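(* Let $\Lambda$ be a rank $r$ graph satisfying condition (F), let $X$ be the spectrum of the diagonal of its two-sided Toeplitz algebra, and let $Z=\{(x,y)\in X\times\Lambda^\infty:s(x)=t(y)\}$. 1. The maps ($m\in\mathbb{N}^r$) $$T_m:\{(x,y)\in Z:\ x=x'x'',\ \sigma(x'')=m\}\to Z,\qquad T_m(x,y)=(x',x''y),$$ $$V_m:Z\to Z,\qquad V_m(x,y)=\bigl(L_m(x\,y(0,m)),\,L_m(y)\bigr),$$ define a multiply generated dynamical system $(T,V)$ on $Z$ (an action of $\mathbb{N}^{2r}=\mathbb{N}^r\times\mathbb{N}^r$ with generators $T_{e_1},\ldots,T_{e_r},V_{e_1},\ldots,V_{e_r}$) which satisfies the condition (DC). 2. The exit time of $T$ agrees with the extended shape: $\sup\{m\in\mathbb{N}^r:(x,y)\in\mathrm{dom}(T_m)\}=\sigma(x)$ for all $(x,y)\in Z$.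
   Context: Graphs. A rank $r$ graph $(\Lambda,\sigma)$ is a small category (source $s$, terminus $t$; $\lambda\mu$ defined when $s(\lambda)=t(\mu)$) with a functor $\sigma:\Lambda\to\mathbb{N}^r$ (shape) having unique factorization: if $\sigma(\lambda)=m+n$ there are unique $\mu,\nu$ with $\lambda=\mu\nu$, $\sigma(\mu)=m$, $\sigma(\nu)=n$. $\Lambda^0$ is the set of objects (morphisms of shape $0$). Condition (F): for every $n\in\mathbb{N}^r$, $\{\lambda:\sigma(\lambda)=n\}$ is nonempty and finite, and for every object $v$ there are finitely many, and at least one, morphisms of shape $n$ with source $v$, and likewise with terminus $v$. $\overline{\mathbb{N}}=\mathbb{N}\cup\{\infty\}$. The space $X$. $\Lambda^*$ is the set of morphisms of nonzero shape; $\overline{\Lambda}=\{\Omega\}\cup\Lambda^*$ where $\Omega\notin\Lambda^*$ is a symbol with $\sigma(\Omega)=0$. On $\ell^2(\overline{\Lambda})$ (basis $\delta_\mu$, $\delta_\Omega=\Omega$), for $\lambda\in\Lambda^*$: $L_\lambda\delta_\mu=\delta_{\lambda\mu}$ if $s(\lambda)=t(\mu)$, $0$ otherwise; $R_\lambda\delta_\mu=\delta_{\mu\lambda}$ if $s(\mu)=t(\lambda)$, $0$ otherwise; $L_\lambda\Omega=R_\lambda\Omega=\delta_\lambda$. $\mathcal{E}=C^*(L_\lambda,R_\lambda;\lambda\in\Lambda^* )$ and $X$ is the Gelfand spectrum of $\mathcal{E}\cap\ell^\infty(\overline{\Lambda})$ ($\ell^\infty(\overline{\Lambda})$ = diagonal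 operators). $\overline{\Lambda}$ is an open dense discrete subset of $X$. By Gelfand duality $f\mapsto L_\lambda fL_\lambda^*$ and $f\mapsto R_\lambda fR_\lambda^*$ give homeomorphisms $l_\lambda$, $r_\lambda$ between clopen subsets of $X$ extending $\mu\mapsto\lambda\mu$, $\mu\mapsto\mu\lambda$ on $\overline{\Lambda}$ (with $\lambda\Omega=\Omega\lambda=\lambda$); write $\lambda x=l_\lambda(x)$, $x\lambda=r_\lambda(x)$, and $\Omega x=x\Omega=x$. The shape extends to a continuous map $\sigma:X\to\overline{\mathbb{N}}^r$, and $s,t$ extend continuously from $\Lambda^*$ to $X\setminus\{\Omega\}$; by convention $\Omega$ is composable with everything, so $(\Omega,y)\in Z$ for all $y\in\Lambda^\infty$. For $x\in X$ with $\sigma(x)\ge m$ there are unique factorizations $x=\lambda x_1=x_2\mu$ with $\lambda,\mu\in\overline{\Lambda}$, $\sigma(\lambda)=\sigma(\mu)=m$, $x_1,x_2\in X$; define $L_mx=x_1$ and $R_mx=x_2$. In the definition of $T_m$, $x=x'x''$ is this right factorization with $x''\in\overline{\Lambda}$, $\sigma(x'')=m$, $x'=R_mx$; so $\mathrm{dom}(T_m)=\{(x,y)\in Z:\sigma(x)\ge m\}$. Infinite paths. $\Lambda^\infty$ is the set of shape-preserving functors $y$ from the rank $r$ graph $\{(n,n')\in\mathbb{N}^r\times\mathbb{N}^r:n\le n'\}$ (with $t(n,n')=n$, $s(n,n')=n'$, $(n,k)(k,p)=(n,p)$, shape $n'-n$) to $\Lambda$, topologized by the cylinder sets $\{y:y(0,k)=\lambda\}$;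 $t(y)=y(0,0)$; $L_m(y)(n,n')=y(n+m,n'+m)$; $\lambda y$ is concatenation, $\Omega y=y$; when $m=0$, $x\,y(0,0)$ is understood as $x$. Dynamical systems. Partial maps are composed on natural domains, $\mathrm{dom}(AB)=\{x\in\mathrm{dom}(B):B(x)\in\mathrm{dom}(A)\}$; they commute if $\mathrm{dom}(AB)=\mathrm{dom}(BA)$ and $AB=BA$ there. A multiply generated dynamical system on a space is a finite system $(S_1,\dots,S_q)$ of pairwise commuting partial maps, each a local homeomorphism from an open set onto an open set; $S^n=S_1^{n_1}\cdots S_q^{n_q}$ for $n\in\mathbb{N}^q$. (DC): $\mathrm{dom}(S^n)\cap\mathrm{dom}(S^m)\subset\mathrm{dom}(S^{n\vee m})$ for all $m,n\in\mathbb{N}^q$, with $n\vee m$ the componentwise maximum. *)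

theory Defs
  imports "HOL-Analysis.Analysis" "HOL-Library.Function_Algebras"
begin

section \<open>Rank \<open>r\<close> graphs\<close>

text \<open>The rank is the cardinality of the finite index type \<open>'r\<close>, and a shape in
  \<open>\<nat>\<^sup>r\<close> is a function \<open>'r \<Rightarrow> nat\<close>; sum, order and supremum of shapes are
  the pointwise ones. Objects are identified with their identity morphisms.\<close>

type_synonym 'r shp = "'r \<Rightarrow> nat"

record ('a, 'r) kgraph =
  mor :: "'a set"
  src :: "'a \<Rightarrow> 'a"
  tgt :: "'a \<Rightarrow> 'a"
  comp :: "'a \<Rightarrow> 'a \<Rightarrow> 'a"
  shape :: "'a \<Rightarrow> 'r shp"

definition small_category :: "('a, 'r) kgraph \<Rightarrow> bool" where
  "small_category G \<longleftrightarrow>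
     (\<forall>\<mu>\<in>mor G. src G \<mu> \<in> mor G \<and> tgt G \<mu> \<in> mor G \<and>
        src G (src G \<mu>) = src G \<mu> \<and> tgt G (src G \<mu>) = src G \<mu> \<and>
        src G (tgt G \<mu>) = tgt G \<mu> \<and> tgt G (tgt G \<mu>) = tgt G \<mu> \<and>
        comp G \<mu> (src G \<mu>) = \<mu> \<and> comp G (tgt G \<mu>) \<mu> = \<mu>) \<and>
     (\<forall>\<mu>\<in>mor G. \<forall>\<nu>\<in>mor G. src G \<mu> = tgt G \<nu> \<longrightarrow>
        comp G \<mu> \<nu> \<in> mor G \<and> src G (comp G \<mu> \<nu>) = src G \<nu> \<and> tgt G (comp G \<mu> \<nu>) = tgt G \<mu>) \<and>
     (\<forall>\<mu>\<in>mor G. \<forall>\<nu>\<in>mor G. \<forall>\<rho>\<in>mor G. src G \<mu> = tgt G \<nu> \<and> src G \<nu> = tgt G \<rho> \<longrightarrow>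
        comp G (comp G \<mu> \<nu>) \<rho> = comp G \<mu> (comp G \<nu> \<rho>))"

definition rank_graph :: "('a, 'r::finite) kgraph \<Rightarrow> bool" where
  "rank_graph G \<longleftrightarrow> small_category G \<and>
     (\<forall>\<mu>\<in>mor G. shape G (src G \<mu>) = 0 \<and> shape G (tgt G \<mu>) = 0) \<and>
     (\<forall>\<mu>\<in>mor G. \<forall>\<nu>\<in>mor G. src G \<mu> = tgt G \<nu> \<longrightarrow>
        shape G (comp G \<mu> \<nu>) = shape G \<mu> + shape G \<nu>) \<and>
     (\<forall>\<rho>\<in>mor G. \<forall>m n. shape G \<rho> = m + n \<longrightarrow>
        (\<exists>!p. p \<in> mor G \<times> mor G \<and> src G (fst p) = tgt G (snd p) \<and> \<rho> = comp G (fst p) (snd p) \<and>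
              shape G (fst p) = m \<and> shape G (snd p) = n))"

definition objs :: "('a, 'r) kgraph \<Rightarrow> 'a set" where
  "objs G = {v \<in> mor G. shape G v = 0}"

lemma objs_eq_identities:
  assumes "rank_graph G"
  shows "objs G = {v \<in> mor G. src G v = v}"
proof (intro equalityI subsetI)
  fix v assume "v \<in> objs G"
  then have v: "v \<in> mor G" "shape G v = 0 + 0" by (auto simp: objs_def)
  then have "\<exists>!p. p \<in> mor G \<times> mor G \<and> src G (fst p) = tgt G (snd p) \<and> v = comp G (fst p) (snd p) \<and>
              shape G (fst p) = 0 \<and> shape G (snd p) = 0"
    using assms unfolding rank_graph_def by blast
  moreover have "(v, src G v) \<in> mor G \<times> mor G \<and> src G v = tgt G (src G v) \<and>
      v = comp G v (src G v) \<and> shape G v = 0 \<and> shape G (src G v) = 0"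
    using assms v unfolding rank_graph_def small_category_def by auto
  moreover have "(tgt G v, v) \<in> mor G \<times> mor G \<and> src G (tgt G v) = tgt G v \<and>
      v = comp G (tgt G v) v \<and> shape G (tgt G v) = 0 \<and> shape G v = 0"
    using assms v unfolding rank_graph_def small_category_def by auto
  ultimately have "(v, src G v) = (tgt G v, v)" by (metis (no_types, lifting) fst_conv snd_conv)
  then show "v \<in> {v \<in> mor G. src G v = v}" using v by auto
next
  fix v assume "v \<in> {v \<in> mor G. src G v = v}"
  then show "v \<in> objs G" using assms unfolding rank_graph_def objs_def by force
qed

definition cond_F :: "('a, 'r::finite) kgraph \<Rightarrow> bool" where
  "cond_F G \<longleftrightarrow> (\<forall>n.
     finite {\<mu>\<in>mor G. shape G \<mu> = n} \<and> {\<mu>\<in>mor G. shape G \<mu> = n} \<noteq> {} \<and>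
     (\<forall>v\<in>objs G.
        finite {\<mu>\<in>mor G. shape G \<mu> = n \<and> src G \<mu> = v} \<and> {\<mu>\<in>mor G. shape G \<mu> = n \<and> src G \<mu> = v} \<noteq> {} \<and>
        finite {\<mu>\<in>mor G. shape G \<mu> = n \<and> tgt G \<mu> = v} \<and> {\<mu>\<in>mor G. shape G \<mu> = n \<and> tgt G \<mu> = v} \<noteq> {}))"

section \<open>Infinite paths\<close>

definition grid :: "('r shp \<times> 'r shp, 'r) kgraph" where
  "grid = \<lparr> mor = {(n, n'). n \<le> n'}, src = (\<lambda>(n, n'). (n', n')), tgt = (\<lambda>(n, n'). (n, n)),
            comp = (\<lambda>(n, k) (k', p). (n, p)), shape = (\<lambda>(n, n'). n' - n) \<rparr>"

text \<open>Shape-preserving functors; extensionality makes a functor determined by its values on morphisms.\<close>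

definition graph_functors :: "('b, 'r) kgraph \<Rightarrow> ('a, 'r) kgraph \<Rightarrow> ('b \<Rightarrow> 'a) set" where
  "graph_functors H G = {y \<in> mor H \<rightarrow>\<^sub>E mor G.
     (\<forall>\<mu>\<in>mor H. src G (y \<mu>) = y (src H \<mu>) \<and> tgt G (y \<mu>) = y (tgt H \<mu>) \<and> shape G (y \<mu>) = shape H \<mu>) \<and>
     (\<forall>\<mu>\<in>mor H. \<forall>\<nu>\<in>mor H. src H \<mu> = tgt H \<nu> \<longrightarrow> y (comp H \<mu> \<nu>) = comp G (y \<mu>) (y \<nu>))}"

type_synonym ('a, 'r) path = "'r shp \<times> 'r shp \<Rightarrow> 'a"

definition paths :: "('a, 'r) kgraph \<Rightarrow> ('a, 'r) path set" where
  "paths G = graph_functors grid G"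

definition path_topology :: "('a, 'r) kgraph \<Rightarrow> ('a, 'r) path topology" where
  "path_topology G = topology_generated_by {{y \<in> paths G. y (0, k) = \<mu>} |k \<mu>. \<mu> \<in> mor G}"

definition shift :: "'r shp \<Rightarrow> ('a, 'r) path \<Rightarrow> ('a, 'r) path" where
  "shift m y = restrict (\<lambda>(n, n'). y (n + m, n' + m)) {(n, n'). n \<le> n'}"

section \<open>The Hilbert space \<open>\<ell>\<^sup>2(I)\<close> and its operators\<close>

text \<open>Vectors of \<open>\<ell>\<^sup>2(I)\<close> vanish outside \<open>I\<close>, and operators on it are
  functions that are \<open>0\<close> outside \<open>\<ell>\<^sup>2(I)\<close>. Hence sums and
  composites of operators are the pointwise sum and \<open>\<circ>\<close>.\<close>

type_synonym 'b vec2 = "'b \<Rightarrow> complex"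
type_synonym 'b oper = "'b vec2 \<Rightarrow> 'b vec2"

definition ell2 :: "'b set \<Rightarrow> 'b vec2 set" where
  "ell2 I = {\<xi>. (\<forall>\<mu>. \<mu> \<notin> I \<longrightarrow> \<xi> \<mu> = 0) \<and> (\<lambda>\<mu>. (cmod (\<xi> \<mu>))\<^sup>2) summable_on I}"

definition ell2_inner :: "'b set \<Rightarrow> 'b vec2 \<Rightarrow> 'b vec2 \<Rightarrow> complex" where
  "ell2_inner I \<xi> \<eta> = (\<Sum>\<^sub>\<infinity>\<mu>\<in>I. \<xi> \<mu> * cnj (\<eta> \<mu>))"

definition ell2_norm :: "'b set \<Rightarrow> 'b vec2 \<Rightarrow> real" where
  "ell2_norm I \<xi> = sqrt (\<Sum>\<^sub>\<infinity>\<mu>\<in>I. (cmod (\<xi> \<mu>))\<^sup>2)"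

definition delta :: "'b \<Rightarrow> 'b vec2" where
  "delta \<mu> = (\<lambda>\<nu>. if \<nu> = \<mu> then 1 else 0)"

definition scale :: "complex \<Rightarrow> 'b oper \<Rightarrow> 'b oper" where
  "scale c A = (\<lambda>\<xi> \<mu>. c * A \<xi> \<mu>)"

definition bounded_ops :: "'b set \<Rightarrow> 'b oper set" where
  "bounded_ops I = {A. (\<forall>\<xi>. \<xi> \<notin> ell2 I \<longrightarrow> A \<xi> = 0) \<and> (\<forall>\<xi>\<in>ell2 I. A \<xi> \<in> ell2 I) \<and>
     (\<forall>\<xi>\<in>ell2 I. \<forall>\<eta>\<in>ell2 I. A (\<xi> + \<eta>) = A \<xi> + A \<eta>) \<and>
     (\<forall>\<xi>\<in>ell2 I. \<forall>c. A (\<lambda>\<mu>. c * \<xi> \<mu>) = (\<lambda>\<mu>. c * A \<xi> \<mu>)) \<and>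
     (\<exists>C. \<forall>\<xi>\<in>ell2 I. ell2_norm I (A \<xi>) \<le> C * ell2_norm I \<xi>)}"

definition adj :: "'b set \<Rightarrow> 'b oper \<Rightarrow> 'b oper" where
  "adj I A = (THE B. B \<in> bounded_ops I \<and>
     (\<forall>\<xi>\<in>ell2 I. \<forall>\<eta>\<in>ell2 I. ell2_inner I (A \<xi>) \<eta> = ell2_inner I \<xi> (B \<eta>)))"

text \<open>The last clause is closedness in operator norm: \<open>\<parallel>A - B\<parallel> \<le> \<epsilon>\<close> is written out pointwise.\<close>

definition cstar_subalgebra :: "'b set \<Rightarrow> 'b oper set \<Rightarrow> bool" where
  "cstar_subalgebra I S \<longleftrightarrow> S \<subseteq> bounded_ops I \<and> 0 \<in> S \<and>
     (\<forall>A\<in>S. \<forall>B\<in>S. A + B \<in> S \<and> A \<circ> B \<in> S) \<and>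
     (\<forall>A\<in>S. \<forall>c. scale c A \<in> S) \<and> (\<forall>A\<in>S. adj I A \<in> S) \<and>
     (\<forall>A\<in>bounded_ops I.
        (\<forall>\<epsilon>>0. \<exists>B\<in>S. \<forall>\<xi>\<in>ell2 I. ell2_norm I (\<lambda>\<mu>. A \<xi> \<mu> - B \<xi> \<mu>) \<le> \<epsilon> * ell2_norm I \<xi>) \<longrightarrow> A \<in> S)"

definition cstar_generated :: "'b set \<Rightarrow> 'b oper set \<Rightarrow> 'b oper set" where
  "cstar_generated I S = \<Inter>{B. cstar_subalgebra I B \<and> S \<subseteq> B}"

definition diagonal_ops :: "'b set \<Rightarrow> 'b oper set" where
  "diagonal_ops I = {(\<lambda>\<xi>. if \<xi> \<in> ell2 I then (\<lambda>\<mu>. f \<mu> * \<xi> \<mu>) else 0) |f. \<exists>C. \<forall>\<mu>\<in>I. cmod (f \<mu>) \<le> C}"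

definition op_on_basis :: "'b set \<Rightarrow> ('b \<Rightarrow> 'b vec2) \<Rightarrow> 'b oper" where
  "op_on_basis I \<phi> = (THE A. A \<in> bounded_ops I \<and> (\<forall>\<mu>\<in>I. A (delta \<mu>) = \<phi> \<mu>))"

section \<open>Gelfand spectra\<close>

text \<open>Nonzero multiplicative linear functionals on a commutative \<open>C\<^sup>*\<close>-algebra of operators,
  with the topology of pointwise convergence.\<close>

definition characters :: "'b oper set \<Rightarrow> ('b oper \<Rightarrow> complex) set" where
  "characters D = {\<omega> \<in> extensional D.
     (\<forall>A\<in>D. \<forall>B\<in>D. \<omega> (A + B) = \<omega> A + \<omega> B \<and> \<omega> (A \<circ> B) = \<omega> A * \<omega> B) \<and>
     (\<forall>A\<in>D. \<forall>c. \<omega> (scale c A) = c * \<omega> A) \<and> (\<exists>A\<in>D. \<omega> A \<noteq> 0)}"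

definition spectrum_topology :: "'b oper set \<Rightarrow> ('b oper \<Rightarrow> complex) topology" where
  "spectrum_topology D = subtopology (product_topology (\<lambda>_. euclidean) D) (characters D)"

text \<open>The partial map of the spectrum of \<open>D\<close> that is Gelfand dual to \<open>f \<mapsto> S f S\<^sup>*\<close>, for a partial isometry
  \<open>S\<close>: it sends \<open>\<omega>\<close> to the character \<open>\<omega>'\<close> with
  \<open>\<omega>' (S f S\<^sup>*) = \<omega> f\<close>, and is defined where there is exactly one such character.
  When \<open>D\<close> is unital and is preserved by conjugation with \<open>S\<close> and \<open>S\<^sup>*\<close>, that is the
  set where \<open>\<omega> (S\<^sup>* S) = 1\<close>, since \<open>S f S\<^sup>* = 0\<close> for \<open>f = 1 - S\<^sup>* S\<close>.\<close>

definition dual_map :: "'b set \<Rightarrow> 'b oper set \<Rightarrow> 'b oper \<Rightarrow> ('b oper \<Rightarrow> complex) \<rightharpoonup> ('b oper \<Rightarrow> complex)" where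
  "dual_map I D S \<omega> =
     (if \<omega> \<in> characters D \<and> (\<exists>!\<omega>'. \<omega>' \<in> characters D \<and> (\<forall>f\<in>D. \<omega>' (S \<circ> f \<circ> adj I S) = \<omega> f))
      then Some (THE \<omega>'. \<omega>' \<in> characters D \<and> (\<forall>f\<in>D. \<omega>' (S \<circ> f \<circ> adj I S) = \<omega> f))
      else None)"

section \<open>The space \<open>X\<close>\<close>

text \<open>\<open>\<Omega>\<close> is \<open>None\<close>; it replaces all objects of the graph.\<close>

definition bar :: "('a, 'r) kgraph \<Rightarrow> 'a option set" where
  "bar G = insert None (Some ` {\<mu>\<in>mor G. shape G \<mu> \<noteq> 0})"

definition bar_shape :: "('a, 'r) kgraph \<Rightarrow> 'a option \<Rightarrow> 'r shp" where
  "bar_shape G \<mu> = (case \<mu> of None \<Rightarrow> 0 | Some a \<Rightarrow> shape G a)"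

fun bar_comp :: "('a, 'r) kgraph \<Rightarrow> 'a option \<Rightarrow> 'a option \<Rightarrow> 'a option" where
  "bar_comp G None \<nu> = \<nu>"
| "bar_comp G \<mu> None = \<mu>"
| "bar_comp G (Some a) (Some b) = Some (comp G a b)"

fun bar_composable :: "('a, 'r) kgraph \<Rightarrow> 'a option \<Rightarrow> 'a option \<Rightarrow> bool" where
  "bar_composable G (Some a) (Some b) \<longleftrightarrow> src G a = tgt G b"
| "bar_composable G _ _ \<longleftrightarrow> True"

definition to_bar :: "('a, 'r) kgraph \<Rightarrow> 'a \<Rightarrow> 'a option" where
  "to_bar G a = (if shape G a = 0 then None else Some a)"

definition L_op :: "('a, 'r) kgraph \<Rightarrow> 'a \<Rightarrow> 'a option oper" where
  "L_op G a = op_on_basis (bar G)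
     (\<lambda>\<mu>. if bar_composable G (Some a) \<mu> then delta (bar_comp G (Some a) \<mu>) else 0)"

definition R_op :: "('a, 'r) kgraph \<Rightarrow> 'a \<Rightarrow> 'a option oper" where
  "R_op G a = op_on_basis (bar G)
     (\<lambda>\<mu>. if bar_composable G \<mu> (Some a) then delta (bar_comp G \<mu> (Some a)) else 0)"

definition toeplitz_algebra :: "('a, 'r) kgraph \<Rightarrow> 'a option oper set" where
  "toeplitz_algebra G = cstar_generated (bar G)
     (L_op G ` {a\<in>mor G. shape G a \<noteq> 0} \<union> R_op G ` {a\<in>mor G. shape G a \<noteq> 0})"

definition diag_algebra :: "('a, 'r) kgraph \<Rightarrow> 'a option oper set" where
  "diag_algebra G = toeplitz_algebra G \<inter> diagonal_ops (bar G)"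

type_synonym 'a xpoint = "'a option oper \<Rightarrow> complex"

definition X_topology :: "('a, 'r) kgraph \<Rightarrow> 'a xpoint topology" where
  "X_topology G = spectrum_topology (diag_algebra G)"

abbreviation X_space :: "('a, 'r) kgraph \<Rightarrow> 'a xpoint set" where
  "X_space G \<equiv> topspace (X_topology G)"

text \<open>The embedding of \<open>\<Lambda>\<close>-bar in \<open>X\<close>: the diagonal operator with entries \<open>f\<close> is sent to \<open>f \<mu>\<close>.\<close>

definition emb :: "('a, 'r) kgraph \<Rightarrow> 'a option \<Rightarrow> 'a xpoint" where
  "emb G \<mu> = restrict (\<lambda>A. A (delta \<mu>) \<mu>) (diag_algebra G)"

abbreviation Omega :: "('a, 'r) kgraph \<Rightarrow> 'a xpoint" where
  "Omega G \<equiv> emb G None"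

definition lmult :: "('a, 'r) kgraph \<Rightarrow> 'a option \<Rightarrow> 'a xpoint \<rightharpoonup> 'a xpoint" where
  "lmult G \<mu> = (case \<mu> of None \<Rightarrow> Some |` X_space G | Some a \<Rightarrow> dual_map (bar G) (diag_algebra G) (L_op G a))"

definition rmult :: "('a, 'r) kgraph \<Rightarrow> 'a option \<Rightarrow> 'a xpoint \<rightharpoonup> 'a xpoint" where
  "rmult G \<mu> = (case \<mu> of None \<Rightarrow> Some |` X_space G | Some a \<Rightarrow> dual_map (bar G) (diag_algebra G) (R_op G a))"

definition cont_extension ::
  "'x topology \<Rightarrow> 'y topology \<Rightarrow> ('b \<Rightarrow> 'x) \<Rightarrow> 'b set \<Rightarrow> ('b \<Rightarrow> 'y) \<Rightarrow> 'x \<Rightarrow> 'y" where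
  "cont_extension X Y \<iota> B f =
     (THE g. g \<in> extensional (topspace X) \<and> continuous_map X Y g \<and> (\<forall>b\<in>B. g (\<iota> b) = f b))"

text \<open>\<open>euclidean\<close> is here the product over \<open>'r\<close> of the order topology of \<open>enat\<close>.\<close>

definition X_shape :: "('a, 'r::finite) kgraph \<Rightarrow> 'a xpoint \<Rightarrow> 'r \<Rightarrow> enat" where
  "X_shape G = cont_extension (X_topology G) euclidean (emb G) (bar G) (\<lambda>\<mu> i. enat (bar_shape G \<mu> i))"

definition X_src :: "('a, 'r) kgraph \<Rightarrow> 'a xpoint \<Rightarrow> 'a" where
  "X_src G = cont_extension (subtopology (X_topology G) (X_space G - {Omega G})) (discrete_topology (objs G))
     (\<lambda>a. emb G (Some a)) {a\<in>mor G. shape G a \<noteq> 0} (src G)"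

definition left_factorization :: "('a, 'r) kgraph \<Rightarrow> 'r shp \<Rightarrow> 'a xpoint \<Rightarrow> 'a option \<Rightarrow> 'a xpoint \<Rightarrow> bool" where
  "left_factorization G m x \<mu> x1 \<longleftrightarrow> \<mu> \<in> bar G \<and> bar_shape G \<mu> = m \<and> lmult G \<mu> x1 = Some x"

definition right_factorization :: "('a, 'r) kgraph \<Rightarrow> 'r shp \<Rightarrow> 'a xpoint \<Rightarrow> 'a xpoint \<Rightarrow> 'a option \<Rightarrow> bool" where
  "right_factorization G m x x2 \<mu> \<longleftrightarrow> \<mu> \<in> bar G \<and> bar_shape G \<mu> = m \<and> rmult G \<mu> x2 = Some x"

definition L_shift :: "('a, 'r) kgraph \<Rightarrow> 'r shp \<Rightarrow> 'a xpoint \<Rightarrow> 'a xpoint" where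
  "L_shift G m x = (THE x1. \<exists>\<mu>. left_factorization G m x \<mu> x1)"

section \<open>The space \<open>Z\<close> and the maps \<open>T\<^sub>m\<close>, \<open>V\<^sub>m\<close>\<close>

definition Z_set :: "('a, 'r) kgraph \<Rightarrow> ('a xpoint \<times> ('a, 'r) path) set" where
  "Z_set G = {(x, y). x \<in> X_space G \<and> y \<in> paths G \<and> (x = Omega G \<or> X_src G x = y (0, 0))}"

definition Z_topology :: "('a, 'r) kgraph \<Rightarrow> ('a xpoint \<times> ('a, 'r) path) topology" where
  "Z_topology G = subtopology (prod_topology (X_topology G) (path_topology G)) (Z_set G)"

text \<open>\<open>\<mu>y\<close> is the infinite path whose initial segment is \<open>\<mu>\<close> and whose remaining part is \<open>y\<close>.\<close>

definition concat_path :: "('a, 'r) kgraph \<Rightarrow> 'a option \<Rightarrow> ('a, 'r) path \<Rightarrow> ('a, 'r) path" where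
  "concat_path G \<mu> y = (case \<mu> of None \<Rightarrow> y
     | Some a \<Rightarrow> (THE y'. y' \<in> paths G \<and> y' (0, shape G a) = a \<and> shift (shape G a) y' = y))"

definition T_map :: "('a, 'r) kgraph \<Rightarrow> 'r shp \<Rightarrow>
    'a xpoint \<times> ('a, 'r) path \<rightharpoonup> 'a xpoint \<times> ('a, 'r) path" where
  "T_map G m = (\<lambda>(x, y).
     if (x, y) \<in> Z_set G \<and> (\<exists>x' x''. right_factorization G m x x' x'')
     then (case (THE p. right_factorization G m x (fst p) (snd p)) of
             (x', x'') \<Rightarrow> Some (x', concat_path G x'' y))
     else None)"

definition V_map :: "('a, 'r) kgraph \<Rightarrow> 'r shp \<Rightarrow>
    'a xpoint \<times> ('a, 'r) path \<rightharpoonup> 'a xpoint \<times> ('a, 'r) path" where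
  "V_map G m = (\<lambda>(x, y).
     if (x, y) \<in> Z_set G
     then Some (L_shift G m (the (rmult G (to_bar G (y (0, m))) x)), shift m y)
     else None)"

section \<open>Multiply generated dynamical systems\<close>

text \<open>Partial maps are composed by \<open>\<circ>\<^sub>m\<close>, so that an equation between composites includes
  equality of the natural domains. A system is a family \<open>S\<close> indexed by a finite type \<open>'i\<close>;
  \<open>'i \<Rightarrow> nat\<close> is the semigroup acting.\<close>

definition local_homeo :: "'z topology \<Rightarrow> ('z \<rightharpoonup> 'z) \<Rightarrow> bool" where
  "local_homeo Z f \<longleftrightarrow> openin Z (dom f) \<and> openin Z (ran f) \<and>
     (\<forall>p\<in>dom f. \<exists>U. p \<in> U \<and> U \<subseteq> dom f \<and> openin Z U \<and> openin Z ((the \<circ> f) ` U) \<and>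
        homeomorphic_map (subtopology Z U) (subtopology Z ((the \<circ> f) ` U)) (the \<circ> f))"

definition mg_system :: "'z topology \<Rightarrow> ('i::finite \<Rightarrow> 'z \<rightharpoonup> 'z) \<Rightarrow> bool" where
  "mg_system Z S \<longleftrightarrow> (\<forall>i. local_homeo Z (S i)) \<and> (\<forall>i j. S i \<circ>\<^sub>m S j = S j \<circ>\<^sub>m S i)"

text \<open>The composite of all the powers \<open>S\<^sub>i\<^bsup>n i\<^esup>\<close>, with \<open>S\<^sup>0\<close> the identity of \<open>Z\<close>. The fold
  is well defined, independently of the order of the factors, when the \<open>S\<^sub>i\<close> commute.\<close>

definition mg_power :: "'z topology \<Rightarrow> ('i::finite \<Rightarrow> 'z \<rightharpoonup> 'z) \<Rightarrow> ('i \<Rightarrow> nat) \<Rightarrow> 'z \<rightharpoonup> 'z" where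
  "mg_power Z S n = Finite_Set.fold (\<lambda>i F. ((\<lambda>H. S i \<circ>\<^sub>m H) ^^ n i) F) (Some |` topspace Z) UNIV"

definition DC :: "'z topology \<Rightarrow> ('i::finite \<Rightarrow> 'z \<rightharpoonup> 'z) \<Rightarrow> bool" where
  "DC Z S \<longleftrightarrow>
     (\<forall>m n. dom (mg_power Z S n) \<inter> dom (mg_power Z S m) \<subseteq> dom (mg_power Z S (sup n m)))"

definition unit_shape :: "'r \<Rightarrow> 'r shp" where
  "unit_shape i = (\<lambda>j. if j = i then 1 else 0)"

definition TV_system :: "('a, 'r) kgraph \<Rightarrow> 'r + 'r \<Rightarrow>
    'a xpoint \<times> ('a, 'r) path \<rightharpoonup> 'a xpoint \<times> ('a, 'r) path" where
  "TV_system G = case_sum (\<lambda>i. T_map G (unit_shape i)) (\<lambda>i. V_map G (unit_shape i))"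

end

theory Submission
  imports Defs
begin

text \<open>
  The diagonal of the Toeplitz algebra is an algebra of bounded functions on \<open>\<Lambda>\<close>-bar. It contains the
  indicators of the domains and ranges of the partial injections \<open>\<mu> \<mapsto> \<lambda>\<mu>\<close> and \<open>\<mu> \<mapsto> \<mu>\<lambda>\<close>, and it is
  invariant under pulling back along them and their inverses. Hence these maps extend to homeomorphisms
  between clopen subsets of \<open>X\<close>, functorially, so every identity between such partial maps of
  \<open>\<Lambda>\<close>-bar (associativity, unique factorization) holds on \<open>X\<close> as well.

  The map \<open>T\<^sub>m\<close> is the inverse of the everywhere defined map \<open>(x, y) \<mapsto> (x y(0,m), L\<^sub>m y)\<close> of \<open>Z\<close>, and \<open>V\<^sub>m\<close>
  is that map followed by \<open>L\<^sub>m\<close> on the first component. Where \<open>y(0,m)\<close> and the left factor split off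
  by \<open>L\<^sub>m\<close> are constant, both are given by the partial homeomorphisms of \<open>X\<close> together with a shift or a
  concatenation of paths, so they are local homeomorphisms. Since \<open>V\<^sub>n\<close> is total, the domain of
  \<open>T\<^sup>m V\<^sup>n\<close> is the set where \<open>\<sigma>(x) \<ge> m\<close>, which gives both (DC) and the exit time.
\<close>

section \<open>Operators on \<open>\<ell>\<^sup>2(I)\<close>\<close>

text \<open>Most objects of the statement are definite descriptions (\<open>adj\<close>,
  \<open>op_on_basis\<close>, \<open>dual_map\<close>, \<open>cont_extension\<close>,
  \<open>L_shift\<close>, \<open>concat_path\<close>), so each must be pinned down by a candidate
  together with a uniqueness proof. For operators uniqueness comes from the basis vectors, for
  continuous extensions from the density of \<Lambda>-bar in X. Density is the one analytic point:
  characters are only assumed nonzero, linear and multiplicative. If finitely many values of a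
  character could not be approximated at a point, the sum of the squared deviations would be bounded
  below, hence invertible in the algebra, although the character kills it. The rest is Boolean. The
  elements of shape at least m are covered by the ranges of the multiplications by elements of shape
  m, finitely many by (F); an ultrafilter containing this union contains one of the ranges, which
  gives factorizations in X, and disjointness of the ranges gives their uniqueness. Collapsing all
  objects to \<Omega> has a price: the sets of elements with a given source all contain \<Omega>,
  and they separate only the other points of X.\<close>

definition diag_op :: "'b set \<Rightarrow> ('b \<Rightarrow> complex) \<Rightarrow> 'b oper" where
  "diag_op I f = (\<lambda>\<xi>. if \<xi> \<in> ell2 I then (\<lambda>\<mu>. f \<mu> * \<xi> \<mu>) else 0)"

definition symbol :: "'b oper \<Rightarrow> 'b \<Rightarrow> complex" where
  "symbol A = (\<lambda>\<mu>. A (delta \<mu>) \<mu>)"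

definition pull :: "('b \<rightharpoonup> 'b) \<Rightarrow> ('b \<Rightarrow> complex) \<Rightarrow> 'b \<Rightarrow> complex" where
  "pull \<phi> f = (\<lambda>\<mu>. case \<phi> \<mu> of None \<Rightarrow> 0 | Some \<nu> \<Rightarrow> f \<nu>)"

definition pull_op :: "'b set \<Rightarrow> ('b \<rightharpoonup> 'b) \<Rightarrow> 'b oper" where
  "pull_op I \<phi> = (\<lambda>\<xi>. if \<xi> \<in> ell2 I then pull \<phi> \<xi> else 0)"

text \<open>If \<open>\<psi>\<close> is the inverse of \<open>\<phi>\<close>, then \<open>pull_op I \<psi>\<close> is the partial isometry that maps
  \<open>\<delta>\<^sub>\<mu>\<close> to \<open>\<delta>\<^bsub>\<phi> \<mu>\<^esub>\<close>, and its adjoint is \<open>pull_op I \<phi>\<close>.\<close>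

definition pinv :: "'b set \<Rightarrow> ('b \<rightharpoonup> 'b) \<Rightarrow> ('b \<rightharpoonup> 'b) \<Rightarrow> bool" where
  "pinv I \<phi> \<psi> \<longleftrightarrow> dom \<phi> \<subseteq> I \<and> dom \<psi> \<subseteq> I \<and> (\<forall>\<mu> \<nu>. \<phi> \<mu> = Some \<nu> \<longleftrightarrow> \<psi> \<nu> = Some \<mu>)"

lemma pinv_sym: "pinv I \<phi> \<psi> \<Longrightarrow> pinv I \<psi> \<phi>"
  by (auto simp: pinv_def)

lemma zero_in_ell2: "0 \<in> ell2 I"
  by (auto simp: ell2_def)

lemma delta_in_ell2: "\<mu> \<in> I \<Longrightarrow> delta \<mu> \<in> ell2 I"
  unfolding ell2_def
proof (safe)
  assume \<mu>: "\<mu> \<in> I"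
  have "(\<lambda>\<nu>. (cmod (delta \<mu> \<nu>))\<^sup>2) summable_on {\<mu>}" by simp
  then show "(\<lambda>\<nu>. (cmod (delta \<mu> \<nu>))\<^sup>2) summable_on I"
    by (rule summable_on_cong_neutral[THEN iffD1, rotated -1]) (auto simp: delta_def \<mu>)
qed (auto simp: delta_def)

lemma delta_notin_ell2: "\<mu> \<notin> I \<Longrightarrow> delta \<mu> \<notin> ell2 I"
  by (auto simp: ell2_def delta_def)

lemma pinv_bij_betw:
  assumes "pinv I \<phi> \<psi>"
  shows "bij_betw (\<lambda>\<mu>. the (\<psi> \<mu>)) (dom \<psi>) (dom \<phi>)"
proof (rule bij_betw_byWitness[where f' = "\<lambda>\<mu>. the (\<phi> \<mu>)"])
  have iff: "\<phi> \<mu> = Some \<nu> \<longleftrightarrow> \<psi> \<nu> = Some \<mu>" for \<mu> \<nu>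
    using assms by (simp add: pinv_def)
  show "\<forall>a\<in>dom \<psi>. the (\<phi> (the (\<psi> a))) = a" using iff by (metis domIff option.exhaust_sel option.sel)
  show "\<forall>a\<in>dom \<phi>. the (\<psi> (the (\<phi> a))) = a" using iff by (metis domIff option.exhaust_sel option.sel)
  show "(\<lambda>\<mu>. the (\<psi> \<mu>)) ` dom \<psi> \<subseteq> dom \<phi>" using iff by fastforce
  show "(\<lambda>\<mu>. the (\<phi> \<mu>)) ` dom \<phi> \<subseteq> dom \<psi>" using iff by fastforce
qed

text \<open>The substitution \<psi> is a bijection of \<open>dom \<psi>\<close> onto
  \<open>dom \<phi>\<close>, so the squared norm of the pulled back vector is that of \<xi>
  restricted to \<open>dom \<phi>\<close>.\<close>

lemma pull_ell2:
  assumes "pinv I \<phi> \<psi>" "\<xi> \<in> ell2 I"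
  shows "pull \<psi> \<xi> \<in> ell2 I" and "ell2_norm I (pull \<psi> \<xi>) \<le> ell2_norm I \<xi>"
proof -
  have bij: "bij_betw (\<lambda>\<mu>. the (\<psi> \<mu>)) (dom \<psi>) (dom \<phi>)"
    by (rule pinv_bij_betw[OF assms(1)])
  have sub: "dom \<phi> \<subseteq> I" "dom \<psi> \<subseteq> I" using assms(1) by (auto simp: pinv_def)
  have sI: "(\<lambda>\<mu>. (cmod (\<xi> \<mu>))\<^sup>2) summable_on I" using assms(2) by (auto simp: ell2_def)
  have s1: "(\<lambda>\<mu>. (cmod (\<xi> \<mu>))\<^sup>2) summable_on dom \<phi>"
    by (rule summable_on_subset_banach[OF sI sub(1)])
  have s2: "(\<lambda>\<mu>. (cmod (\<xi> (the (\<psi> \<mu>))))\<^sup>2) summable_on dom \<psi>"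
    using summable_on_reindex_bij_betw[OF bij, of "\<lambda>\<mu>. (cmod (\<xi> \<mu>))\<^sup>2"] s1 by blast
  have s3: "(\<lambda>\<mu>. (cmod (pull \<psi> \<xi> \<mu>))\<^sup>2) summable_on I"
    using s2 by (rule summable_on_cong_neutral[THEN iffD1, rotated -1]) 
      (use sub in \<open>auto simp: pull_def split: option.splits\<close>)
  show "pull \<psi> \<xi> \<in> ell2 I"
    using s3 sub unfolding ell2_def by (auto simp: pull_def split: option.splits)
  have "(\<Sum>\<^sub>\<infinity>\<mu>\<in>I. (cmod (pull \<psi> \<xi> \<mu>))\<^sup>2) = (\<Sum>\<^sub>\<infinity>\<mu>\<in>dom \<psi>. (cmod (\<xi> (the (\<psi> \<mu>))))\<^sup>2)"
    by (rule infsum_cong_neutral) (use sub in \<open>auto simp: pull_def split: option.splits\<close>)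
  also have "\<dots> = (\<Sum>\<^sub>\<infinity>\<mu>\<in>dom \<phi>. (cmod (\<xi> \<mu>))\<^sup>2)"
    by (rule infsum_reindex_bij_betw[OF bij])
  also have "\<dots> \<le> (\<Sum>\<^sub>\<infinity>\<mu>\<in>I. (cmod (\<xi> \<mu>))\<^sup>2)"
    by (rule infsum_mono_neutral[OF s1 sI]) (use sub in auto)
  finally show "ell2_norm I (pull \<psi> \<xi>) \<le> ell2_norm I \<xi>"
    unfolding ell2_norm_def by (rule real_sqrt_le_mono)
qed

lemma ell2_add:
  assumes "\<xi> \<in> ell2 I" "\<eta> \<in> ell2 I" shows "\<xi> + \<eta> \<in> ell2 I"
proof -
  have "(\<lambda>\<mu>. 2 * (cmod (\<xi> \<mu>))\<^sup>2 + 2 * (cmod (\<eta> \<mu>))\<^sup>2) summable_on I"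
    using assms by (intro summable_on_add summable_on_cmult_right) (auto simp: ell2_def)
  moreover have "(cmod (\<xi> \<mu> + \<eta> \<mu>))\<^sup>2 \<le> 2 * (cmod (\<xi> \<mu>))\<^sup>2 + 2 * (cmod (\<eta> \<mu>))\<^sup>2" for \<mu>
  proof -
    have "(cmod (\<xi> \<mu> + \<eta> \<mu>))\<^sup>2 \<le> (cmod (\<xi> \<mu>) + cmod (\<eta> \<mu>))\<^sup>2"
      by (intro power_mono norm_triangle_ineq) auto
    also have "\<dots> \<le> 2 * (cmod (\<xi> \<mu>))\<^sup>2 + 2 * (cmod (\<eta> \<mu>))\<^sup>2"
      using sum_squares_bound[of "cmod (\<xi> \<mu>)" "cmod (\<eta> \<mu>)"] by (simp add: power2_sum)
    finally show ?thesis .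
  qed
  ultimately have "(\<lambda>\<mu>. (cmod (\<xi> \<mu> + \<eta> \<mu>))\<^sup>2) summable_on I"
    by (rule summable_on_comparison_test) auto
  then show ?thesis using assms by (auto simp: ell2_def)
qed

lemma ell2_mult:
  assumes "\<xi> \<in> ell2 I" and "\<And>\<mu>. \<mu> \<in> I \<Longrightarrow> cmod (f \<mu>) \<le> C"
  shows "(\<lambda>\<mu>. f \<mu> * \<xi> \<mu>) \<in> ell2 I" and "0 \<le> C \<Longrightarrow> ell2_norm I (\<lambda>\<mu>. f \<mu> * \<xi> \<mu>) \<le> C * ell2_norm I \<xi>"
proof -
  have s: "(\<lambda>\<mu>. C\<^sup>2 * (cmod (\<xi> \<mu>))\<^sup>2) summable_on I"
    using assms(1) by (intro summable_on_cmult_right) (auto simp: ell2_def)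
  have le: "(cmod (f \<mu> * \<xi> \<mu>))\<^sup>2 \<le> C\<^sup>2 * (cmod (\<xi> \<mu>))\<^sup>2" if "\<mu> \<in> I" for \<mu>
    using assms(2)[OF that] by (simp add: norm_mult power_mult_distrib mult_right_mono power_mono)
  have s': "(\<lambda>\<mu>. (cmod (f \<mu> * \<xi> \<mu>))\<^sup>2) summable_on I"
    using s le by (rule summable_on_comparison_test) auto
  then show "(\<lambda>\<mu>. f \<mu> * \<xi> \<mu>) \<in> ell2 I" using assms by (auto simp: ell2_def)
  assume C: "0 \<le> C"
  have "(\<Sum>\<^sub>\<infinity>\<mu>\<in>I. (cmod (f \<mu> * \<xi> \<mu>))\<^sup>2) \<le> (\<Sum>\<^sub>\<infinity>\<mu>\<in>I. C\<^sup>2 * (cmod (\<xi> \<mu>))\<^sup>2)"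
    by (rule infsum_mono[OF s' s le])
  also have "\<dots> = C\<^sup>2 * (\<Sum>\<^sub>\<infinity>\<mu>\<in>I. (cmod (\<xi> \<mu>))\<^sup>2)"
    by (rule infsum_cmult_right')
  finally have "ell2_norm I (\<lambda>\<mu>. f \<mu> * \<xi> \<mu>) \<le> sqrt (C\<^sup>2 * (\<Sum>\<^sub>\<infinity>\<mu>\<in>I. (cmod (\<xi> \<mu>))\<^sup>2))"
    unfolding ell2_norm_def by (rule real_sqrt_le_mono)
  also have "\<dots> = C * ell2_norm I \<xi>"
    using C by (simp add: ell2_norm_def real_sqrt_mult)
  finally show "ell2_norm I (\<lambda>\<mu>. f \<mu> * \<xi> \<mu>) \<le> C * ell2_norm I \<xi>" .
qed

lemma ell2_scale: "\<xi> \<in> ell2 I \<Longrightarrow> (\<lambda>\<mu>. c * \<xi> \<mu>) \<in> ell2 I"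
  by (rule ell2_mult(1)[where C = "cmod c"]) auto

lemma diag_op_bounded:
  assumes "\<And>\<mu>. \<mu> \<in> I \<Longrightarrow> cmod (f \<mu>) \<le> C"
  shows "diag_op I f \<in> bounded_ops I"
proof -
  \<comment> \<open>For empty \<open>I\<close> the constant C may be negative, while the norm
    estimate asks for a nonnegative one.\<close>
  have "\<And>\<mu>. \<mu> \<in> I \<Longrightarrow> cmod (f \<mu>) \<le> \<bar>C\<bar>" using assms by force
  then have "\<forall>\<xi>\<in>ell2 I. ell2_norm I (diag_op I f \<xi>) \<le> \<bar>C\<bar> * ell2_norm I \<xi>"
    by (auto simp: diag_op_def intro!: ell2_mult(2))
  then show ?thesis unfolding bounded_ops_def
    using ell2_mult(1)[OF _ assms]
    by (auto simp: diag_op_def ell2_add ell2_scale algebra_simps)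
qed

lemma pull_op_bounded:
  assumes "pinv I \<phi> \<psi>"
  shows "pull_op I \<psi> \<in> bounded_ops I"
proof -
  have "\<forall>\<xi>\<in>ell2 I. ell2_norm I (pull_op I \<psi> \<xi>) \<le> 1 * ell2_norm I \<xi>"
    using pull_ell2[OF assms] by (auto simp: pull_op_def)
  moreover have "pull_op I \<psi> (\<xi> + \<eta>) = pull_op I \<psi> \<xi> + pull_op I \<psi> \<eta>"
    if "\<xi> \<in> ell2 I" "\<eta> \<in> ell2 I" for \<xi> \<eta>
    using that by (auto simp: pull_op_def ell2_add pull_def fun_eq_iff split: option.splits)
  moreover have "pull_op I \<psi> (\<lambda>\<mu>. c * \<xi> \<mu>) = (\<lambda>\<mu>. c * pull_op I \<psi> \<xi> \<mu>)" if "\<xi> \<in> ell2 I" for \<xi> c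
    using that by (auto simp: pull_op_def ell2_scale pull_def fun_eq_iff split: option.splits)
  moreover have "\<forall>\<xi>\<in>ell2 I. pull_op I \<psi> \<xi> \<in> ell2 I" and "\<forall>\<xi>. \<xi> \<notin> ell2 I \<longrightarrow> pull_op I \<psi> \<xi> = 0"
    using pull_ell2(1)[OF assms] by (auto simp: pull_op_def)
  ultimately show ?thesis unfolding bounded_ops_def by blast
qed

section \<open>Uniqueness of adjoints and of operators given on the basis\<close>

lemma inner_delta: "\<mu> \<in> I \<Longrightarrow> ell2_inner I (delta \<mu>) \<eta> = cnj (\<eta> \<mu>)"
proof -
  assume \<mu>: "\<mu> \<in> I"
  have "ell2_inner I (delta \<mu>) \<eta> = (\<Sum>\<^sub>\<infinity>\<nu>\<in>{\<mu>}. delta \<mu> \<nu> * cnj (\<eta> \<nu>))"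
    unfolding ell2_inner_def by (rule infsum_cong_neutral) (auto simp: \<mu> delta_def)
  then show ?thesis by (simp add: delta_def)
qed

text \<open>Uniqueness in the description of the adjoint: pairing with \<open>delta \<mu>\<close>
  reads off the conjugated coordinate at \<mu>, and off \<open>I\<close> or off the Hilbert space
  all candidates agree by convention.\<close>

lemma adj_eqI:
  assumes B: "B \<in> bounded_ops I"
    and adj: "\<And>\<xi> \<eta>. \<xi> \<in> ell2 I \<Longrightarrow> \<eta> \<in> ell2 I \<Longrightarrow> ell2_inner I (A \<xi>) \<eta> = ell2_inner I \<xi> (B \<eta>)"
  shows "adj I A = B"
  unfolding adj_def
proof (rule the_equality)
  show "B \<in> bounded_ops I \<and> (\<forall>\<xi>\<in>ell2 I. \<forall>\<eta>\<in>ell2 I. ell2_inner I (A \<xi>) \<eta> = ell2_inner I \<xi> (B \<eta>))"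
    using assms by auto
next
  fix B' assume B': "B' \<in> bounded_ops I \<and> (\<forall>\<xi>\<in>ell2 I. \<forall>\<eta>\<in>ell2 I. ell2_inner I (A \<xi>) \<eta> = ell2_inner I \<xi> (B' \<eta>))"
  show "B' = B"
  proof (intro ext)
    fix \<eta> \<mu>
    show "B' \<eta> \<mu> = B \<eta> \<mu>"
    proof (cases "\<eta> \<in> ell2 I \<and> \<mu> \<in> I")
      case True
      have "ell2_inner I (delta \<mu>) (B' \<eta>) = ell2_inner I (A (delta \<mu>)) \<eta>"
        using B' True delta_in_ell2[of \<mu> I] by simp
      also have "\<dots> = ell2_inner I (delta \<mu>) (B \<eta>)" using adj True delta_in_ell2[of \<mu> I] by simp
      finally show ?thesis using True by (simp add: inner_delta)
    next
      case False
      have "B' \<in> bounded_ops I" using B' by blast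
      then have "\<zeta> \<notin> ell2 I \<Longrightarrow> B' \<zeta> = B \<zeta>" "\<zeta> \<in> ell2 I \<Longrightarrow> B' \<zeta> \<in> ell2 I \<and> B \<zeta> \<in> ell2 I" for \<zeta>
        using B by (simp_all add: bounded_ops_def)
      then show ?thesis using False by (cases "\<eta> \<in> ell2 I") (auto simp: ell2_def)
    qed
  qed
qed

lemma adj_diag_op:
  assumes "\<And>\<mu>. \<mu> \<in> I \<Longrightarrow> cmod (f \<mu>) \<le> C"
  shows "adj I (diag_op I f) = diag_op I (\<lambda>\<mu>. cnj (f \<mu>))"
  by (rule adj_eqI, rule diag_op_bounded[where C = C])
    (auto simp: assms ell2_inner_def diag_op_def algebra_simps intro!: infsum_cong)

lemma adj_pull_op:
  assumes "pinv I \<phi> \<psi>"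
  shows "adj I (pull_op I \<psi>) = pull_op I \<phi>"
proof (rule adj_eqI)
  show "pull_op I \<phi> \<in> bounded_ops I"
    by (rule pull_op_bounded[OF pinv_sym[OF assms]])
next
  fix \<xi> \<eta> assume \<xi>: "\<xi> \<in> ell2 I" and \<eta>: "\<eta> \<in> ell2 I"
  have bij: "bij_betw (\<lambda>\<mu>. the (\<psi> \<mu>)) (dom \<psi>) (dom \<phi>)"
    by (rule pinv_bij_betw[OF assms(1)])
  have sub: "dom \<phi> \<subseteq> I" "dom \<psi> \<subseteq> I" using assms(1) by (auto simp: pinv_def)
  have "ell2_inner I (pull_op I \<psi> \<xi>) \<eta> =
      (\<Sum>\<^sub>\<infinity>\<mu>\<in>dom \<psi>. \<xi> (the (\<psi> \<mu>)) * cnj (\<eta> (the (\<phi> (the (\<psi> \<mu>))))))"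
    unfolding ell2_inner_def
  proof (rule infsum_cong_neutral)
    fix \<mu> assume "\<mu> \<in> I \<inter> dom \<psi>"
    then obtain \<nu> where "\<psi> \<mu> = Some \<nu>" by auto
    moreover from this have "\<phi> \<nu> = Some \<mu>" using assms by (auto simp: pinv_def)
    ultimately show "pull_op I \<psi> \<xi> \<mu> * cnj (\<eta> \<mu>) = \<xi> (the (\<psi> \<mu>)) * cnj (\<eta> (the (\<phi> (the (\<psi> \<mu>)))))"
      using \<xi> by (simp add: pull_op_def pull_def)
  qed (use sub in \<open>auto simp: pull_op_def pull_def split: option.splits\<close>)
  also have "\<dots> = (\<Sum>\<^sub>\<infinity>\<mu>\<in>dom \<phi>. \<xi> \<mu> * cnj (\<eta> (the (\<phi> \<mu>))))"
    by (rule infsum_reindex_bij_betw[OF bij])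
  also have "\<dots> = ell2_inner I \<xi> (pull_op I \<phi> \<eta>)"
    unfolding ell2_inner_def using \<eta>
    by (intro infsum_cong_neutral) (use sub in \<open>auto simp: pull_op_def pull_def split: option.splits\<close>)
  finally show "ell2_inner I (pull_op I \<psi> \<xi>) \<eta> = ell2_inner I \<xi> (pull_op I \<phi> \<eta>)" .
qed

lemma cmod_le_ell2_norm:
  assumes "\<xi> \<in> ell2 I" shows "cmod (\<xi> \<mu>) \<le> ell2_norm I \<xi>"
proof (cases "\<mu> \<in> I")
  case True
  have "(\<Sum>\<nu>\<in>{\<mu>}. (cmod (\<xi> \<nu>))\<^sup>2) \<le> (\<Sum>\<^sub>\<infinity>\<nu>\<in>I. (cmod (\<xi> \<nu>))\<^sup>2)"
    using assms True by (intro finite_sum_le_infsum) (auto simp: ell2_def)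
  then show ?thesis unfolding ell2_norm_def by (intro real_le_rsqrt) simp
next
  case False
  then show ?thesis using assms by (auto simp: ell2_def ell2_norm_def infsum_nonneg)
qed

lemma ell2_finite_approx:
  assumes "\<xi> \<in> ell2 I" "\<epsilon> > 0"
  obtains F where "finite F" "F \<subseteq> I" "(\<lambda>\<mu>. if \<mu> \<in> F then 0 else \<xi> \<mu>) \<in> ell2 I"
    "ell2_norm I (\<lambda>\<mu>. if \<mu> \<in> F then 0 else \<xi> \<mu>) \<le> \<epsilon>"
proof -
  let ?g = "\<lambda>\<mu>. (cmod (\<xi> \<mu>))\<^sup>2"
  have s: "?g summable_on I" using assms by (auto simp: ell2_def)
  obtain F where F: "finite F" "F \<subseteq> I" "dist (sum ?g F) (infsum ?g I) \<le> \<epsilon>\<^sup>2"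
    using infsum_finite_approximation[OF s, of "\<epsilon>\<^sup>2"] assms(2) by auto
  have "infsum ?g (I - F) = infsum ?g I - infsum ?g F"
    using F by (intro infsum_Diff s) auto
  then have le: "infsum ?g (I - F) \<le> \<epsilon>\<^sup>2"
    using F by (auto simp: dist_real_def)
  let ?\<eta> = "\<lambda>\<mu>. if \<mu> \<in> F then 0 else \<xi> \<mu>"
  have eq: "(\<Sum>\<^sub>\<infinity>\<mu>\<in>I. (cmod (?\<eta> \<mu>))\<^sup>2) = infsum ?g (I - F)"
    by (rule infsum_cong_neutral) auto
  have "ell2_norm I ?\<eta> \<le> \<epsilon>" unfolding ell2_norm_def eq using le assms(2) by (simp add: real_le_lsqrt)
  moreover have "?\<eta> \<in> ell2 I"
  proof -
    have "(\<lambda>\<mu>. (if \<mu> \<in> F then 0 else 1) * \<xi> \<mu>) \<in> ell2 I"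
      by (rule ell2_mult(1)[OF assms(1), where C = 1]) auto
    also have "(\<lambda>\<mu>. (if \<mu> \<in> F then 0 else 1) * \<xi> \<mu>) = ?\<eta>" by auto
    finally show ?thesis .
  qed
  ultimately show ?thesis using F that by blast
qed

text \<open>Linearity gives agreement on finitely supported vectors, and the rest of \<xi> outside a
  large finite set has small norm, on which both operators are bounded. Coordinates are compared, so
  \<open>cmod_le_ell2_norm\<close> finishes the estimate.\<close>

lemma bounded_ops_eqI:
  assumes A: "A \<in> bounded_ops I" and B: "B \<in> bounded_ops I"
    and eq: "\<And>\<mu>. \<mu> \<in> I \<Longrightarrow> A (delta \<mu>) = B (delta \<mu>)"
  shows "A = B"
proof (intro ext)
  fix \<xi> \<mu>
  show "A \<xi> \<mu> = B \<xi> \<mu>"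
  proof (cases "\<xi> \<in> ell2 I")
    case False
    then show ?thesis using A B by (auto simp: bounded_ops_def)
  next
    case True
    obtain C1 where C1: "\<forall>\<xi>\<in>ell2 I. ell2_norm I (A \<xi>) \<le> C1 * ell2_norm I \<xi>"
      using A by (auto simp: bounded_ops_def)
    obtain C2 where C2: "\<forall>\<xi>\<in>ell2 I. ell2_norm I (B \<xi>) \<le> C2 * ell2_norm I \<xi>"
      using B by (auto simp: bounded_ops_def)
    have nn: "ell2_norm I \<eta> \<ge> 0" for \<eta> by (simp add: ell2_norm_def infsum_nonneg)
    have fin: "(\<lambda>\<nu>. if \<nu> \<in> F then \<xi> \<nu> else 0) \<in> ell2 I \<and>
        A (\<lambda>\<nu>. if \<nu> \<in> F then \<xi> \<nu> else 0) = B (\<lambda>\<nu>. if \<nu> \<in> F then \<xi> \<nu> else 0)"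
      if "finite F" "F \<subseteq> I" for F
      using that
    proof (induction F)
      case empty
      have z: "(\<lambda>\<nu>. (0::complex)) = (\<lambda>\<mu>. 0 * (0::'a \<Rightarrow> complex) \<mu>)" by auto
      have "A (\<lambda>\<mu>. 0 * (0::'a \<Rightarrow> complex) \<mu>) = (\<lambda>\<mu>. 0 * A 0 \<mu>)"
        using A zero_in_ell2[of I] unfolding bounded_ops_def by blast
      moreover have "B (\<lambda>\<mu>. 0 * (0::'a \<Rightarrow> complex) \<mu>) = (\<lambda>\<mu>. 0 * B 0 \<mu>)"
        using B zero_in_ell2[of I] unfolding bounded_ops_def by blast
      ultimately show ?case using zero_in_ell2[of I] by (auto simp: zero_fun_def)
    next
      case (insert \<nu> F)
      let ?f = "\<lambda>\<kappa>. if \<kappa> \<in> F then \<xi> \<kappa> else 0"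
      have e: "(\<lambda>\<kappa>. if \<kappa> \<in> insert \<nu> F then \<xi> \<kappa> else 0) = ?f + (\<lambda>\<kappa>. \<xi> \<nu> * delta \<nu> \<kappa>)"
        using insert by (auto simp: delta_def)
      have d: "delta \<nu> \<in> ell2 I" "(\<lambda>\<kappa>. \<xi> \<nu> * delta \<nu> \<kappa>) \<in> ell2 I"
        using insert by (auto intro: delta_in_ell2 ell2_scale)
      have ih: "?f \<in> ell2 I" "A ?f = B ?f" using insert by auto
      have "A (?f + (\<lambda>\<kappa>. \<xi> \<nu> * delta \<nu> \<kappa>)) = A ?f + (\<lambda>\<kappa>. \<xi> \<nu> * A (delta \<nu>) \<kappa>)"
        using A ih d by (simp add: bounded_ops_def)
      also have "\<dots> = B ?f + (\<lambda>\<kappa>. \<xi> \<nu> * B (delta \<nu>) \<kappa>)"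
        using ih eq[of \<nu>] insert by simp
      also have "\<dots> = B (?f + (\<lambda>\<kappa>. \<xi> \<nu> * delta \<nu> \<kappa>))"
        using B ih d by (simp add: bounded_ops_def)
      finally show ?case using e ell2_add[OF ih(1) d(2)] by auto
    qed
    have "cmod (A \<xi> \<mu> - B \<xi> \<mu>) \<le> (\<bar>C1\<bar> + \<bar>C2\<bar>) * \<epsilon>" if pos: "\<epsilon> > 0" for \<epsilon>
    proof -
      obtain F where F: "finite F" "F \<subseteq> I" "(\<lambda>\<mu>. if \<mu> \<in> F then 0 else \<xi> \<mu>) \<in> ell2 I"
        "ell2_norm I (\<lambda>\<mu>. if \<mu> \<in> F then 0 else \<xi> \<mu>) \<le> \<epsilon>"
        using ell2_finite_approx[OF True pos] by blast
      let ?f = "\<lambda>\<kappa>. if \<kappa> \<in> F then \<xi> \<kappa> else 0" and ?r = "\<lambda>\<kappa>. if \<kappa> \<in> F then 0 else \<xi> \<kappa>"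
      have \<xi>: "\<xi> = ?f + ?r" by auto
      have "A \<xi> = A ?f + A ?r" using A fin[OF F(1,2)] F(3) by (subst \<xi>) (simp add: bounded_ops_def)
      moreover have "B \<xi> = B ?f + B ?r" using B fin[OF F(1,2)] F(3) by (subst \<xi>) (simp add: bounded_ops_def)
      ultimately have "A \<xi> \<mu> - B \<xi> \<mu> = A ?r \<mu> - B ?r \<mu>" using fin[OF F(1,2)] by simp
      also have "cmod \<dots> \<le> cmod (A ?r \<mu>) + cmod (B ?r \<mu>)" by (rule norm_triangle_ineq4)
      also have "\<dots> \<le> ell2_norm I (A ?r) + ell2_norm I (B ?r)"
        using A B F(3) by (intro add_mono cmod_le_ell2_norm) (auto simp: bounded_ops_def)
      also have "\<dots> \<le> C1 * ell2_norm I ?r + C2 * ell2_norm I ?r"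
        using C1 C2 F(3) by (intro add_mono) auto
      also have "\<dots> \<le> \<bar>C1\<bar> * ell2_norm I ?r + \<bar>C2\<bar> * ell2_norm I ?r"
        using nn by (intro add_mono mult_right_mono) auto
      also have "\<dots> \<le> \<bar>C1\<bar> * \<epsilon> + \<bar>C2\<bar> * \<epsilon>"
        using F(4) by (intro add_mono mult_left_mono) auto
      finally show ?thesis by (simp add: algebra_simps)
    qed
    note bound = this
    have "cmod (A \<xi> \<mu> - B \<xi> \<mu>) \<le> 0 + e" if e: "e > 0" for e
    proof -
      \<comment> \<open>The summand 1 keeps the denominator positive when both constants
        vanish.\<close>
      have p: "\<bar>C1\<bar> + \<bar>C2\<bar> + 1 > 0" by linarith
      have "cmod (A \<xi> \<mu> - B \<xi> \<mu>) \<le> (\<bar>C1\<bar> + \<bar>C2\<bar>) * (e / (\<bar>C1\<bar> + \<bar>C2\<bar> + 1))"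
        using e p by (intro bound) simp
      also have "\<dots> \<le> e" using e p by (simp add: field_simps)
      finally show ?thesis by simp
    qed
    then have "cmod (A \<xi> \<mu> - B \<xi> \<mu>) \<le> 0" by (rule field_le_epsilon)
    then show ?thesis by simp
  qed
qed

text \<open>Coordinate \<nu> of \<open>pull_op I \<psi> (delta \<mu>)\<close> is 1 exactly when
  \<open>\<psi> \<nu> = Some \<mu>\<close>, that is, when \<open>\<phi> \<mu> = Some \<nu>\<close>:
  pulling back along the inverse pushes basis vectors forward.\<close>

lemma op_on_basis_pull:
  assumes "pinv I \<phi> \<psi>"
    and "\<And>\<mu>. \<mu> \<in> I \<Longrightarrow> h \<mu> = (case \<phi> \<mu> of None \<Rightarrow> 0 | Some \<nu> \<Rightarrow> delta \<nu>)"
  shows "op_on_basis I h = pull_op I \<psi>"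
proof -
  have b: "pull_op I \<psi> (delta \<mu>) = h \<mu>" if "\<mu> \<in> I" for \<mu>
  proof
    fix \<nu>
    have "\<phi> \<mu> = Some \<nu> \<longleftrightarrow> \<psi> \<nu> = Some \<mu>" using assms(1) by (auto simp: pinv_def)
    then show "pull_op I \<psi> (delta \<mu>) \<nu> = h \<mu> \<nu>"
      using that delta_in_ell2[OF that] by (auto simp: pull_op_def pull_def assms(2) delta_def split: option.splits)
  qed
  show ?thesis unfolding op_on_basis_def
    by (rule the_equality) (auto intro!: bounded_ops_eqI simp: b pull_op_bounded[OF assms(1)])
qed

section \<open>Products of diagonal operators and conjugation by partial isometries\<close>

lemma diag_op_mem: "\<xi> \<in> ell2 I \<Longrightarrow> \<forall>\<mu>\<in>I. cmod (f \<mu>) \<le> C \<Longrightarrow> diag_op I f \<xi> \<in> ell2 I"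
  using ell2_mult(1)[of \<xi> I f C] by (auto simp: diag_op_def)

lemma diag_op_add: "diag_op I f + diag_op I g = diag_op I (\<lambda>\<mu>. f \<mu> + g \<mu>)"
  by (auto simp: diag_op_def fun_eq_iff algebra_simps)

text \<open>Operators are 0 off the Hilbert space; the bound on \<open>g\<close> keeps the
  intermediate vector inside it.\<close>

lemma diag_op_comp:
  assumes "\<forall>\<mu>\<in>I. cmod (g \<mu>) \<le> C"
  shows "diag_op I f \<circ> diag_op I g = diag_op I (\<lambda>\<mu>. f \<mu> * g \<mu>)"
proof
  fix \<xi>
  show "(diag_op I f \<circ> diag_op I g) \<xi> = diag_op I (\<lambda>\<mu>. f \<mu> * g \<mu>) \<xi>"
    using diag_op_mem[OF _ assms] zero_in_ell2[of I]
    by (cases "\<xi> \<in> ell2 I") (auto simp: diag_op_def algebra_simps fun_eq_iff)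
qed

lemma scale_diag_op: "scale c (diag_op I f) = diag_op I (\<lambda>\<mu>. c * f \<mu>)"
  by (auto simp: diag_op_def scale_def fun_eq_iff algebra_simps)

lemma pull_comp: "pull \<phi> (pull \<psi> f) = pull (\<psi> \<circ>\<^sub>m \<phi>) f"
  by (auto simp: pull_def map_comp_def split: option.splits)

text \<open>At \<kappa> = \<psi>(\<nu>) the inner pullback returns to \<nu>. This is the pointwise
  form of the formulas for \<open>S f S\<^sup>*\<close> and \<open>S\<^sup>* S\<close> that
  follow.\<close>

lemma pull_mult_pull:
  assumes "pinv I \<phi> \<psi>"
  shows "pull \<psi> (\<lambda>\<mu>. f \<mu> * pull \<phi> g \<mu>) \<nu> = pull \<psi> f \<nu> * g \<nu>"
proof (cases "\<psi> \<nu>")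
  case (Some \<kappa>)
  then have "\<phi> \<kappa> = Some \<nu>" using assms by (simp add: pinv_def)
  with Some show ?thesis by (simp add: pull_def)
qed (simp add: pull_def)

lemma pull_op_conj:
  assumes "pinv I \<phi> \<psi>" "\<forall>\<mu>\<in>I. cmod (f \<mu>) \<le> C"
  shows "pull_op I \<psi> \<circ> diag_op I f \<circ> pull_op I \<phi> = diag_op I (pull \<psi> f)"
proof
  fix \<xi>
  show "(pull_op I \<psi> \<circ> diag_op I f \<circ> pull_op I \<phi>) \<xi> = diag_op I (pull \<psi> f) \<xi>"
  proof (cases "\<xi> \<in> ell2 I")
    case True
    then have p: "pull \<phi> \<xi> \<in> ell2 I" using pull_ell2(1)[OF pinv_sym[OF assms(1)]] by blast
    have "(\<lambda>\<mu>. f \<mu> * pull \<phi> \<xi> \<mu>) \<in> ell2 I" using p assms(2) by (intro ell2_mult(1)) auto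
    moreover have "pull \<psi> (\<lambda>\<mu>. f \<mu> * pull \<phi> \<xi> \<mu>) \<nu> = pull \<psi> f \<nu> * \<xi> \<nu>" for \<nu>
      by (rule pull_mult_pull[OF assms(1)])
    ultimately show ?thesis using True p by (auto simp: pull_op_def diag_op_def)
  next
    case False
    then show ?thesis using zero_in_ell2[of I]
      by (auto simp: pull_op_def diag_op_def pull_def fun_eq_iff zero_fun_def split: option.splits)
  qed
qed

text \<open>The initial projection \<open>S\<^sup>* S\<close> of the partial isometry of \<phi>. It
  puts the indicator of \<open>dom \<phi>\<close> into the algebra as soon as \<open>S\<close> is
  there.\<close>

lemma pull_op_proj:
  assumes "pinv I \<phi> \<psi>"
  shows "pull_op I \<phi> \<circ> pull_op I \<psi> = diag_op I (pull \<phi> (\<lambda>_. 1))"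
proof
  fix \<xi>
  show "(pull_op I \<phi> \<circ> pull_op I \<psi>) \<xi> = diag_op I (pull \<phi> (\<lambda>_. 1)) \<xi>"
  proof (cases "\<xi> \<in> ell2 I")
    case True
    have "pull \<phi> (pull \<psi> \<xi>) \<nu> = pull \<phi> (\<lambda>_. 1) \<nu> * \<xi> \<nu>" for \<nu>
      using pull_mult_pull[OF pinv_sym[OF assms], of "\<lambda>_. 1"] by simp
    then show ?thesis using True pull_ell2(1)[OF assms] by (auto simp: pull_op_def diag_op_def)
  next
    case False
    then show ?thesis using zero_in_ell2[of I]
      by (auto simp: pull_op_def diag_op_def pull_def fun_eq_iff zero_fun_def split: option.splits)
  qed
qed

lemma diagonal_ops_eq: "diagonal_ops I = {diag_op I f |f. \<exists>C. \<forall>\<mu>\<in>I. cmod (f \<mu>) \<le> C}"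
  by (simp add: diagonal_ops_def diag_op_def)

text \<open>Vectors vanish off \<open>I\<close>, so entries there are invisible and may be
  normalized to 0.\<close>

lemma diag_op_cong: "(\<And>\<mu>. \<mu> \<in> I \<Longrightarrow> f \<mu> = g \<mu>) \<Longrightarrow> diag_op I f = diag_op I g"
  by (force simp: diag_op_def ell2_def fun_eq_iff)

lemma symbol_diag_op: "symbol (diag_op I f) = (\<lambda>\<mu>. if \<mu> \<in> I then f \<mu> else 0)"
proof
  fix \<mu>
  show "symbol (diag_op I f) \<mu> = (if \<mu> \<in> I then f \<mu> else 0)"
    using delta_in_ell2[of \<mu> I] delta_notin_ell2[of \<mu> I]
    by (cases "\<mu> \<in> I") (simp_all add: symbol_def diag_op_def, simp add: delta_def)
qed

lemma diag_op_approx: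
  assumes "\<forall>\<mu>\<in>I. cmod (f \<mu> - g \<mu>) \<le> \<epsilon>" "0 \<le> \<epsilon>" "\<xi> \<in> ell2 I"
  shows "ell2_norm I (\<lambda>\<mu>. diag_op I f \<xi> \<mu> - diag_op I g \<xi> \<mu>) \<le> \<epsilon> * ell2_norm I \<xi>"
proof -
  have "(\<lambda>\<mu>. diag_op I f \<xi> \<mu> - diag_op I g \<xi> \<mu>) = (\<lambda>\<mu>. (f \<mu> - g \<mu>) * \<xi> \<mu>)"
    using assms by (auto simp: diag_op_def algebra_simps)
  then show ?thesis using ell2_mult(2)[of \<xi> I "\<lambda>\<mu>. f \<mu> - g \<mu>" \<epsilon>] assms by auto
qed

text \<open>Every closure clause passes to an intersection; in the last one the approximants lie in
  each member, so each member contains the limit.\<close>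

lemma cstar_generated_closed:
  fixes I S defines "E \<equiv> cstar_generated I S"
  shows "0 \<in> E" and "A \<in> E \<Longrightarrow> B \<in> E \<Longrightarrow> A + B \<in> E" and "A \<in> E \<Longrightarrow> B \<in> E \<Longrightarrow> A \<circ> B \<in> E"
    and "A \<in> E \<Longrightarrow> scale c A \<in> E" and "A \<in> E \<Longrightarrow> adj I A \<in> E" and "A \<in> S \<Longrightarrow> A \<in> E"
    and "A \<in> bounded_ops I \<Longrightarrow> (\<And>\<epsilon>. \<epsilon> > 0 \<Longrightarrow>
      \<exists>B\<in>E. \<forall>\<xi>\<in>ell2 I. ell2_norm I (\<lambda>\<mu>. A \<xi> \<mu> - B \<xi> \<mu>) \<le> \<epsilon> * ell2_norm I \<xi>) \<Longrightarrow> A \<in> E"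
proof -
  show "A \<in> E" if A: "A \<in> bounded_ops I" and ap: "\<And>\<epsilon>. \<epsilon> > 0 \<Longrightarrow>
      \<exists>B\<in>E. \<forall>\<xi>\<in>ell2 I. ell2_norm I (\<lambda>\<mu>. A \<xi> \<mu> - B \<xi> \<mu>) \<le> \<epsilon> * ell2_norm I \<xi>"
    unfolding E_def cstar_generated_def
  proof (rule InterI, clarify)
    fix B assume B: "cstar_subalgebra I B" "S \<subseteq> B"
    then have "E \<subseteq> B" by (auto simp: E_def cstar_generated_def)
    then have "\<forall>\<epsilon>>0. \<exists>C\<in>B. \<forall>\<xi>\<in>ell2 I. ell2_norm I (\<lambda>\<mu>. A \<xi> \<mu> - C \<xi> \<mu>) \<le> \<epsilon> * ell2_norm I \<xi>"
      using ap by (meson subsetD)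
    then show "A \<in> B" using B(1) A unfolding cstar_subalgebra_def by blast
  qed
qed (auto simp: E_def cstar_generated_def cstar_subalgebra_def)

section \<open>Spectra of function algebras\<close>

text \<open>Diagonal operators are replaced by their entries. As the functions vanish off
  \<open>I\<close>, \<open>symbol\<close> inverts \<open>diag_op I\<close> on \<open>A\<close>. The
  clause \<open>lim\<close> is closedness under uniform limits, which for diagonal operators is
  closedness in norm.\<close>

locale function_algebra =
  fixes I :: "'b set" and A :: "('b \<Rightarrow> complex) set"
  assumes supp: "f \<in> A \<Longrightarrow> \<mu> \<notin> I \<Longrightarrow> f \<mu> = 0"
    and bdd: "f \<in> A \<Longrightarrow> \<exists>C. \<forall>\<mu>. cmod (f \<mu>) \<le> C"
    and one: "indicator I \<in> A"
    and add: "f \<in> A \<Longrightarrow> g \<in> A \<Longrightarrow> (\<lambda>\<mu>. f \<mu> + g \<mu>) \<in> A"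
    and mult: "f \<in> A \<Longrightarrow> g \<in> A \<Longrightarrow> (\<lambda>\<mu>. f \<mu> * g \<mu>) \<in> A"
    and scl: "f \<in> A \<Longrightarrow> (\<lambda>\<mu>. c * f \<mu>) \<in> A"
    and conj: "f \<in> A \<Longrightarrow> (\<lambda>\<mu>. cnj (f \<mu>)) \<in> A"
    and lim: "(\<And>\<mu>. \<mu> \<notin> I \<Longrightarrow> f \<mu> = 0) \<Longrightarrow>
      (\<And>\<epsilon>. \<epsilon> > 0 \<Longrightarrow> \<exists>g\<in>A. \<forall>\<mu>\<in>I. cmod (f \<mu> - g \<mu>) \<le> \<epsilon>) \<Longrightarrow> f \<in> A"
begin

definition D :: "'b oper set" where "D = diag_op I ` A"

abbreviation X :: "('b oper \<Rightarrow> complex) set" where "X \<equiv> characters D"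

definition ev :: "('b oper \<Rightarrow> complex) \<Rightarrow> ('b \<Rightarrow> complex) \<Rightarrow> complex" where
  "ev \<omega> f = \<omega> (diag_op I f)"

text \<open>A character is \<open>0\<close> or \<open>1\<close> on indicators, so it is an ultrafilter on the Boolean algebra of sets with
  indicator in \<open>A\<close>; \<open>In \<omega> U\<close> says that \<open>U\<close> belongs to it.\<close>

definition In :: "('b oper \<Rightarrow> complex) \<Rightarrow> 'b set \<Rightarrow> bool" where
  "In \<omega> U \<longleftrightarrow> ev \<omega> (indicator U) = 1"

text \<open>Turns a functional on functions into one on operators; the restriction to
  \<open>D\<close> is the extensionality that \<open>characters\<close> demands.\<close>

definition char_of :: "(('b \<Rightarrow> complex) \<Rightarrow> complex) \<Rightarrow> 'b oper \<Rightarrow> complex" where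
  "char_of w = restrict (\<lambda>T. w (symbol T)) D"

lemma symbol_diag: "f \<in> A \<Longrightarrow> symbol (diag_op I f) = f"
  using supp by (auto simp: symbol_diag_op)

lemma diag_in_D: "f \<in> A \<Longrightarrow> diag_op I f \<in> D"
  by (auto simp: D_def)

lemma diag_comp: "g \<in> A \<Longrightarrow> diag_op I f \<circ> diag_op I g = diag_op I (\<lambda>\<mu>. f \<mu> * g \<mu>)"
  using bdd[of g] by (auto intro: diag_op_comp)

lemma diff: "f \<in> A \<Longrightarrow> g \<in> A \<Longrightarrow> (\<lambda>\<mu>. f \<mu> - g \<mu>) \<in> A"
  using add[of f "\<lambda>\<mu>. -1 * g \<mu>"] scl[of g "-1"] by simp

lemma zero: "(\<lambda>_. 0) \<in> A"
  using scl[OF one, of 0] by simp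

lemma ev_char_of: "f \<in> A \<Longrightarrow> ev (char_of w) f = w f"
  by (simp add: ev_def char_of_def diag_in_D symbol_diag)

lemma char_of_in_X:
  assumes "\<And>f g. f \<in> A \<Longrightarrow> g \<in> A \<Longrightarrow> w (\<lambda>\<mu>. f \<mu> + g \<mu>) = w f + w g"
    and "\<And>f g. f \<in> A \<Longrightarrow> g \<in> A \<Longrightarrow> w (\<lambda>\<mu>. f \<mu> * g \<mu>) = w f * w g"
    and "\<And>f c. f \<in> A \<Longrightarrow> w (\<lambda>\<mu>. c * f \<mu>) = c * w f"
    and "w (indicator I) = 1"
  shows "char_of w \<in> X"
proof -
  have "char_of w (diag_op I f) = w f" if "f \<in> A" for f
    using ev_char_of[OF that, of w] by (simp add: ev_def)
  then show ?thesis
    using assms one by (force simp: characters_def D_def diag_op_add diag_comp scale_diag_op add mult scl char_of_def)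
qed

lemma ev_add: "\<omega> \<in> X \<Longrightarrow> f \<in> A \<Longrightarrow> g \<in> A \<Longrightarrow> ev \<omega> (\<lambda>\<mu>. f \<mu> + g \<mu>) = ev \<omega> f + ev \<omega> g"
  using diag_in_D by (fastforce simp: ev_def characters_def simp flip: diag_op_add)

lemma ev_mult: "\<omega> \<in> X \<Longrightarrow> f \<in> A \<Longrightarrow> g \<in> A \<Longrightarrow> ev \<omega> (\<lambda>\<mu>. f \<mu> * g \<mu>) = ev \<omega> f * ev \<omega> g"
  using diag_in_D by (fastforce simp: ev_def characters_def simp flip: diag_comp)

lemma ev_scl: "\<omega> \<in> X \<Longrightarrow> f \<in> A \<Longrightarrow> ev \<omega> (\<lambda>\<mu>. c * f \<mu>) = c * ev \<omega> f"
  using diag_in_D by (fastforce simp: ev_def characters_def simp flip: scale_diag_op)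

lemma ev_diff: "\<omega> \<in> X \<Longrightarrow> f \<in> A \<Longrightarrow> g \<in> A \<Longrightarrow> ev \<omega> (\<lambda>\<mu>. f \<mu> - g \<mu>) = ev \<omega> f - ev \<omega> g"
  using ev_add[of \<omega> f "\<lambda>\<mu>. -1 * g \<mu>"] scl[of g "-1"] ev_scl[of \<omega> g "-1"] by simp

lemma ev_zero: "\<omega> \<in> X \<Longrightarrow> ev \<omega> (\<lambda>_. 0) = 0"
  using ev_scl[OF _ one, of \<omega> 0] by simp

lemma X_eqI:
  assumes "\<omega> \<in> X" "\<omega>' \<in> X" "\<And>f. f \<in> A \<Longrightarrow> ev \<omega> f = ev \<omega>' f"
  shows "\<omega> = \<omega>'"
proof (rule extensionalityI[of _ D])
  show "\<omega> \<in> extensional D" "\<omega>' \<in> extensional D" using assms(1,2) by (auto simp: characters_def)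
qed (use assms(3) in \<open>auto simp: D_def ev_def\<close>)

text \<open>A character is nonzero at some \<open>f\<close>, and \<open>f\<close> times the unit is
  \<open>f\<close> by the support condition.\<close>

lemma ev_one: assumes "\<omega> \<in> X" shows "ev \<omega> (indicator I) = 1"
proof -
  obtain f where f: "f \<in> A" "ev \<omega> f \<noteq> 0"
    using assms by (auto simp: characters_def ev_def D_def)
  have "(\<lambda>\<mu>. f \<mu> * indicator I \<mu>) = f"
    using supp[OF f(1)] by (auto simp: indicator_def fun_eq_iff)
  then have "ev \<omega> f * ev \<omega> (indicator I) = ev \<omega> f"
    using ev_mult[OF assms f(1) one] by simp
  then show ?thesis using f(2) by simp
qed

section \<open>The Boolean algebra of indicators and its ultrafilters\<close>

lemma ind_sub: "indicator U \<in> A \<Longrightarrow> U \<subseteq> I"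
  using supp[of "indicator U"] by (auto simp: indicator_def split: if_splits)

lemma ind_Int: "indicator U \<in> A \<Longrightarrow> indicator V \<in> A \<Longrightarrow> indicator (U \<inter> V) \<in> A"
  using mult[of "indicator U" "indicator V"] by (simp add: indicator_inter_arith[symmetric])

lemma ind_Diff: "indicator U \<in> A \<Longrightarrow> indicator V \<in> A \<Longrightarrow> indicator (U - V) \<in> A"
proof -
  assume a: "indicator U \<in> A" "indicator V \<in> A"
  have "(indicator (U - V) :: 'b \<Rightarrow> complex) = (\<lambda>\<mu>. indicator U \<mu> - indicator (U \<inter> V) \<mu>)"
    by (auto simp: indicator_def fun_eq_iff)
  then show ?thesis using diff[OF a(1) ind_Int[OF a]] by simp
qed

lemma ind_Un: "indicator U \<in> A \<Longrightarrow> indicator V \<in> A \<Longrightarrow> indicator (U \<union> V) \<in> A"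
proof -
  assume a: "indicator U \<in> A" "indicator V \<in> A"
  have "U \<union> V = I - (I - U - V)" using ind_sub a by auto
  then show ?thesis using ind_Diff one a by metis
qed

lemma ind_empty: "indicator {} \<in> A"
  using ind_Diff[OF one one] by simp

lemma ind_UN: "finite S \<Longrightarrow> (\<And>s. s \<in> S \<Longrightarrow> indicator (U s) \<in> A) \<Longrightarrow> indicator (\<Union>s\<in>S. U s) \<in> A"
  by (induction S rule: finite_induct) (auto simp: ind_empty ind_Un)

lemma In_UNIV: "\<omega> \<in> X \<Longrightarrow> In \<omega> I"
  by (simp add: In_def ev_one)

lemma ev_ind_01: assumes "\<omega> \<in> X" "indicator U \<in> A" shows "ev \<omega> (indicator U) = 0 \<or> ev \<omega> (indicator U) = 1"
proof -
  have "ev \<omega> (indicator U) * ev \<omega> (indicator U) = ev \<omega> (indicator U)"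
    using ev_mult[OF assms assms(2)] by (simp add: indicator_inter_arith[symmetric])
  then show ?thesis by simp
qed

lemma In_Int: assumes "\<omega> \<in> X" "indicator U \<in> A" "indicator V \<in> A"
  shows "In \<omega> (U \<inter> V) \<longleftrightarrow> In \<omega> U \<and> In \<omega> V"
proof -
  have "ev \<omega> (indicator (U \<inter> V)) = ev \<omega> (indicator U) * ev \<omega> (indicator V)"
    using ev_mult[OF assms] by (simp add: indicator_inter_arith[symmetric])
  then show ?thesis using ev_ind_01[OF assms(1,2)] ev_ind_01[OF assms(1,3)] by (auto simp: In_def)
qed

lemma In_Diff: assumes "\<omega> \<in> X" "indicator U \<in> A" "indicator V \<in> A"
  shows "In \<omega> (U - V) \<longleftrightarrow> In \<omega> U \<and> \<not> In \<omega> V"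
proof -
  have e: "(indicator (U - V) :: 'b \<Rightarrow> complex) = (\<lambda>\<mu>. indicator U \<mu> - indicator (U \<inter> V) \<mu>)"
    by (auto simp: indicator_def fun_eq_iff)
  have "ev \<omega> (indicator (U - V)) = ev \<omega> (indicator U) - ev \<omega> (indicator (U \<inter> V))"
    unfolding e using assms ind_Int by (intro ev_diff) auto
  moreover have "ev \<omega> (indicator (U \<inter> V)) = ev \<omega> (indicator U) * ev \<omega> (indicator V)"
    using ev_mult[OF assms] by (simp add: indicator_inter_arith[symmetric])
  ultimately show ?thesis using ev_ind_01[OF assms(1,2)] ev_ind_01[OF assms(1,3)] by (auto simp: In_def)
qed

lemma In_empty: "\<omega> \<in> X \<Longrightarrow> \<not> In \<omega> {}"
  using In_Diff[OF _ one one] by auto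

lemma In_Un: assumes "\<omega> \<in> X" "indicator U \<in> A" "indicator V \<in> A"
  shows "In \<omega> (U \<union> V) \<longleftrightarrow> In \<omega> U \<or> In \<omega> V"
proof -
  have "U \<union> V = I - (I - U - V)" using ind_sub assms by auto
  then show ?thesis using assms by (simp add: In_Diff In_UNIV ind_Diff one)
qed

lemma In_UN:
  assumes "\<omega> \<in> X"
  shows "finite S \<Longrightarrow> (\<And>s. s \<in> S \<Longrightarrow> indicator (U s) \<in> A) \<Longrightarrow>
    In \<omega> (\<Union>s\<in>S. U s) \<longleftrightarrow> (\<exists>s\<in>S. In \<omega> (U s))"
  by (induction S rule: finite_induct) (auto simp: assms In_empty In_Un ind_UN)

lemma In_mono: "\<omega> \<in> X \<Longrightarrow> indicator U \<in> A \<Longrightarrow> indicator V \<in> A \<Longrightarrow> In \<omega> U \<Longrightarrow> U \<subseteq> V \<Longrightarrow> In \<omega> V"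
  using In_Int[of \<omega> U V] by (simp add: Int_absorb2)

section \<open>Points of \<open>I\<close> as characters, and approximation of characters by
  them\<close>

definition point :: "'b \<Rightarrow> 'b oper \<Rightarrow> complex" where
  "point \<mu> = restrict (\<lambda>T. T (delta \<mu>) \<mu>) D"

lemma point_eq: "point \<mu> = char_of (\<lambda>f. f \<mu>)"
  by (simp add: point_def char_of_def symbol_def)

lemma point_in_X: "\<mu> \<in> I \<Longrightarrow> point \<mu> \<in> X"
  unfolding point_eq by (rule char_of_in_X) auto

lemma ev_point: "f \<in> A \<Longrightarrow> ev (point \<mu>) f = f \<mu>"
  by (simp add: point_eq ev_char_of)

lemma In_point: "indicator U \<in> A \<Longrightarrow> In (point \<mu>) U \<longleftrightarrow> \<mu> \<in> U"
  by (simp add: In_def ev_point indicator_def)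

text \<open>Multiplying \<open>f\<close> by the indicator of the singleton is the same as scaling
  that indicator by \<open>f \<mu>\<close>, so a character equal to 1 on it must evaluate at
  \<mu>.\<close>

lemma In_singleton:
  assumes "\<omega> \<in> X" "indicator {\<mu>} \<in> A" "In \<omega> {\<mu>}"
  shows "\<omega> = point \<mu>"
proof (rule X_eqI[OF assms(1)])
  show "point \<mu> \<in> X" using ind_sub[OF assms(2)] by (auto intro: point_in_X)
  fix f assume f: "f \<in> A"
  have "(\<lambda>\<nu>. f \<nu> * indicator {\<mu>} \<nu>) = (\<lambda>\<nu>. f \<mu> * indicator {\<mu>} \<nu>)"
    by (auto simp: indicator_def)
  then have "ev \<omega> f * ev \<omega> (indicator {\<mu>}) = f \<mu> * ev \<omega> (indicator {\<mu>})"
    using ev_mult[OF assms(1) f assms(2)] ev_scl[OF assms(1,2), of "f \<mu>"] by metis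
  then have "ev \<omega> f = f \<mu>" using assms(3) unfolding In_def by simp
  then show "ev \<omega> f = ev (point \<mu>) f" by (simp add: ev_point f)
qed

text \<open>The factor \<open>indicator I\<close> matters for the power 0, which would otherwise be
  1 off \<open>I\<close>.\<close>

lemma power_sum_in: "f \<in> A \<Longrightarrow> (\<lambda>\<mu>. \<Sum>j<n. f \<mu> ^ j * indicator I \<mu>) \<in> A"
proof (induction n)
  case 0 then show ?case by (simp add: zero)
next
  case (Suc n)
  have "(\<lambda>\<mu>. f \<mu> ^ j * indicator I \<mu>) \<in> A" for j
  proof (induction j)
    case (Suc j)
    then show ?case using mult[OF Suc.prems] mult[of f "\<lambda>\<mu>. f \<mu> ^ j * indicator I \<mu>"] \<open>f \<in> A\<close>
      by (simp add: mult.assoc)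
  qed (simp add: one)
  then show ?case using add[of "\<lambda>\<mu>. \<Sum>j<n. f \<mu> ^ j * indicator I \<mu>" "\<lambda>\<mu>. f \<mu> ^ n * indicator I \<mu>"] Suc
    by simp
qed

text \<open>The inverse of \<open>f\<close> is the uniform limit of a geometric series in \<open>1 - f / M\<close>.\<close>

lemma inverse_in:
  assumes f: "f \<in> A" and "\<delta> > 0" and r: "\<And>\<mu>. \<mu> \<in> I \<Longrightarrow> f \<mu> = complex_of_real (r \<mu>) \<and> \<delta> \<le> r \<mu>"
  obtains g where "g \<in> A" "(\<lambda>\<mu>. f \<mu> * g \<mu>) = indicator I"
proof -
  obtain C where C: "\<And>\<mu>. cmod (f \<mu>) \<le> C" using bdd[OF f] by auto
  \<comment> \<open>C bounds \<open>f\<close> from above; the maximum with \<delta> makes M positive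
    and \<open>\<delta> / M\<close> at most 1 even when \<open>I\<close> is empty.\<close>
  define M where "M = max C \<delta>"
  have M: "M > 0" "\<delta> \<le> M" using \<open>\<delta> > 0\<close> by (simp_all add: M_def less_max_iff_disj)
  define h where "h \<mu> = r \<mu> / M" for \<mu>
  \<comment> \<open>On \<open>I\<close> the values of 1 - \<open>h\<close> lie between 0 and q, so q
    is the ratio of the dominating geometric series.\<close>
  define q where "q = 1 - \<delta> / M"
  have q: "0 \<le> q" "q < 1" using M \<open>\<delta> > 0\<close> by (auto simp: q_def)
  have h: "1 - q \<le> h \<mu>" "h \<mu> \<le> 1" if "\<mu> \<in> I" for \<mu>
  proof -
    show "1 - q \<le> h \<mu>" using r[OF that] M by (simp add: q_def h_def divide_right_mono)
    have "r \<mu> \<le> M" using C[of \<mu>] r[OF that] by (simp add: M_def)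
    then show "h \<mu> \<le> 1" using M by (simp add: h_def)
  qed
  define k where "k \<mu> = indicator I \<mu> - (1 / complex_of_real M) * f \<mu>" for \<mu>
  have kA: "k \<in> A" unfolding k_def by (intro diff one scl f)
  have k: "k \<mu> = complex_of_real (1 - h \<mu>)" if "\<mu> \<in> I" for \<mu>
    using that r[OF that] by (simp add: k_def h_def)
  define b where "b \<mu> = (if \<mu> \<in> I then complex_of_real (1 / h \<mu>) else 0)" for \<mu>
  have bA: "b \<in> A"
  proof (rule lim)
    fix e :: real assume e: "e > 0"
    \<comment> \<open>The remainder of the series after n terms is
      \<open>(1 - h \<mu>) ^ n / h \<mu>\<close>, which is at most \<open>q ^ n / (1 - q)\<close>
      uniformly in \<mu>.\<close>
    have "(\<lambda>n. q ^ n / (1 - q)) \<longlonglongrightarrow> 0 / (1 - q)"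
      using q by (intro tendsto_divide LIMSEQ_realpow_zero tendsto_const) auto
    then have "eventually (\<lambda>n. q ^ n / (1 - q) < e) sequentially"
      using e by (intro order_tendstoD) auto
    then obtain n where n: "q ^ n / (1 - q) < e" by (auto simp: eventually_sequentially)
    have "cmod (b \<mu> - (\<Sum>j<n. k \<mu> ^ j * indicator I \<mu>)) \<le> e" if \<mu>: "\<mu> \<in> I" for \<mu>
    proof -
      have hp: "h \<mu> > 0" using h[OF \<mu>] q by linarith
      have "b \<mu> - (\<Sum>j<n. k \<mu> ^ j * indicator I \<mu>) = complex_of_real (1 / h \<mu> - (\<Sum>j<n. (1 - h \<mu>) ^ j))"
        using \<mu> by (simp add: b_def k)
      also have "1 / h \<mu> - (\<Sum>j<n. (1 - h \<mu>) ^ j) = (1 - h \<mu>) ^ n / h \<mu>"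
        using hp by (simp add: sum_gp_strict diff_divide_distrib)
      finally have "cmod (b \<mu> - (\<Sum>j<n. k \<mu> ^ j * indicator I \<mu>)) = (1 - h \<mu>) ^ n / h \<mu>"
        using hp h[OF \<mu>] by (simp add: norm_of_real del: of_real_divide of_real_power of_real_diff)
      also have "\<dots> \<le> q ^ n / (1 - q)"
        using h[OF \<mu>] q by (intro frac_le power_mono) auto
      finally show ?thesis using n by simp
    qed
    then show "\<exists>g\<in>A. \<forall>\<mu>\<in>I. cmod (b \<mu> - g \<mu>) \<le> e"
      by (intro bexI[OF _ power_sum_in[OF kA, of n]] ballI)
  qed (simp add: b_def)
  define g where "g \<mu> = (1 / complex_of_real M) * b \<mu>" for \<mu>
  have "g \<in> A" unfolding g_def by (intro scl bA)
  moreover have "f \<mu> * g \<mu> = indicator I \<mu>" for \<mu>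
  proof (cases "\<mu> \<in> I")
    case True
    have "r \<mu> > 0" using r[OF True] \<open>\<delta> > 0\<close> by simp
    then show ?thesis using True M r[OF True] by (simp add: g_def b_def h_def)
  qed (use supp[OF f] in simp)
  ultimately show ?thesis using that by blast
qed

lemma finite_sum_in:
  "finite F \<Longrightarrow> (\<And>t. t \<in> F \<Longrightarrow> u t \<in> A) \<Longrightarrow> (\<lambda>\<mu>. \<Sum>t\<in>F. u t \<mu>) \<in> A"
  by (induction F rule: finite_induct) (auto simp: zero add)

lemma ev_sum:
  assumes "\<omega> \<in> X"
  shows "finite F \<Longrightarrow> (\<And>t. t \<in> F \<Longrightarrow> u t \<in> A) \<Longrightarrow> ev \<omega> (\<lambda>\<mu>. \<Sum>t\<in>F. u t \<mu>) = (\<Sum>t\<in>F. ev \<omega> (u t))"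
  by (induction F rule: finite_induct) (auto simp: assms ev_zero ev_add finite_sum_in)

text \<open>Otherwise the sum \<open>h\<close> of the squared deviations is at least
  \<open>\<epsilon>\<^sup>2\<close> on \<open>I\<close>, hence invertible in \<open>A\<close>. But
  every summand of \<open>h\<close> has a factor \<open>d f\<close> that \<omega> maps to 0, so
  \<omega> would map the unit to 0. One vanishing factor per summand is enough, so compatibility of
  \<omega> with conjugation never comes up.\<close>

lemma approx_point:
  assumes w: "\<omega> \<in> X" and F: "finite F" "F \<subseteq> A" and "\<epsilon> > 0"
  obtains \<mu> where "\<mu> \<in> I" "\<And>f. f \<in> F \<Longrightarrow> cmod (f \<mu> - ev \<omega> f) < \<epsilon>"
proof (rule ccontr)
  note main = that
  assume nothesis: "\<not> thesis"
  have no: "\<exists>f\<in>F. \<not> cmod (f \<mu> - ev \<omega> f) < \<epsilon>" if "\<mu> \<in> I" for \<mu>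
  proof (rule ccontr)
    assume "\<not> ?thesis"
    then show False using main[OF \<open>\<mu> \<in> I\<close>] nothesis by blast
  qed
  define d where "d f \<mu> = f \<mu> - ev \<omega> f * indicator I \<mu>" for f \<mu>
  have dA: "d f \<in> A" and ed: "ev \<omega> (d f) = 0" if "f \<in> F" for f
  proof -
    have "f \<in> A" using F that by auto
    then show "d f \<in> A" "ev \<omega> (d f) = 0"
      unfolding d_def using w one by (auto intro!: diff scl simp: ev_diff ev_scl scl ev_one)
  qed
  define h where "h \<mu> = (\<Sum>f\<in>F. d f \<mu> * cnj (d f \<mu>))" for \<mu>
  have hA: "h \<in> A" unfolding h_def using F dA by (intro finite_sum_in mult conj) auto
  have "ev \<omega> h = (\<Sum>f\<in>F. ev \<omega> (\<lambda>\<mu>. d f \<mu> * cnj (d f \<mu>)))"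
    unfolding h_def using w F dA by (intro ev_sum mult conj) auto
  also have "\<dots> = 0" by (intro sum.neutral ballI) (simp add: ev_mult w dA conj ed)
  finally have h0: "ev \<omega> h = 0" .
  have "h \<mu> = complex_of_real (\<Sum>f\<in>F. (cmod (d f \<mu>))\<^sup>2) \<and> \<epsilon>\<^sup>2 \<le> (\<Sum>f\<in>F. (cmod (d f \<mu>))\<^sup>2)" if \<mu>: "\<mu> \<in> I" for \<mu>
  proof
    obtain f where f: "f \<in> F" "\<not> cmod (f \<mu> - ev \<omega> f) < \<epsilon>" using no[OF \<mu>] by blast
    have "\<epsilon> \<le> cmod (d f \<mu>)" using f(2) \<mu> by (simp add: d_def)
    then have "\<epsilon>\<^sup>2 \<le> (cmod (d f \<mu>))\<^sup>2" using \<open>\<epsilon> > 0\<close> by (intro power_mono) simp_all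
    also have "\<dots> \<le> (\<Sum>f\<in>F. (cmod (d f \<mu>))\<^sup>2)" using f F by (intro member_le_sum) auto
    finally show "\<epsilon>\<^sup>2 \<le> (\<Sum>f\<in>F. (cmod (d f \<mu>))\<^sup>2)" .
    show "h \<mu> = complex_of_real (\<Sum>f\<in>F. (cmod (d f \<mu>))\<^sup>2)"
      unfolding h_def of_real_sum by (intro sum.cong refl) (rule complex_norm_square[symmetric])
  qed
  from inverse_in[OF hA zero_less_power[OF \<open>\<epsilon> > 0\<close>, of 2] this]
  obtain g where "g \<in> A" "(\<lambda>\<mu>. h \<mu> * g \<mu>) = indicator I" by blast
  then show False using ev_mult[OF w hA] h0 ev_one[OF w] by fastforce
qed

section \<open>The topology of the spectrum and density of the points\<close>

abbreviation XT :: "('b oper \<Rightarrow> complex) topology" where "XT \<equiv> spectrum_topology D"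

lemma topspace_XT: "topspace XT = X"
  by (auto simp: spectrum_topology_def characters_def PiE_def)

lemma continuous_map_into_XT:
  assumes "\<And>z. z \<in> topspace Y \<Longrightarrow> g z \<in> X"
    and "\<And>f. f \<in> A \<Longrightarrow> continuous_map Y euclidean (\<lambda>z. ev (g z) f)"
  shows "continuous_map Y XT g"
  unfolding spectrum_topology_def continuous_map_in_subtopology continuous_map_componentwise
  using assms by (auto simp: characters_def D_def ev_def)

lemma continuous_ev: "f \<in> A \<Longrightarrow> continuous_map XT euclidean (\<lambda>\<omega>. ev \<omega> f)"
  unfolding ev_def spectrum_topology_def
  by (intro continuous_map_from_subtopology continuous_map_product_projection diag_in_D)

lemma openin_In: assumes "indicator U \<in> A" shows "openin XT {\<omega> \<in> X. In \<omega> U}"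
proof -
  \<comment> \<open>The value is 0 or 1, so being 1 is the open condition of being nonzero.\<close>
  have "openin XT {\<omega> \<in> topspace XT. ev \<omega> (indicator U) \<in> - {0}}"
    using assms by (intro openin_continuous_map_preimage[OF continuous_ev]) (auto intro: open_openin[THEN iffD1])
  moreover have "{\<omega> \<in> topspace XT. ev \<omega> (indicator U) \<in> - {0}} = {\<omega> \<in> X. In \<omega> U}"
    using ev_ind_01[OF _ assms] by (auto simp: topspace_XT In_def)
  ultimately show ?thesis by simp
qed

text \<open>A basic neighbourhood in the product topology restricts only finitely many values, so
  \<open>approx_point\<close> finds a point in it.\<close>

lemma point_dense:
  assumes "openin XT U" "\<omega> \<in> U"
  obtains \<mu> where "\<mu> \<in> I" "point \<mu> \<in> U"
proof -
  obtain W where W: "openin (product_topology (\<lambda>_. euclidean) D) W" "U = W \<inter> X"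
    using assms(1) by (auto simp: spectrum_topology_def openin_subtopology)
  have w: "\<omega> \<in> X" "\<omega> \<in> W" using W assms(2) by auto
  obtain B where B0: "finite {i \<in> D. B i \<noteq> topspace euclidean}" "\<forall>i\<in>D. openin euclidean (B i)"
    "\<omega> \<in> Pi\<^sub>E D B" "Pi\<^sub>E D B \<subseteq> W"
    using openin_product_topology_alt[THEN iffD1, OF W(1), rule_format, OF w(2)] by blast
  have B: "finite {i \<in> D. B i \<noteq> UNIV}" "\<And>i. i \<in> D \<Longrightarrow> open (B i)" "\<omega> \<in> Pi\<^sub>E D B" "Pi\<^sub>E D B \<subseteq> W"
    using B0 by simp_all
  define F where "F = {f \<in> A. B (diag_op I f) \<noteq> UNIV}"
  have "F \<subseteq> symbol ` {i \<in> D. B i \<noteq> UNIV}"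
    unfolding F_def D_def using symbol_diag by (force simp: image_iff)
  then have fin: "finite F" using B(1) by (auto intro: finite_subset)
  have "\<exists>e>0. ball (ev \<omega> f) e \<subseteq> B (diag_op I f)" if "f \<in> F" for f
  proof -
    have d: "diag_op I f \<in> D" using that by (simp add: F_def diag_in_D)
    have "ev \<omega> f \<in> B (diag_op I f)" using B(3) d by (simp add: ev_def PiE_mem)
    then show ?thesis using B(2)[OF d] open_contains_ball by blast
  qed
  then obtain e where e: "\<And>f. f \<in> F \<Longrightarrow> e f > 0 \<and> ball (ev \<omega> f) (e f) \<subseteq> B (diag_op I f)"
    by metis
  \<comment> \<open>The inserted 1 covers the case that no coordinate is restricted.\<close>
  define \<epsilon> where "\<epsilon> = Min (insert 1 (e ` F))"
  have pos: "\<epsilon> > 0" and le: "f \<in> F \<Longrightarrow> \<epsilon> \<le> e f" for f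
    using fin e by (auto simp: \<epsilon>_def)
  obtain \<mu> where \<mu>: "\<mu> \<in> I" "\<And>f. f \<in> F \<Longrightarrow> cmod (f \<mu> - ev \<omega> f) < \<epsilon>"
    using approx_point[OF w(1) fin _ pos] by (auto simp: F_def)
  have "point \<mu> \<in> Pi\<^sub>E D B"
  proof (rule PiE_I)
    fix T assume "T \<in> D"
    then obtain f where f: "f \<in> A" "T = diag_op I f" by (auto simp: D_def)
    have pt: "point \<mu> T = f \<mu>" using ev_point[OF f(1), of \<mu>] by (simp add: f ev_def)
    show "point \<mu> T \<in> B T"
    proof (cases "f \<in> F")
      case True
      then have "f \<mu> \<in> ball (ev \<omega> f) (e f)"
        using \<mu>(2)[OF True] le[OF True] by (simp add: dist_norm norm_minus_commute)
      then show ?thesis using e[OF True] pt f by auto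
    qed (use f pt in \<open>auto simp: F_def\<close>)
  qed (auto simp: point_def)
  then show ?thesis using that \<mu>(1) W B(4) point_in_X by auto
qed

lemma continuous_eq_on_points:
  assumes "openin XT V" "continuous_map (subtopology XT V) Y g" "continuous_map (subtopology XT V) Y h"
    and "Hausdorff_space Y" and eq: "\<And>\<mu>. \<mu> \<in> I \<Longrightarrow> point \<mu> \<in> V \<Longrightarrow> g (point \<mu>) = h (point \<mu>)" and "\<omega> \<in> V"
  shows "g \<omega> = h \<omega>"
proof (rule ccontr)
  assume ne: "g \<omega> \<noteq> h \<omega>"
  have top: "topspace (subtopology XT V) = V" using openin_subset[OF assms(1)] by auto
  have "g \<omega> \<in> topspace Y" "h \<omega> \<in> topspace Y"
    using assms(2,3,6) top by (auto simp: continuous_map_def)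
  then obtain P Q where PQ: "openin Y P" "openin Y Q" "g \<omega> \<in> P" "h \<omega> \<in> Q" "disjnt P Q"
    using \<open>Hausdorff_space Y\<close> ne unfolding Hausdorff_space_def by blast
  let ?W = "{z \<in> V. g z \<in> P} \<inter> {z \<in> V. h z \<in> Q}"
  have "openin (subtopology XT V) {z \<in> V. g z \<in> P}" "openin (subtopology XT V) {z \<in> V. h z \<in> Q}"
    using openin_continuous_map_preimage[OF assms(2) PQ(1)] openin_continuous_map_preimage[OF assms(3) PQ(2)]
    unfolding top by auto
  then have "openin (subtopology XT V) ?W" by (rule openin_Int)
  then have "openin XT ?W" using openin_trans_full[OF _ assms(1)] by blast
  moreover have "\<omega> \<in> ?W" using PQ assms(6) by auto
  ultimately obtain \<mu> where "\<mu> \<in> I" "point \<mu> \<in> ?W" using point_dense by blast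
  then show False using eq PQ(5) by (auto simp: disjnt_iff)
qed

text \<open>Density makes any continuous candidate with the prescribed values the only one. The open
  set \<open>V\<close> will be all of X for the shape and X without \<Omega> for the source; the
  last assumption says that every point in \<open>V\<close> is among those with a prescribed
  value.\<close>

lemma cont_extension_eqI:
  assumes V: "openin XT V" and Y: "Hausdorff_space Y"
    and g: "g \<in> extensional V" "continuous_map (subtopology XT V) Y g" "\<And>b. b \<in> B \<Longrightarrow> g (\<iota> b) = f b"
    and dense: "\<And>\<mu>. \<mu> \<in> I \<Longrightarrow> point \<mu> \<in> V \<Longrightarrow> point \<mu> \<in> \<iota> ` B"
  shows "cont_extension (subtopology XT V) Y \<iota> B f = g"
proof -
  have top: "topspace (subtopology XT V) = V" using openin_subset[OF V] by auto
  show ?thesis unfolding cont_extension_def top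
  proof (rule the_equality)
    fix h assume h: "h \<in> extensional V \<and> continuous_map (subtopology XT V) Y h \<and> (\<forall>b\<in>B. h (\<iota> b) = f b)"
    then have hc: "continuous_map (subtopology XT V) Y h" by blast
    have "h (point \<mu>) = g (point \<mu>)" if "\<mu> \<in> I" "point \<mu> \<in> V" for \<mu>
      using dense[OF that] h g(3) by force
    then have "h x = g x" if "x \<in> V" for x
      using continuous_eq_on_points[OF V hc g(2) Y _ that] by blast
    then show "h = g" using h g(1) by (blast intro: extensionalityI)
  qed (use g in blast)
qed

section \<open>Extension of partial maps to the spectrum\<close>

text \<open>The partial maps that act on X by duality: pullback, extended by 0, preserves
  \<open>A\<close>. Invertibility is a separate matter, expressed by \<open>pinv\<close>.\<close>

definition pmap :: "('b \<rightharpoonup> 'b) \<Rightarrow> bool" where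
  "pmap \<phi> \<longleftrightarrow> dom \<phi> \<subseteq> I \<and> ran \<phi> \<subseteq> I \<and> (\<forall>f\<in>A. pull \<phi> f \<in> A)"

definition vim :: "('b \<rightharpoonup> 'b) \<Rightarrow> 'b set \<Rightarrow> 'b set" where
  "vim \<phi> U = {\<mu>. \<exists>\<nu>\<in>U. \<phi> \<mu> = Some \<nu>}"

text \<open>The Gelfand dual, composing \<omega> with \<open>pull \<phi>\<close>. A character that
  is 0 on the indicator of \<open>dom \<phi>\<close> kills every pullback along \<phi>, so the
  composite would not be a character there.\<close>

definition hat :: "('b \<rightharpoonup> 'b) \<Rightarrow> ('b oper \<Rightarrow> complex) \<rightharpoonup> ('b oper \<Rightarrow> complex)" where
  "hat \<phi> \<omega> = (if \<omega> \<in> X \<and> In \<omega> (dom \<phi>) then Some (char_of (\<lambda>f. ev \<omega> (pull \<phi> f))) else None)"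

lemma pull_indicator: "pull \<phi> (indicator U) = indicator (vim \<phi> U)"
  by (auto simp: pull_def vim_def indicator_def fun_eq_iff split: option.splits)

lemma vim_I: "pmap \<phi> \<Longrightarrow> vim \<phi> I = dom \<phi>"
  by (auto simp: pmap_def vim_def ran_def)

lemma ind_vim: "pmap \<phi> \<Longrightarrow> indicator U \<in> A \<Longrightarrow> indicator (vim \<phi> U) \<in> A"
  by (auto simp: pmap_def simp flip: pull_indicator)

lemma ind_dom: "pmap \<phi> \<Longrightarrow> indicator (dom \<phi>) \<in> A"
  using ind_vim[OF _ one] vim_I by auto

lemma hat_SomeD:
  assumes "pmap \<phi>" "hat \<phi> \<omega> = Some \<omega>'"
  shows "\<omega> \<in> X" "In \<omega> (dom \<phi>)" "\<omega>' \<in> X" "f \<in> A \<Longrightarrow> ev \<omega>' f = ev \<omega> (pull \<phi> f)"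
    "indicator U \<in> A \<Longrightarrow> In \<omega>' U \<longleftrightarrow> In \<omega> (vim \<phi> U)"
proof -
  have pA: "pull \<phi> f \<in> A" if "f \<in> A" for f using assms(1) that by (auto simp: pmap_def)
  show w: "\<omega> \<in> X" and d: "In \<omega> (dom \<phi>)" using assms(2) by (auto simp: hat_def split: if_splits)
  have w': "\<omega>' = char_of (\<lambda>f. ev \<omega> (pull \<phi> f))" using assms(2) by (auto simp: hat_def split: if_splits)
  show e: "ev \<omega>' f = ev \<omega> (pull \<phi> f)" if "f \<in> A" for f using that by (simp add: w' ev_char_of)
  show "\<omega>' \<in> X" unfolding w'
  proof (rule char_of_in_X)
    fix f g assume fg: "f \<in> A" "g \<in> A"
    have "pull \<phi> (\<lambda>\<mu>. f \<mu> + g \<mu>) = (\<lambda>\<mu>. pull \<phi> f \<mu> + pull \<phi> g \<mu>)"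
      "pull \<phi> (\<lambda>\<mu>. f \<mu> * g \<mu>) = (\<lambda>\<mu>. pull \<phi> f \<mu> * pull \<phi> g \<mu>)"
      by (auto simp: pull_def fun_eq_iff split: option.splits)
    then show "ev \<omega> (pull \<phi> (\<lambda>\<mu>. f \<mu> + g \<mu>)) = ev \<omega> (pull \<phi> f) + ev \<omega> (pull \<phi> g)"
      "ev \<omega> (pull \<phi> (\<lambda>\<mu>. f \<mu> * g \<mu>)) = ev \<omega> (pull \<phi> f) * ev \<omega> (pull \<phi> g)"
      using w fg pA by (simp_all add: ev_add ev_mult)
  next
    fix f c assume f: "f \<in> A"
    have "pull \<phi> (\<lambda>\<mu>. c * f \<mu>) = (\<lambda>\<mu>. c * pull \<phi> f \<mu>)"
      by (auto simp: pull_def fun_eq_iff split: option.splits)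
    then show "ev \<omega> (pull \<phi> (\<lambda>\<mu>. c * f \<mu>)) = c * ev \<omega> (pull \<phi> f)"
      using w f pA by (simp add: ev_scl)
  next
    show "ev \<omega> (pull \<phi> (indicator I)) = 1"
      using d by (simp add: pull_indicator vim_I assms(1) In_def)
  qed
  show "In \<omega>' U \<longleftrightarrow> In \<omega> (vim \<phi> U)" if "indicator U \<in> A"
    using e[OF that] by (simp add: In_def pull_indicator)
qed

lemma hat_eq_SomeI:
  assumes "pmap \<phi>" "\<omega> \<in> X" "In \<omega> (dom \<phi>)" "\<omega>' \<in> X" "\<And>f. f \<in> A \<Longrightarrow> ev \<omega>' f = ev \<omega> (pull \<phi> f)"
  shows "hat \<phi> \<omega> = Some \<omega>'"
proof -
  obtain \<omega>'' where h: "hat \<phi> \<omega> = Some \<omega>''" using assms by (auto simp: hat_def)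
  have "\<omega>'' = \<omega>'" using hat_SomeD[OF assms(1) h] assms by (intro X_eqI) auto
  then show ?thesis using h by simp
qed

lemma dom_hat: "dom (hat \<phi>) = {\<omega> \<in> X. In \<omega> (dom \<phi>)}"
  by (auto simp: hat_def split: if_splits)

lemma pmap_comp:
  assumes "pmap \<phi>" "pmap \<psi>" shows "pmap (\<psi> \<circ>\<^sub>m \<phi>)"
proof -
  have "pull (\<psi> \<circ>\<^sub>m \<phi>) f \<in> A" if "f \<in> A" for f
    using assms that by (simp add: pmap_def flip: pull_comp)
  moreover have "dom (\<psi> \<circ>\<^sub>m \<phi>) \<subseteq> dom \<phi>" "ran (\<psi> \<circ>\<^sub>m \<phi>) \<subseteq> ran \<psi>"
    by (auto simp: map_comp_def ran_def split: option.splits)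
  ultimately show ?thesis using assms unfolding pmap_def by blast
qed

text \<open>Pullback is contravariant, and the domain of the composite is the preimage
  \<open>vim \<phi> (dom \<psi>)\<close>, so even the domains of the extensions agree. An identity
  between partial maps of \<open>I\<close>, domains included, thereby carries over to X without a
  density argument.\<close>

lemma hat_comp:
  assumes "pmap \<phi>" "pmap \<psi>"
  shows "hat (\<psi> \<circ>\<^sub>m \<phi>) = hat \<psi> \<circ>\<^sub>m hat \<phi>"
proof (rule ext)
  fix \<omega>
  have vd: "vim \<phi> (dom \<psi>) = dom (\<psi> \<circ>\<^sub>m \<phi>)"
    by (auto simp: vim_def map_comp_def split: option.splits)
  have sub: "dom (\<psi> \<circ>\<^sub>m \<phi>) \<subseteq> dom \<phi>" by (auto simp: map_comp_def split: option.splits)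
  show "hat (\<psi> \<circ>\<^sub>m \<phi>) \<omega> = (hat \<psi> \<circ>\<^sub>m hat \<phi>) \<omega>"
  proof (cases "hat \<phi> \<omega>")
    case None
    then have "\<not> (\<omega> \<in> X \<and> In \<omega> (dom (\<psi> \<circ>\<^sub>m \<phi>)))"
      using In_mono[OF _ ind_dom[OF pmap_comp[OF assms]] ind_dom[OF assms(1)] _ sub]
      by (auto simp: hat_def)
    then show ?thesis using None by (auto simp: hat_def)
  next
    case (Some \<omega>')
    note S = hat_SomeD[OF assms(1) Some]
    have iff: "In \<omega>' (dom \<psi>) \<longleftrightarrow> In \<omega> (dom (\<psi> \<circ>\<^sub>m \<phi>))"
      using S(5)[OF ind_dom[OF assms(2)]] vd by simp
    show ?thesis
    proof (cases "hat \<psi> \<omega>'")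
      case None
      then show ?thesis using iff Some S by (auto simp: hat_def)
    next
      case (Some \<omega>'')
      note S2 = hat_SomeD[OF assms(2) Some]
      have "hat (\<psi> \<circ>\<^sub>m \<phi>) \<omega> = Some \<omega>''"
        using S S2 iff assms
        by (intro hat_eq_SomeI pmap_comp) (auto simp: pull_comp pmap_def)
      then show ?thesis using Some \<open>hat \<phi> \<omega> = Some \<omega>'\<close> by simp
    qed
  qed
qed

lemma hat_empty: "hat Map.empty = Map.empty"
  by (auto simp: hat_def In_empty)

lemma hat_id: "hat (Some |` I) = Some |` X"
proof
  fix \<omega>
  have p: "pull (Some |` I) f = f" if "f \<in> A" for f
    using supp[OF that] by (auto simp: pull_def restrict_map_def)
  then have pm: "pmap (Some |` I)" by (auto simp: pmap_def ran_def restrict_map_def split: if_splits)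
  show "hat (Some |` I) \<omega> = (Some |` X) \<omega>"
  proof (cases "\<omega> \<in> X")
    case True
    then show ?thesis using pm p by (subst hat_eq_SomeI[of _ _ \<omega>]) (auto simp: In_UNIV)
  qed (simp add: hat_def)
qed

text \<open>Pulling back along \<psi> and then along \<phi> is multiplication by the indicator of
  \<open>dom \<phi>\<close>, on which \<omega> is 1.\<close>

lemma hat_inverse:
  assumes "pmap \<phi>" "pmap \<psi>" "pinv I \<phi> \<psi>"
  shows "hat \<phi> \<omega> = Some \<omega>' \<longleftrightarrow> hat \<psi> \<omega>' = Some \<omega>"
proof -
  have *: "hat \<psi> \<omega>' = Some \<omega>" if h: "hat \<phi> \<omega> = Some \<omega>'" and p: "pmap \<phi>" "pmap \<psi>" "pinv I \<phi> \<psi>" for \<phi> \<psi> \<omega> \<omega>'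
  proof -
    note S = hat_SomeD[OF p(1) h]
    have pp: "pull \<phi> (pull \<psi> f) = (\<lambda>\<mu>. f \<mu> * indicator (dom \<phi>) \<mu>)" for f
    proof
      fix \<mu> show "pull \<phi> (pull \<psi> f) \<mu> = f \<mu> * indicator (dom \<phi>) \<mu>"
      proof (cases "\<phi> \<mu>")
        case (Some \<nu>)
        then have "\<psi> \<nu> = Some \<mu>" using p(3) by (simp add: pinv_def)
        then show ?thesis using Some by (simp add: pull_def indicator_def domI)
      qed (simp add: pull_def indicator_def domIff)
    qed
    have "vim \<phi> (dom \<psi>) = dom \<phi>" using p(3) by (fastforce simp: vim_def pinv_def)
    then have "In \<omega>' (dom \<psi>)" using S(2) S(5)[OF ind_dom[OF p(2)]] by simp
    moreover have "ev \<omega> f = ev \<omega>' (pull \<psi> f)" if f: "f \<in> A" for f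
    proof -
      have "pull \<psi> f \<in> A" using f p(2) by (simp add: pmap_def)
      then have "ev \<omega>' (pull \<psi> f) = ev \<omega> (pull \<phi> (pull \<psi> f))" by (rule S(4))
      also have "\<dots> = ev \<omega> f * ev \<omega> (indicator (dom \<phi>))"
        using pp ev_mult[OF S(1) f ind_dom[OF p(1)]] by simp
      finally show ?thesis using S(2) by (simp add: In_def)
    qed
    ultimately show ?thesis using S p by (intro hat_eq_SomeI) auto
  qed
  show ?thesis using *[of \<phi> \<omega> \<omega>' \<psi>] *[of \<psi> \<omega>' \<omega> \<phi>] assms pinv_sym by blast
qed

text \<open>The range of \<open>\<phi> s\<close> is the domain of its inverse. An ultrafilter
  containing a finite union of ranges contains one of them, and there the inverse extends to
  \<omega>. This is the source of all existence of factorizations in X.\<close>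

lemma In_ranges_iff:
  assumes "\<omega> \<in> X" "finite S" and p: "\<And>s. s \<in> S \<Longrightarrow> pmap (\<phi> s) \<and> pmap (\<psi> s) \<and> pinv I (\<phi> s) (\<psi> s)"
  shows "In \<omega> (\<Union>s\<in>S. dom (\<psi> s)) \<longleftrightarrow> (\<exists>s\<in>S. \<exists>\<omega>'. hat (\<phi> s) \<omega>' = Some \<omega>)"
proof -
  have "In \<omega> (\<Union>s\<in>S. dom (\<psi> s)) \<longleftrightarrow> (\<exists>s\<in>S. In \<omega> (dom (\<psi> s)))"
    using p by (intro In_UN[OF assms(1,2)] ind_dom) blast
  moreover have "In \<omega> (dom (\<psi> s)) \<longleftrightarrow> (\<exists>\<omega>'. hat (\<psi> s) \<omega> = Some \<omega>')" for s
    using assms(1) by (simp add: hat_def)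
  ultimately show ?thesis using p hat_inverse by blast
qed

text \<open>Both ranges belong to the ultrafilter \<open>z\<close>, hence so does their
  intersection, which therefore is not empty. For multiplications by elements of one shape this is
  uniqueness of factorization in X.\<close>

lemma hat_unique:
  assumes p: "pmap \<phi>" "pmap \<psi>" "pinv I \<phi> \<psi>" and p': "pmap \<phi>'" "pmap \<psi>'" "pinv I \<phi>' \<psi>'"
    and disj: "dom \<psi> \<inter> dom \<psi>' = {} \<or> \<phi> = \<phi>'"
    and h: "hat \<phi> \<omega> = Some z" "hat \<phi>' \<omega>' = Some z"
  shows "\<phi> = \<phi>' \<and> \<omega> = \<omega>'"
proof -
  have d: "hat \<psi> z = Some \<omega>" "hat \<psi>' z = Some \<omega>'" using h hat_inverse[OF p] hat_inverse[OF p'] by auto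
  then have z: "z \<in> X" and "In z (dom \<psi>)" "In z (dom \<psi>')" by (auto simp: hat_def split: if_splits)
  then have "In z (dom \<psi> \<inter> dom \<psi>')" using In_Int[OF z ind_dom[OF p(2)] ind_dom[OF p'(2)]] by simp
  then have "\<phi> = \<phi>'" using disj In_empty[OF z] by auto
  moreover from this have "hat \<phi>' \<omega> = Some z" using h by simp
  then have "hat \<psi>' z = Some \<omega>" using hat_inverse[OF p'] by simp
  ultimately show ?thesis using d by simp
qed

lemma continuous_hat:
  assumes "pmap \<phi>"
  shows "continuous_map (subtopology XT (dom (hat \<phi>))) XT (\<lambda>\<omega>. the (hat \<phi> \<omega>))"
proof (rule continuous_map_into_XT)
  fix \<omega> assume "\<omega> \<in> topspace (subtopology XT (dom (hat \<phi>)))"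
  then obtain \<omega>' where "hat \<phi> \<omega> = Some \<omega>'" by auto
  then show "the (hat \<phi> \<omega>) \<in> X" using hat_SomeD(3)[OF assms] by simp
next
  fix f assume f: "f \<in> A"
  have "continuous_map (subtopology XT (dom (hat \<phi>))) euclidean (\<lambda>\<omega>. ev \<omega> (pull \<phi> f))"
    using assms f by (intro continuous_map_from_subtopology continuous_ev) (simp add: pmap_def)
  then show "continuous_map (subtopology XT (dom (hat \<phi>))) euclidean (\<lambda>\<omega>. ev (the (hat \<phi> \<omega>)) f)"
  proof (rule continuous_map_eq)
    fix \<omega> assume "\<omega> \<in> topspace (subtopology XT (dom (hat \<phi>)))"
    then obtain \<omega>' where "hat \<phi> \<omega> = Some \<omega>'" by auto
    then show "ev \<omega> (pull \<phi> f) = ev (the (hat \<phi> \<omega>)) f" using hat_SomeD(4)[OF assms] f by simp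
  qed
qed

text \<open>For \<open>S = pull_op I \<psi>\<close> the condition in \<open>dual_map\<close> says
  that \<open>hat \<psi>\<close> maps \<omega>' to \<omega>; the unit in place of \<open>f\<close>
  puts \<omega>' into the domain. By \<open>hat_inverse\<close> the solutions \<omega>' are the
  values of \<open>hat \<phi>\<close> at \<omega>, so there is at most one, and one exists exactly
  on \<open>dom (hat \<phi>)\<close>.\<close>

lemma dual_map_pull_op:
  assumes "pmap \<phi>" "pmap \<psi>" "pinv I \<phi> \<psi>"
  shows "dual_map I D (pull_op I \<psi>) = hat \<phi>"
proof
  fix \<omega>
  have conj: "pull_op I \<psi> \<circ> diag_op I f \<circ> adj I (pull_op I \<psi>) = diag_op I (pull \<psi> f)" if "f \<in> A" for f
    using bdd[OF that] pull_op_conj[OF assms(3)] by (auto simp: adj_pull_op[OF assms(3)])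
  have iff: "\<omega>' \<in> X \<and> (\<forall>f\<in>D. \<omega>' (pull_op I \<psi> \<circ> f \<circ> adj I (pull_op I \<psi>)) = \<omega> f) \<longleftrightarrow> hat \<phi> \<omega> = Some \<omega>'"
    if w: "\<omega> \<in> X" for \<omega>'
  proof -
    have "(\<forall>f\<in>D. \<omega>' (pull_op I \<psi> \<circ> f \<circ> adj I (pull_op I \<psi>)) = \<omega> f) \<longleftrightarrow> (\<forall>f\<in>A. ev \<omega>' (pull \<psi> f) = ev \<omega> f)"
      unfolding D_def ball_simps by (auto simp: conj ev_def)
    moreover have "\<omega>' \<in> X \<and> (\<forall>f\<in>A. ev \<omega>' (pull \<psi> f) = ev \<omega> f) \<longleftrightarrow> hat \<psi> \<omega>' = Some \<omega>"
    proof
      assume a: "\<omega>' \<in> X \<and> (\<forall>f\<in>A. ev \<omega>' (pull \<psi> f) = ev \<omega> f)"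
      then have "In \<omega>' (dom \<psi>)"
        using bspec[OF conjunct2[OF a] one] ev_one[OF w] by (simp add: In_def pull_indicator vim_I assms(2))
      then show "hat \<psi> \<omega>' = Some \<omega>" using a w assms(2) by (intro hat_eq_SomeI) auto
    next
      assume "hat \<psi> \<omega>' = Some \<omega>"
      then show "\<omega>' \<in> X \<and> (\<forall>f\<in>A. ev \<omega>' (pull \<psi> f) = ev \<omega> f)"
        using hat_SomeD[OF assms(2)] by metis
    qed
    ultimately show ?thesis using hat_inverse[OF assms] by simp
  qed
  show "dual_map I D (pull_op I \<psi>) \<omega> = hat \<phi> \<omega>"
  proof (cases "\<omega> \<in> X")
    case True
    then show ?thesis unfolding dual_map_def iff[OF True] by (cases "hat \<phi> \<omega>") auto
  next
    case False
    then show ?thesis by (simp add: dual_map_def hat_def)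
  qed
qed

end

section \<open>Left and right multiplication on \<open>X\<close>\<close>

definition minv :: "('b \<rightharpoonup> 'b) \<Rightarrow> 'b \<rightharpoonup> 'b" where
  "minv \<phi> \<nu> = (if \<exists>\<kappa>. \<phi> \<kappa> = Some \<nu> then Some (THE \<kappa>. \<phi> \<kappa> = Some \<nu>) else None)"

lemma minv_iff:
  assumes "\<And>\<kappa> \<kappa>' \<nu>. \<phi> \<kappa> = Some \<nu> \<Longrightarrow> \<phi> \<kappa>' = Some \<nu> \<Longrightarrow> \<kappa> = \<kappa>'"
  shows "minv \<phi> \<nu> = Some \<mu> \<longleftrightarrow> \<phi> \<mu> = Some \<nu>"
proof
  assume a: "\<phi> \<mu> = Some \<nu>"
  then have "(THE \<kappa>. \<phi> \<kappa> = Some \<nu>) = \<mu>" using assms by blast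
  then show "minv \<phi> \<nu> = Some \<mu>" using a by (auto simp: minv_def)
next
  assume m: "minv \<phi> \<nu> = Some \<mu>"
  then obtain \<kappa> where k: "\<phi> \<kappa> = Some \<nu>" by (auto simp: minv_def split: if_splits)
  then have "(THE \<kappa>. \<phi> \<kappa> = Some \<nu>) = \<kappa>" using assms by blast
  then show "\<phi> \<mu> = Some \<nu>" using m k by (auto simp: minv_def split: if_splits)
qed

lemma pinv_minv:
  assumes "dom \<phi> \<subseteq> I" "ran \<phi> \<subseteq> I" "\<And>\<kappa> \<kappa>' \<nu>. \<phi> \<kappa> = Some \<nu> \<Longrightarrow> \<phi> \<kappa>' = Some \<nu> \<Longrightarrow> \<kappa> = \<kappa>'"
  shows "pinv I \<phi> (minv \<phi>)"
proof -
  have "minv \<phi> \<nu> = Some \<mu> \<longleftrightarrow> \<phi> \<mu> = Some \<nu>" for \<mu> \<nu>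
    by (rule minv_iff) (rule assms(3))
  moreover from this have "dom (minv \<phi>) \<subseteq> ran \<phi>" by (auto simp: ran_def)
  ultimately show ?thesis using assms(1,2) unfolding pinv_def by blast
qed

section \<open>Unique factorization in the graph, before and after collapsing the objects\<close>

locale rank_graph_F =
  fixes G :: "('a, 'r::finite) kgraph"
  assumes rank_graph: "rank_graph G" and cond_F: "cond_F G"
begin

lemma small_category: "small_category G"
  using rank_graph by (simp add: rank_graph_def)

lemma src_tgt:
  assumes "a \<in> mor G"
  shows "src G a \<in> mor G" "tgt G a \<in> mor G" "src G (src G a) = src G a" "tgt G (src G a) = src G a"
    "src G (tgt G a) = tgt G a" "tgt G (tgt G a) = tgt G a" "comp G a (src G a) = a" "comp G (tgt G a) a = a"
    "shape G (src G a) = 0" "shape G (tgt G a) = 0"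
  using small_category rank_graph assms by (simp_all add: small_category_def rank_graph_def)

lemma comp_props:
  assumes "a \<in> mor G" "b \<in> mor G" "src G a = tgt G b"
  shows "comp G a b \<in> mor G" "src G (comp G a b) = src G b" "tgt G (comp G a b) = tgt G a"
    "shape G (comp G a b) = shape G a + shape G b"
  using small_category rank_graph assms by (simp_all add: small_category_def rank_graph_def)

lemma comp_assoc:
  assumes "a \<in> mor G" "b \<in> mor G" "c \<in> mor G" "src G a = tgt G b" "src G b = tgt G c"
  shows "comp G (comp G a b) c = comp G a (comp G b c)"
  using small_category assms by (simp add: small_category_def)

lemma src_obj: "a \<in> mor G \<Longrightarrow> src G a \<in> objs G" and tgt_obj: "a \<in> mor G \<Longrightarrow> tgt G a \<in> objs G"
  by (auto simp: objs_def src_tgt)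

lemma obj_props:
  assumes "v \<in> mor G" "shape G v = 0"
  shows "src G v = v" "tgt G v = v"
proof -
  show "src G v = v" using objs_eq_identities[OF rank_graph] assms by (auto simp: objs_def)
  then show "tgt G v = v" using src_tgt(4)[OF assms(1)] by simp
qed

lemma factor_ex1:
  assumes "c \<in> mor G" "shape G c = m + n"
  shows "\<exists>!p. p \<in> mor G \<times> mor G \<and> src G (fst p) = tgt G (snd p) \<and> c = comp G (fst p) (snd p) \<and>
              shape G (fst p) = m \<and> shape G (snd p) = n"
proof -
  have "\<forall>\<rho>\<in>mor G. \<forall>m n. shape G \<rho> = m + n \<longrightarrow>
        (\<exists>!p. p \<in> mor G \<times> mor G \<and> src G (fst p) = tgt G (snd p) \<and> \<rho> = comp G (fst p) (snd p) \<and>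
              shape G (fst p) = m \<and> shape G (snd p) = n)"
    using rank_graph unfolding rank_graph_def by (elim conjE)
  then show ?thesis using assms by blast
qed

lemma factor:
  assumes "c \<in> mor G" "shape G c = m + n"
  obtains a b where "a \<in> mor G" "b \<in> mor G" "src G a = tgt G b" "c = comp G a b" "shape G a = m" "shape G b = n"
  using ex1_implies_ex[OF factor_ex1[OF assms]] that by auto

text \<open>Shapes cancel, so equality of shapes on one side forces it on the other; factors can be
  compared from either end.\<close>

lemma factor_unique:
  assumes "a \<in> mor G" "b \<in> mor G" "src G a = tgt G b" "a' \<in> mor G" "b' \<in> mor G" "src G a' = tgt G b'"
    and "comp G a b = comp G a' b'" "shape G a = shape G a' \<or> shape G b = shape G b'"
  shows "a = a' \<and> b = b'"
proof -
  have "shape G a + shape G b = shape G a' + shape G b'"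
    using comp_props(4)[OF assms(1-3)] comp_props(4)[OF assms(4-6)] assms(7) by simp
  then have eq: "shape G a = shape G a'" "shape G b = shape G b'" using assms(8) by auto
  let ?P = "\<lambda>p. p \<in> mor G \<times> mor G \<and> src G (fst p) = tgt G (snd p) \<and> comp G a b = comp G (fst p) (snd p) \<and>
              shape G (fst p) = shape G a \<and> shape G (snd p) = shape G b"
  have "\<exists>!p. ?P p" by (rule factor_ex1[OF comp_props(1,4)[OF assms(1-3)]])
  moreover have "?P (a, b)" "?P (a', b')" using assms eq by simp_all
  ultimately have "(a, b) = (a', b')" by blast
  then show ?thesis by simp
qed

lemma comp_zero:
  assumes "a \<in> mor G" "b \<in> mor G" "src G a = tgt G b"
  shows "shape G a = 0 \<Longrightarrow> comp G a b = b" "shape G b = 0 \<Longrightarrow> comp G a b = a"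
  using assms obj_props src_tgt(7)[OF assms(1)] src_tgt(8)[OF assms(2)] by metis+

abbreviation "L \<equiv> bar G"
abbreviation "bc \<equiv> bar_comp G"
abbreviation "bco \<equiv> bar_composable G"
abbreviation "bs \<equiv> bar_shape G"

lemma bar_Some: "Some a \<in> L \<longleftrightarrow> a \<in> mor G \<and> shape G a \<noteq> 0"
  by (auto simp: bar_def)

lemma bar_None: "None \<in> L"
  by (auto simp: bar_def)

lemma bs_simps: "bs None = 0" "bs (Some a) = shape G a"
  by (auto simp: bar_shape_def)

lemma bco_None: "bco None \<beta>" "bco \<alpha> None" and bc_None: "bc \<alpha> None = \<alpha>"
  by (cases \<alpha>; cases \<beta>; simp)+ 

lemma bs_zero: "\<alpha> \<in> L \<Longrightarrow> bs \<alpha> = 0 \<longleftrightarrow> \<alpha> = None"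
  by (cases \<alpha>) (auto simp: bs_simps bar_Some)

lemma sum_nz: "(m :: 'r shp) \<noteq> 0 \<Longrightarrow> m + n \<noteq> 0"
  by (auto simp: fun_eq_iff)

lemma bc_props:
  assumes "\<alpha> \<in> L" "\<beta> \<in> L" "bco \<alpha> \<beta>"
  shows "bc \<alpha> \<beta> \<in> L" "bs (bc \<alpha> \<beta>) = bs \<alpha> + bs \<beta>"
  using assms by (cases \<alpha>; cases \<beta>; auto simp: bs_simps bar_Some comp_props sum_nz)+

text \<open>Composability is compared for whole bracketings because it does not pass through
  \<Omega>: with \<Omega> in the middle, both sides of the equivalence ask whether \<alpha> and
  \<gamma> compose.\<close>

lemma bc_assoc:
  assumes "\<alpha> \<in> L" "\<beta> \<in> L" "\<gamma> \<in> L"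
  shows "bco \<beta> \<gamma> \<and> bco \<alpha> (bc \<beta> \<gamma>) \<longleftrightarrow> bco \<alpha> \<beta> \<and> bco (bc \<alpha> \<beta>) \<gamma>"
    and "bco \<beta> \<gamma> \<Longrightarrow> bco \<alpha> (bc \<beta> \<gamma>) \<Longrightarrow> bc (bc \<alpha> \<beta>) \<gamma> = bc \<alpha> (bc \<beta> \<gamma>)"
  using assms by (cases \<alpha>; cases \<beta>; cases \<gamma>; auto simp: bar_Some comp_props comp_assoc)+

lemma to_bar_in: "a \<in> mor G \<Longrightarrow> to_bar G a \<in> L"
  by (auto simp: to_bar_def bar_Some bar_None)

lemma bs_to_bar: "bs (to_bar G a) = shape G a"
  by (auto simp: to_bar_def bs_simps)

lemma to_bar_comp:
  assumes "a \<in> mor G" "b \<in> mor G" "src G a = tgt G b"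
  shows "to_bar G (comp G a b) = bc (to_bar G a) (to_bar G b)" "bco (to_bar G a) (to_bar G b)"
  using assms comp_props[OF assms] comp_zero[OF assms] by (auto simp: to_bar_def sum_nz)

lemma bar_factor:
  assumes "\<rho> \<in> L" "bs \<rho> = m + n"
  obtains \<alpha> \<beta> where "\<alpha> \<in> L" "\<beta> \<in> L" "bco \<alpha> \<beta>" "\<rho> = bc \<alpha> \<beta>" "bs \<alpha> = m" "bs \<beta> = n"
proof (cases \<rho>)
  case None
  then have "m + n = 0" using assms by (simp add: bs_simps)
  then have "m = 0 \<and> n = 0" by (auto simp: fun_eq_iff)
  then show ?thesis using None that[of None None] by (auto simp: bar_None bs_simps)
next
  case (Some c)
  then have c: "c \<in> mor G" "shape G c = m + n" "shape G c \<noteq> 0" using assms by (auto simp: bar_Some bs_simps)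
  obtain a b where ab: "a \<in> mor G" "b \<in> mor G" "src G a = tgt G b" "c = comp G a b" "shape G a = m" "shape G b = n"
    using factor[OF c(1,2)] .
  have "\<rho> = to_bar G c" using Some c by (simp add: to_bar_def)
  then show ?thesis using ab to_bar_comp[OF ab(1-3)] that[of "to_bar G a" "to_bar G b"]
    by (simp add: to_bar_in bs_to_bar)
qed

text \<open>Uniqueness survives the collapse of the objects because shape 0 identifies \<Omega>:
  factors of equal shape are \<Omega> simultaneously, and otherwise \<open>factor_unique\<close>
  applies.\<close>

lemma bar_factor_unique:
  assumes "\<alpha> \<in> L" "\<beta> \<in> L" "bco \<alpha> \<beta>" "\<alpha>' \<in> L" "\<beta>' \<in> L" "bco \<alpha>' \<beta>'"
    and eq: "bc \<alpha> \<beta> = bc \<alpha>' \<beta>'" "bs \<alpha> = bs \<alpha>' \<or> bs \<beta> = bs \<beta>'"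
  shows "\<alpha> = \<alpha>' \<and> \<beta> = \<beta>'"
proof -
  have "bs \<alpha> + bs \<beta> = bs \<alpha>' + bs \<beta>'"
    using bc_props(2) assms by metis
  then have s: "bs \<alpha> = bs \<alpha>'" "bs \<beta> = bs \<beta>'" using eq(2) by auto
  have "\<alpha> = None \<longleftrightarrow> \<alpha>' = None" "\<beta> = None \<longleftrightarrow> \<beta>' = None"
    using s assms bs_zero by metis+
  then show ?thesis
    using assms s by (cases \<alpha>; cases \<alpha>'; cases \<beta>; cases \<beta>') (auto simp: bar_Some bs_simps dest: factor_unique)
qed

section \<open>Multiplication on \<Lambda>-bar and the diagonal of the Toeplitz algebra\<close>

definition lpm :: "'a option \<Rightarrow> 'a option \<rightharpoonup> 'a option" where
  "lpm \<xi> \<nu> = (if \<nu> \<in> L \<and> bco \<xi> \<nu> then Some (bc \<xi> \<nu>) else None)"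

definition rpm :: "'a option \<Rightarrow> 'a option \<rightharpoonup> 'a option" where
  "rpm \<mu> \<nu> = (if \<nu> \<in> L \<and> bco \<nu> \<mu> then Some (bc \<nu> \<mu>) else None)"

lemma pinv_lpm: "\<xi> \<in> L \<Longrightarrow> pinv L (lpm \<xi>) (minv (lpm \<xi>))"
  and pinv_rpm: "\<xi> \<in> L \<Longrightarrow> pinv L (rpm \<xi>) (minv (rpm \<xi>))"
  by (rule pinv_minv; auto simp: lpm_def rpm_def ran_def bc_props split: if_splits dest: bar_factor_unique)+

lemma minv_lpm: "\<xi> \<in> L \<Longrightarrow> minv (lpm \<xi>) \<nu> = Some \<beta> \<longleftrightarrow> lpm \<xi> \<beta> = Some \<nu>"
  and minv_rpm: "\<xi> \<in> L \<Longrightarrow> minv (rpm \<xi>) \<nu> = Some \<beta> \<longleftrightarrow> rpm \<xi> \<beta> = Some \<nu>"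
  using pinv_lpm pinv_rpm by (simp_all add: pinv_def)

lemma L_op_eq: "Some a \<in> L \<Longrightarrow> L_op G a = pull_op L (minv (lpm (Some a)))"
  unfolding L_op_def by (rule op_on_basis_pull[OF pinv_lpm]) (auto simp: lpm_def)

lemma R_op_eq: "Some a \<in> L \<Longrightarrow> R_op G a = pull_op L (minv (rpm (Some a)))"
  unfolding R_op_def by (rule op_on_basis_pull[OF pinv_rpm]) (auto simp: rpm_def)

text \<open>Entries are normalized to vanish off \<Lambda>-bar, so that each operator of the
  diagonal algebra comes from exactly one function.\<close>

definition A :: "('a option \<Rightarrow> complex) set" where
  "A = {f. (\<forall>\<mu>. \<mu> \<notin> L \<longrightarrow> f \<mu> = 0) \<and> (\<exists>C. \<forall>\<mu>. cmod (f \<mu>) \<le> C) \<and> diag_op L f \<in> toeplitz_algebra G}"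

lemmas closed_E = cstar_generated_closed[where I = L and S =
    "L_op G ` {a\<in>mor G. shape G a \<noteq> 0} \<union> R_op G ` {a\<in>mor G. shape G a \<noteq> 0}", folded toeplitz_algebra_def]

lemma A_I: "(\<And>\<mu>. \<mu> \<notin> L \<Longrightarrow> f \<mu> = 0) \<Longrightarrow> (\<And>\<mu>. cmod (f \<mu>) \<le> C) \<Longrightarrow> diag_op L f \<in> toeplitz_algebra G \<Longrightarrow> f \<in> A"
  by (auto simp: A_def)

lemma A_D:
  assumes "f \<in> A"
  shows "\<mu> \<notin> L \<Longrightarrow> f \<mu> = 0" "\<exists>C. \<forall>\<mu>. cmod (f \<mu>) \<le> C" "diag_op L f \<in> toeplitz_algebra G"
  using assms by (auto simp: A_def)

lemma A_add: assumes "f \<in> A" "g \<in> A" shows "(\<lambda>\<mu>. f \<mu> + g \<mu>) \<in> A"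
proof -
  obtain C C' where "\<forall>\<mu>. cmod (f \<mu>) \<le> C" "\<forall>\<mu>. cmod (g \<mu>) \<le> C'"
    using A_D(2) assms by metis
  then have "cmod (f \<mu> + g \<mu>) \<le> C + C'" for \<mu> using norm_triangle_mono by blast
  then show ?thesis using A_D[OF assms(1)] A_D[OF assms(2)] closed_E(2)[of "diag_op L f" "diag_op L g"]
    by (auto intro!: A_I simp: diag_op_add)
qed

lemma A_mult: assumes "f \<in> A" "g \<in> A" shows "(\<lambda>\<mu>. f \<mu> * g \<mu>) \<in> A"
proof -
  obtain C C' where C: "\<forall>\<mu>. cmod (f \<mu>) \<le> C" "\<forall>\<mu>. cmod (g \<mu>) \<le> C'"
    using A_D(2) assms by metis
  have "cmod (f \<mu> * g \<mu>) \<le> C * C'" for \<mu>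
    unfolding norm_mult using C order_trans[OF norm_ge_zero C(1)[rule_format]] by (intro mult_mono) auto
  moreover have "diag_op L f \<circ> diag_op L g = diag_op L (\<lambda>\<mu>. f \<mu> * g \<mu>)" using C by (auto intro: diag_op_comp)
  ultimately show ?thesis using A_D[OF assms(1)] A_D[OF assms(2)] closed_E(3)[of "diag_op L f" "diag_op L g"]
    by (auto intro!: A_I)
qed

lemma A_scl: assumes "f \<in> A" shows "(\<lambda>\<mu>. c * f \<mu>) \<in> A"
proof -
  obtain C where C: "\<forall>\<mu>. cmod (f \<mu>) \<le> C" using A_D(2) assms by metis
  then have "cmod (c * f \<mu>) \<le> cmod c * C" for \<mu> by (simp add: norm_mult mult_left_mono)
  then show ?thesis using A_D[OF assms(1)] closed_E(4)[of "diag_op L f" c]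
    by (auto intro!: A_I simp: scale_diag_op)
qed

lemma A_cnj: assumes "f \<in> A" shows "(\<lambda>\<mu>. cnj (f \<mu>)) \<in> A"
proof -
  obtain C where C: "\<forall>\<mu>. cmod (f \<mu>) \<le> C" using A_D(2) assms by metis
  then have "adj L (diag_op L f) = diag_op L (\<lambda>\<mu>. cnj (f \<mu>))" by (auto intro: adj_diag_op)
  then show ?thesis using A_D[OF assms(1)] C closed_E(5)[of "diag_op L f"]
    by (auto intro!: A_I[of _ C])
qed

lemma A_lim:
  assumes "\<And>\<mu>. \<mu> \<notin> L \<Longrightarrow> f \<mu> = 0" and lim: "\<And>\<epsilon>. \<epsilon> > 0 \<Longrightarrow> \<exists>g\<in>A. \<forall>\<mu>\<in>L. cmod (f \<mu> - g \<mu>) \<le> \<epsilon>"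
  shows "f \<in> A"
proof -
  \<comment> \<open>A single approximation within 1 already bounds \<open>f\<close>.\<close>
  obtain g where g: "g \<in> A" "\<forall>\<mu>\<in>L. cmod (f \<mu> - g \<mu>) \<le> 1" using lim[of 1] by auto
  obtain C where C: "\<forall>\<mu>. cmod (g \<mu>) \<le> C" using A_D(2) g by metis
  have b: "cmod (f \<mu>) \<le> \<bar>C\<bar> + 1" for \<mu>
  proof (cases "\<mu> \<in> L")
    case True
    have "cmod (f \<mu>) \<le> cmod (g \<mu>) + cmod (f \<mu> - g \<mu>)" by (rule norm_triangle_sub)
    then show ?thesis using g(2) C True by (smt (verit))
  qed (simp add: assms(1))
  have "diag_op L f \<in> toeplitz_algebra G"
  proof (rule closed_E(7))
    show "diag_op L f \<in> bounded_ops L" using b by (rule diag_op_bounded)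
    fix \<epsilon> :: real assume e: "\<epsilon> > 0"
    obtain g where g: "g \<in> A" "\<forall>\<mu>\<in>L. cmod (f \<mu> - g \<mu>) \<le> \<epsilon>" using lim[OF e] by auto
    then show "\<exists>B\<in>toeplitz_algebra G. \<forall>\<xi>\<in>ell2 L. ell2_norm L (\<lambda>\<mu>. diag_op L f \<xi> \<mu> - B \<xi> \<mu>) \<le> \<epsilon> * ell2_norm L \<xi>"
      using e A_D(3)[OF g(1)] diag_op_approx[OF g(2)] by (intro bexI[of _ "diag_op L g"]) auto
  qed
  then show ?thesis using assms(1) b by (intro A_I[of _ "\<bar>C\<bar> + 1"]) auto
qed

text \<open>With \<open>S = pull_op L \<psi>\<close> in the algebra, so are
  \<open>S\<^sup>*\<close>, both conjugates of a diagonal operator and the initial projection;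
  \<open>pull_op_conj\<close> and \<open>pull_op_proj\<close> read off their entries.\<close>

lemma pull_gen:
  assumes "pinv L \<phi> \<psi>" "pull_op L \<psi> \<in> toeplitz_algebra G" "f \<in> A"
  shows "pull \<phi> f \<in> A" "pull \<psi> f \<in> A" "indicator (dom \<phi>) \<in> A"
proof -
  obtain C where C: "\<And>\<mu>. cmod (f \<mu>) \<le> C" using A_D(2) assms(3) by metis
  have \<phi>: "pull_op L \<phi> \<in> toeplitz_algebra G"
    using closed_E(5)[OF assms(2)] adj_pull_op[OF assms(1)] by simp
  have sub: "dom \<phi> \<subseteq> L" "dom \<psi> \<subseteq> L" using assms(1) by (auto simp: pinv_def)
  have b: "cmod (pull \<phi> f \<mu>) \<le> \<bar>C\<bar>" "cmod (pull \<psi> f \<mu>) \<le> \<bar>C\<bar>" for \<mu>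
    using C by (auto simp: pull_def split: option.splits intro: order_trans[OF _ abs_ge_self])
  have conj: "pull_op L \<psi> \<circ> diag_op L f \<circ> pull_op L \<phi> = diag_op L (pull \<psi> f)"
    "pull_op L \<phi> \<circ> diag_op L f \<circ> pull_op L \<psi> = diag_op L (pull \<phi> f)"
    using C by (auto intro!: pull_op_conj[where C = C] assms(1) pinv_sym[OF assms(1)])
  have "diag_op L (pull \<phi> f) \<in> toeplitz_algebra G" "diag_op L (pull \<psi> f) \<in> toeplitz_algebra G"
    using closed_E(3)[OF closed_E(3)[OF \<phi> A_D(3)[OF assms(3)]] assms(2)]
      closed_E(3)[OF closed_E(3)[OF assms(2) A_D(3)[OF assms(3)]] \<phi>] conj by simp_all
  moreover have "pull \<phi> f \<mu> = 0" "pull \<psi> f \<mu> = 0" if "\<mu> \<notin> L" for \<mu>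
    using sub that by (auto simp: pull_def split: option.splits)
  ultimately show "pull \<phi> f \<in> A" "pull \<psi> f \<in> A"
    by (auto intro: A_I[OF _ b(1)] A_I[OF _ b(2)])
  have "pull \<phi> (\<lambda>_. 1) = indicator (dom \<phi>)"
    by (auto simp: pull_def indicator_def fun_eq_iff split: option.splits)
  then have "diag_op L (indicator (dom \<phi>)) \<in> toeplitz_algebra G"
    using closed_E(3)[OF \<phi> assms(2)] pull_op_proj[OF assms(1)] by simp
  then show "indicator (dom \<phi>) \<in> A"
    using sub by (intro A_I[of _ 1]) (auto simp: indicator_def)
qed

lemma gens_in_E:
  assumes "Some a \<in> L"
  shows "pull_op L (minv (lpm (Some a))) \<in> toeplitz_algebra G" "pull_op L (minv (rpm (Some a))) \<in> toeplitz_algebra G"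
  unfolding L_op_eq[OF assms, symmetric] R_op_eq[OF assms, symmetric]
  using assms by (auto simp: bar_Some intro!: closed_E(6))

text \<open>Supplies the member of \<open>A\<close> that \<open>pull_gen\<close> asks for while the
  unit is still to be found.\<close>

lemma zero_in_A: "(\<lambda>_. 0) \<in> A"
  by (rule A_I[of _ 0]) (use closed_E(1) in \<open>auto simp: diag_op_def zero_fun_def cong: if_cong\<close>)

lemma unit_shape_nz: "unit_shape i \<noteq> (0 :: 'r shp)"
  by (auto simp: unit_shape_def fun_eq_iff)

lemma finite_bar_shape: "finite {\<alpha> \<in> L. bs \<alpha> = m}"
proof -
  have "{\<alpha> \<in> L. bs \<alpha> = m} \<subseteq> insert None (Some ` {a \<in> mor G. shape G a = m})"
    by (auto simp: bar_def bs_simps)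
  moreover have "finite {a \<in> mor G. shape G a = m}" using cond_F unfolding cond_F_def by blast
  ultimately show ?thesis by (meson finite_imageI finite_insert finite_subset)
qed

lemma finite_objs: "finite (objs G)"
  using cond_F unfolding cond_F_def objs_def by blast

lemma ex_src:
  assumes "v \<in> objs G" obtains a where "a \<in> mor G" "shape G a = n" "src G a = v"
proof -
  have "{a\<in>mor G. shape G a = n \<and> src G a = v} \<noteq> {}" using cond_F assms unfolding cond_F_def by blast
  then show ?thesis using that by blast
qed

lemma ex_tgt:
  assumes "v \<in> objs G" obtains a where "a \<in> mor G" "shape G a = n" "tgt G a = v"
proof -
  have "{a\<in>mor G. shape G a = n \<and> tgt G a = v} \<noteq> {}" using cond_F assms unfolding cond_F_def by blast
  then show ?thesis using that by blast
qed

text \<open>The unit is the supremum of the projections \<open>L\<^sub>a\<^sup>* L\<^sub>a\<close> over the finitely many \<open>a\<close> of a fixed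
  nonzero shape: every object is the source of such an \<open>a\<close>.\<close>

lemma one_in_A: "indicator L \<in> A"
proof -
  \<comment> \<open>Some index exists because the type \<open>'r\<close> is inhabited; any nonzero
    shape would serve.\<close>
  define e where "e = (unit_shape undefined :: 'r shp)"
  let ?S = "{\<alpha> \<in> L. bs \<alpha> = e}"
  have e: "e \<noteq> 0" by (simp add: e_def unit_shape_nz)
  have un: "indicator (U \<union> V) \<in> A" if "indicator U \<in> A" "indicator V \<in> A" for U V :: "'a option set"
  proof -
    \<comment> \<open>Inclusion-exclusion uses no unit, whereas the Boolean operations of
      \<open>function_algebra\<close> presuppose one.\<close>
    have "(indicator (U \<union> V) :: _ \<Rightarrow> complex) =
        (\<lambda>\<mu>. (indicator U \<mu> + indicator V \<mu>) + -1 * (indicator U \<mu> * indicator V \<mu>))"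
      by (auto simp: indicator_def fun_eq_iff)
    then show ?thesis using A_add[OF A_add[OF that] A_scl[OF A_mult[OF that], of "-1"]] by simp
  qed
  have d: "indicator (dom (lpm \<alpha>)) \<in> A" if \<alpha>: "\<alpha> \<in> ?S" for \<alpha>
  proof -
    obtain a where a: "\<alpha> = Some a" using \<alpha> e by (cases \<alpha>) (auto simp: bs_simps)
    show ?thesis using pull_gen(3)[OF pinv_lpm gens_in_E(1) zero_in_A] \<alpha> a by auto
  qed
  have "finite F \<Longrightarrow> F \<subseteq> ?S \<Longrightarrow> indicator (\<Union>\<alpha>\<in>F. dom (lpm \<alpha>)) \<in> A" for F
  proof (induction F rule: finite_induct)
    case empty then show ?case using zero_in_A by simp
  next
    case (insert \<alpha> F) then show ?case using un d by simp
  qed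
  from this[OF finite_bar_shape] have "indicator (\<Union>\<alpha>\<in>?S. dom (lpm \<alpha>)) \<in> A" by blast
  moreover have "(\<Union>\<alpha>\<in>?S. dom (lpm \<alpha>)) = L"
  proof (intro equalityI subsetI)
    fix \<nu> assume \<nu>: "\<nu> \<in> L"
    show "\<nu> \<in> (\<Union>\<alpha>\<in>?S. dom (lpm \<alpha>))"
    proof (cases \<nu>)
      case None
      \<comment> \<open>\<Omega> is composable with everything, so any morphism of shape
        \<open>e\<close> will do.\<close>
      have "{a\<in>mor G. shape G a = e} \<noteq> {}" using cond_F unfolding cond_F_def by blast
      then obtain a where "a \<in> mor G" "shape G a = e" by blast
      then show ?thesis using None e \<nu> by (intro UN_I[of "Some a"]) (auto simp: lpm_def bar_Some bs_simps)
    next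
      case (Some b)
      then have "tgt G b \<in> objs G" using \<nu> by (auto simp: bar_Some tgt_obj)
      then obtain a where "a \<in> mor G" "shape G a = e" "src G a = tgt G b" using ex_src by metis
      then show ?thesis using Some e \<nu> by (intro UN_I[of "Some a"]) (auto simp: lpm_def bar_Some bs_simps)
    qed
  qed (auto simp: lpm_def split: if_splits)
  ultimately show ?thesis by simp
qed

sublocale function_algebra L A
  by unfold_locales (use A_D A_add A_mult A_scl A_cnj A_lim one_in_A in auto)

lemma D_eq: "D = diag_algebra G"
proof (intro equalityI subsetI)
  fix T assume "T \<in> D"
  then show "T \<in> diag_algebra G"
    using A_D(2,3) by (fastforce simp: D_def diag_algebra_def diagonal_ops_eq)
next
  fix T assume "T \<in> diag_algebra G"
  then obtain f C where f: "T = diag_op L f" "\<forall>\<mu>\<in>L. cmod (f \<mu>) \<le> C" "T \<in> toeplitz_algebra G"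
    by (auto simp: diag_algebra_def diagonal_ops_eq)
  let ?g = "\<lambda>\<mu>. if \<mu> \<in> L then f \<mu> else 0"
  have T: "T = diag_op L ?g" unfolding f(1) by (rule diag_op_cong) auto
  have "cmod (?g \<mu>) \<le> \<bar>C\<bar>" for \<mu> using f(2) by (auto intro: order_trans[OF _ abs_ge_self])
  then have "?g \<in> A" using T f(3) by (intro A_I[of _ "\<bar>C\<bar>"]) auto
  then show "T \<in> D" using T by (auto simp: D_def)
qed

lemma X_topology_eq: "X_topology G = XT" and X_space_eq: "X_space G = X"
  using topspace_XT by (auto simp: X_topology_def D_eq)

lemma emb_eq: "emb G = point"
  by (auto simp: emb_def point_def D_eq fun_eq_iff)

section \<open>Multiplications as partial maps of X\<close>

lemma pmap_mult:
  assumes "\<xi> \<in> L"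
  shows "pmap (lpm \<xi>)" "pmap (minv (lpm \<xi>))" "pmap (rpm \<xi>)" "pmap (minv (rpm \<xi>))"
proof -
  have sub: "dom (lpm \<xi>) \<subseteq> L" "ran (lpm \<xi>) \<subseteq> L" "dom (rpm \<xi>) \<subseteq> L" "ran (rpm \<xi>) \<subseteq> L"
    "dom (minv (lpm \<xi>)) \<subseteq> L" "ran (minv (lpm \<xi>)) \<subseteq> L" "dom (minv (rpm \<xi>)) \<subseteq> L" "ran (minv (rpm \<xi>)) \<subseteq> L"
    using pinv_lpm[OF assms] pinv_rpm[OF assms] unfolding pinv_def by (force simp: ran_def)+
  have *: "(\<forall>f\<in>A. pull (lpm \<xi>) f \<in> A) \<and> (\<forall>f\<in>A. pull (minv (lpm \<xi>)) f \<in> A) \<and>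
      (\<forall>f\<in>A. pull (rpm \<xi>) f \<in> A) \<and> (\<forall>f\<in>A. pull (minv (rpm \<xi>)) f \<in> A)"
  proof (cases \<xi>)
    case None
    have id: "lpm None = Some |` L" "rpm None = Some |` L"
      by (auto simp: lpm_def rpm_def restrict_map_def bc_None bco_None)
    have minv_id: "minv (Some |` L) = Some |` L"
      by (auto simp: minv_def restrict_map_def fun_eq_iff split: if_splits)
    have "pull (Some |` L) f = f" if "f \<in> A" for f
      using A_D(1)[OF that] by (auto simp: pull_def restrict_map_def)
    then show ?thesis using None by (simp add: id minv_id)
  next
    case (Some a)
    then show ?thesis using pull_gen(1,2)[OF pinv_lpm gens_in_E(1)] pull_gen(1,2)[OF pinv_rpm gens_in_E(2)] assms
      by auto
  qed
  show "pmap (lpm \<xi>)" "pmap (minv (lpm \<xi>))" "pmap (rpm \<xi>)" "pmap (minv (rpm \<xi>))"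
    using sub * by (auto simp: pmap_def)
qed

lemma pm_None: "lpm None = Some |` L" "rpm None = Some |` L"
  by (auto simp: lpm_def rpm_def restrict_map_def bc_None bco_None)

text \<open>For a proper morphism this is \<open>dual_map_pull_op\<close>; for \<Omega> both sides
  are the identity of X. Facts on multiplication in X are thereby reduced to facts on partial maps
  of \<Lambda>-bar.\<close>

lemma lmult_eq: assumes "\<xi> \<in> L" shows "lmult G \<xi> = hat (lpm \<xi>)"
proof (cases \<xi>)
  case None
  then show ?thesis by (simp add: lmult_def pm_None hat_id X_space_eq)
next
  case (Some a)
  then show ?thesis using assms L_op_eq[of a] dual_map_pull_op[OF pmap_mult(1,2) pinv_lpm, OF assms assms assms]
    by (simp add: lmult_def D_eq)
qed

lemma rmult_eq: assumes "\<xi> \<in> L" shows "rmult G \<xi> = hat (rpm \<xi>)"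
proof (cases \<xi>)
  case None
  then show ?thesis by (simp add: rmult_def pm_None hat_id X_space_eq)
next
  case (Some a)
  then show ?thesis using assms R_op_eq[of a] dual_map_pull_op[OF pmap_mult(3,4) pinv_rpm, OF assms assms assms]
    by (simp add: rmult_def D_eq)
qed

definition ldiv :: "'a option \<Rightarrow> 'a xpoint \<rightharpoonup> 'a xpoint" where "ldiv \<xi> = hat (minv (lpm \<xi>))"
definition rdiv :: "'a option \<Rightarrow> 'a xpoint \<rightharpoonup> 'a xpoint" where "rdiv \<xi> = hat (minv (rpm \<xi>))"

lemma ldiv_iff: "\<xi> \<in> L \<Longrightarrow> ldiv \<xi> z = Some x \<longleftrightarrow> lmult G \<xi> x = Some z"
  using hat_inverse[OF pmap_mult(1,2) pinv_lpm] by (simp add: ldiv_def lmult_eq)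

lemma rdiv_iff: "\<xi> \<in> L \<Longrightarrow> rdiv \<xi> z = Some x \<longleftrightarrow> rmult G \<xi> x = Some z"
  using hat_inverse[OF pmap_mult(3,4) pinv_rpm] by (simp add: rdiv_def rmult_eq)

lemma mult_in_X:
  assumes "\<xi> \<in> L"
  shows "lmult G \<xi> x = Some z \<Longrightarrow> x \<in> X \<and> z \<in> X" "rmult G \<xi> x = Some z \<Longrightarrow> x \<in> X \<and> z \<in> X"
  using hat_SomeD(1,3) pmap_mult[OF assms] unfolding lmult_eq[OF assms] rmult_eq[OF assms] by blast+

lemma rmult_None: "rmult G None = Some |` X"
  by (simp add: rmult_def X_space_eq)

lemma lmult_None: "lmult G None = Some |` X"
  by (simp add: lmult_def X_space_eq)

text \<open>Associativity of \<xi>\<nu>\<mu>, read as an equality of partial maps in \<nu> and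
  transported by \<open>hat_comp\<close>.\<close>

lemma lmult_rmult:
  assumes "\<xi> \<in> L" "\<mu> \<in> L"
  shows "lmult G \<xi> \<circ>\<^sub>m rmult G \<mu> = rmult G \<mu> \<circ>\<^sub>m lmult G \<xi>"
proof -
  have "lpm \<xi> \<circ>\<^sub>m rpm \<mu> = rpm \<mu> \<circ>\<^sub>m lpm \<xi>"
  proof
    fix \<nu>
    show "(lpm \<xi> \<circ>\<^sub>m rpm \<mu>) \<nu> = (rpm \<mu> \<circ>\<^sub>m lpm \<xi>) \<nu>"
      using bc_assoc[OF assms(1) _ assms(2), of \<nu>] bc_props assms
      by (cases "\<nu> \<in> L"; cases "bco \<xi> \<nu>"; cases "bco \<nu> \<mu>") (auto simp: map_comp_def lpm_def rpm_def)
  qed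
  then show ?thesis using assms pmap_mult by (simp add: lmult_eq rmult_eq flip: hat_comp)
qed

text \<open>If \<alpha> and \<beta> do not compose, both differ from \<Omega>, and then \<alpha>
  composes with no multiple of \<beta>, not even with \<beta>\<Omega>; hence the empty map.\<close>

lemma lmult_lmult:
  assumes "\<alpha> \<in> L" "\<beta> \<in> L"
  shows "lmult G \<alpha> \<circ>\<^sub>m lmult G \<beta> = (if bco \<alpha> \<beta> then lmult G (bc \<alpha> \<beta>) else Map.empty)"
proof -
  have "lpm \<alpha> \<circ>\<^sub>m lpm \<beta> = (if bco \<alpha> \<beta> then lpm (bc \<alpha> \<beta>) else Map.empty)"
  proof
    fix \<nu>
    show "(lpm \<alpha> \<circ>\<^sub>m lpm \<beta>) \<nu> = (if bco \<alpha> \<beta> then lpm (bc \<alpha> \<beta>) else Map.empty) \<nu>"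
      using bc_assoc[OF assms, of \<nu>] bc_props assms
      by (cases "\<nu> \<in> L"; cases "bco \<alpha> \<beta>"; cases "bco \<beta> \<nu>") (auto simp: map_comp_def lpm_def)
  qed
  then show ?thesis using assms pmap_mult
    by (auto simp: lmult_eq bc_props hat_empty simp flip: hat_comp)
qed

lemma rmult_rmult:
  assumes "\<alpha> \<in> L" "\<beta> \<in> L"
  shows "rmult G \<beta> \<circ>\<^sub>m rmult G \<alpha> = (if bco \<alpha> \<beta> then rmult G (bc \<alpha> \<beta>) else Map.empty)"
proof -
  have "rpm \<beta> \<circ>\<^sub>m rpm \<alpha> = (if bco \<alpha> \<beta> then rpm (bc \<alpha> \<beta>) else Map.empty)"
  proof
    fix \<nu>
    show "(rpm \<beta> \<circ>\<^sub>m rpm \<alpha>) \<nu> = (if bco \<alpha> \<beta> then rpm (bc \<alpha> \<beta>) else Map.empty) \<nu>"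
      using bc_assoc[OF _ assms, of \<nu>] bc_props assms
      by (cases "\<nu> \<in> L"; cases "bco \<alpha> \<beta>"; cases "bco \<nu> \<alpha>") (auto simp: map_comp_def rpm_def)
  qed
  then show ?thesis using assms pmap_mult
    by (auto simp: rmult_eq bc_props hat_empty simp flip: hat_comp)
qed

section \<open>Existence and uniqueness of factorizations in X\<close>

definition shape_ge :: "'r shp \<Rightarrow> 'a option set" where "shape_ge m = {\<nu> \<in> L. m \<le> bs \<nu>}"

lemma shp_le: "(m :: 'r shp) \<le> n \<longleftrightarrow> (\<exists>k. n = m + k)"
proof
  assume "m \<le> n"
  then have "n = m + (\<lambda>i. n i - m i)" by (auto simp: le_fun_def fun_eq_iff)
  then show "\<exists>k. n = m + k" by blast
qed (auto simp: le_fun_def)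

text \<open>Factorization in \<Lambda>-bar: an element of shape at least m has a left factor of
  shape m. The union is finite by (F), so the set has its indicator in \<open>A\<close>.\<close>

lemma shape_ge_lpm: "shape_ge m = (\<Union>\<xi>\<in>{\<alpha> \<in> L. bs \<alpha> = m}. dom (minv (lpm \<xi>)))"
proof (intro equalityI subsetI)
  fix \<nu> assume "\<nu> \<in> shape_ge m"
  then obtain k where k: "\<nu> \<in> L" "bs \<nu> = m + k" by (auto simp: shape_ge_def shp_le)
  obtain \<alpha> \<beta> where "\<alpha> \<in> L" "\<beta> \<in> L" "bco \<alpha> \<beta>" "\<nu> = bc \<alpha> \<beta>" "bs \<alpha> = m" using bar_factor[OF k] by metis
  moreover from this have "minv (lpm \<alpha>) \<nu> = Some \<beta>" by (simp add: minv_lpm lpm_def)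
  ultimately show "\<nu> \<in> (\<Union>\<xi>\<in>{\<alpha> \<in> L. bs \<alpha> = m}. dom (minv (lpm \<xi>)))" by blast
next
  fix \<nu> assume "\<nu> \<in> (\<Union>\<xi>\<in>{\<alpha> \<in> L. bs \<alpha> = m}. dom (minv (lpm \<xi>)))"
  then obtain \<alpha> \<beta> where a: "\<alpha> \<in> L" "bs \<alpha> = m" "minv (lpm \<alpha>) \<nu> = Some \<beta>" by auto
  then have "lpm \<alpha> \<beta> = Some \<nu>" by (simp add: minv_lpm)
  then show "\<nu> \<in> shape_ge m" using a bc_props[of \<alpha> \<beta>] by (auto simp: shape_ge_def lpm_def shp_le split: if_splits)
qed

lemma shape_ge_rpm: "shape_ge m = (\<Union>\<xi>\<in>{\<alpha> \<in> L. bs \<alpha> = m}. dom (minv (rpm \<xi>)))"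
proof (intro equalityI subsetI)
  fix \<nu> assume "\<nu> \<in> shape_ge m"
  then obtain k where k: "\<nu> \<in> L" "bs \<nu> = k + m" by (auto simp: shape_ge_def shp_le add.commute)
  obtain \<alpha> \<beta> where "\<alpha> \<in> L" "\<beta> \<in> L" "bco \<alpha> \<beta>" "\<nu> = bc \<alpha> \<beta>" "bs \<beta> = m" using bar_factor[OF k] by metis
  moreover from this have "minv (rpm \<beta>) \<nu> = Some \<alpha>" by (simp add: minv_rpm rpm_def)
  ultimately show "\<nu> \<in> (\<Union>\<xi>\<in>{\<alpha> \<in> L. bs \<alpha> = m}. dom (minv (rpm \<xi>)))" by blast
next
  fix \<nu> assume "\<nu> \<in> (\<Union>\<xi>\<in>{\<alpha> \<in> L. bs \<alpha> = m}. dom (minv (rpm \<xi>)))"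
  then obtain \<alpha> \<beta> where a: "\<alpha> \<in> L" "bs \<alpha> = m" "minv (rpm \<alpha>) \<nu> = Some \<beta>" by auto
  then have "rpm \<alpha> \<beta> = Some \<nu>" by (simp add: minv_rpm)
  then show "\<nu> \<in> shape_ge m" using a bc_props[of \<beta> \<alpha>] by (auto simp: shape_ge_def rpm_def le_fun_def split: if_splits)
qed

lemma ind_ge: "indicator (shape_ge m) \<in> A"
  unfolding shape_ge_lpm by (rule ind_UN[OF finite_bar_shape]) (auto intro: ind_dom pmap_mult)

text \<open>\<open>In_ranges_iff\<close> for the finite cover \<open>shape_ge_lpm\<close>: the
  ultrafilter selects one left factor.\<close>

lemma left_factor_iff:
  assumes "x \<in> X"
  shows "In x (shape_ge m) \<longleftrightarrow> (\<exists>\<xi> z. \<xi> \<in> L \<and> bs \<xi> = m \<and> lmult G \<xi> z = Some x)"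
proof -
  have "In x (shape_ge m) \<longleftrightarrow> (\<exists>\<xi>\<in>{\<alpha> \<in> L. bs \<alpha> = m}. \<exists>z. hat (lpm \<xi>) z = Some x)"
    unfolding shape_ge_lpm using pmap_mult pinv_lpm
    by (intro In_ranges_iff[OF assms finite_bar_shape]) blast
  also have "\<dots> \<longleftrightarrow> (\<exists>\<xi>\<in>{\<alpha> \<in> L. bs \<alpha> = m}. \<exists>z. lmult G \<xi> z = Some x)"
    by (intro bex_cong refl) (simp add: lmult_eq)
  finally show ?thesis by auto
qed

lemma right_factor_iff:
  assumes "x \<in> X"
  shows "In x (shape_ge m) \<longleftrightarrow> (\<exists>\<xi> z. \<xi> \<in> L \<and> bs \<xi> = m \<and> rmult G \<xi> z = Some x)"
proof -
  have "In x (shape_ge m) \<longleftrightarrow> (\<exists>\<xi>\<in>{\<alpha> \<in> L. bs \<alpha> = m}. \<exists>z. hat (rpm \<xi>) z = Some x)"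
    unfolding shape_ge_rpm using pmap_mult pinv_rpm
    by (intro In_ranges_iff[OF assms finite_bar_shape]) blast
  also have "\<dots> \<longleftrightarrow> (\<exists>\<xi>\<in>{\<alpha> \<in> L. bs \<alpha> = m}. \<exists>z. rmult G \<xi> z = Some x)"
    by (intro bex_cong refl) (simp add: rmult_eq)
  finally show ?thesis by auto
qed

lemma pm_apply_None: "\<xi> \<in> L \<Longrightarrow> lpm \<xi> None = Some \<xi>" "\<xi> \<in> L \<Longrightarrow> rpm \<xi> None = Some \<xi>"
  by (simp_all add: lpm_def rpm_def bar_None bco_None bc_None)

text \<open>Multiplications by elements of one shape coincide or have disjoint ranges, so
  \<open>hat_unique\<close> applies.\<close>

lemma left_unique:
  assumes "\<xi> \<in> L" "\<xi>' \<in> L" "bs \<xi> = bs \<xi>'" "lmult G \<xi> z = Some x" "lmult G \<xi>' z' = Some x"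
  shows "\<xi> = \<xi>' \<and> z = z'"
proof -
  have "dom (minv (lpm \<xi>)) \<inter> dom (minv (lpm \<xi>')) = {} \<or> lpm \<xi> = lpm \<xi>'"
  proof (rule disjCI, rule ccontr)
    assume ne: "lpm \<xi> \<noteq> lpm \<xi>'" and "dom (minv (lpm \<xi>)) \<inter> dom (minv (lpm \<xi>')) \<noteq> {}"
    then obtain \<nu> \<beta> \<beta>' where "lpm \<xi> \<beta> = Some \<nu>" "lpm \<xi>' \<beta>' = Some \<nu>" using assms(1,2) by (auto simp: minv_lpm)
    then show False using ne bar_factor_unique[of \<xi> \<beta> \<xi>' \<beta>'] assms by (auto simp: lpm_def split: if_splits)
  qed
  from hat_unique[OF pmap_mult(1,2)[OF assms(1)] pinv_lpm[OF assms(1)] pmap_mult(1,2)[OF assms(2)] pinv_lpm[OF assms(2)] this]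
  have "lpm \<xi> = lpm \<xi>' \<and> z = z'" using assms by (simp add: lmult_eq)
  \<comment> \<open>Evaluation at \<Omega> recovers \<xi> from its multiplication map.\<close>
  then show ?thesis using pm_apply_None(1) assms(1,2) by (metis option.inject)
qed

lemma right_unique:
  assumes "\<xi> \<in> L" "\<xi>' \<in> L" "bs \<xi> = bs \<xi>'" "rmult G \<xi> z = Some x" "rmult G \<xi>' z' = Some x"
  shows "\<xi> = \<xi>' \<and> z = z'"
proof -
  have "dom (minv (rpm \<xi>)) \<inter> dom (minv (rpm \<xi>')) = {} \<or> rpm \<xi> = rpm \<xi>'"
  proof (rule disjCI, rule ccontr)
    assume ne: "rpm \<xi> \<noteq> rpm \<xi>'" and "dom (minv (rpm \<xi>)) \<inter> dom (minv (rpm \<xi>')) \<noteq> {}"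
    then obtain \<nu> \<beta> \<beta>' where "rpm \<xi> \<beta> = Some \<nu>" "rpm \<xi>' \<beta>' = Some \<nu>" using assms(1,2) by (auto simp: minv_rpm)
    then show False using ne bar_factor_unique[of \<beta> \<xi> \<beta>' \<xi>'] assms by (auto simp: rpm_def split: if_splits)
  qed
  from hat_unique[OF pmap_mult(3,4)[OF assms(1)] pinv_rpm[OF assms(1)] pmap_mult(3,4)[OF assms(2)] pinv_rpm[OF assms(2)] this]
  have "rpm \<xi> = rpm \<xi>' \<and> z = z'" using assms by (simp add: rmult_eq)
  then show ?thesis using pm_apply_None(2) assms(1,2) by (metis option.inject)
qed

section \<open>The source map on X and the isolated point \<Omega>\<close>

text \<open>\<open>\<Omega>\<close> is included, by the convention that it is composable with everything.\<close>

definition src_at :: "'a \<Rightarrow> 'a option set" where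
  "src_at v = {\<nu> \<in> L. \<forall>a. \<nu> = Some a \<longrightarrow> src G a = v}"

lemma dom_rpm: "Some a \<in> L \<Longrightarrow> dom (rpm (Some a)) = src_at (tgt G a)"
proof -
  have "bco \<nu> (Some a) \<longleftrightarrow> (\<forall>b. \<nu> = Some b \<longrightarrow> src G b = tgt G a)" for \<nu>
    by (cases \<nu>) auto
  then show ?thesis by (auto simp: rpm_def src_at_def split: if_splits)
qed

text \<open>By (F) every object is the terminus of some morphism of nonzero shape, and the set is
  the domain of right multiplication by it.\<close>

lemma ind_src_at: assumes "v \<in> objs G" shows "indicator (src_at v) \<in> A"
proof -
  obtain a where "a \<in> mor G" "shape G a = unit_shape undefined" "tgt G a = v" using ex_tgt[OF assms] by blast
  then have "Some a \<in> L" "tgt G a = v" by (auto simp: bar_Some unit_shape_nz)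
  then show ?thesis using ind_dom[OF pmap_mult(3)] dom_rpm by metis
qed

text \<open>\<Omega> is the only element of \<Lambda>-bar that has shape at least 1 in none of the
  finitely many coordinates.\<close>

lemma ind_Omega: "indicator {None} \<in> A"
proof -
  have "{None} = L - (\<Union>i\<in>UNIV. shape_ge (unit_shape i))"
  proof (intro equalityI subsetI)
    fix \<nu> assume "\<nu> \<in> L - (\<Union>i\<in>UNIV. shape_ge (unit_shape i))"
    then have \<nu>: "\<nu> \<in> L" "\<And>i. \<not> unit_shape i \<le> bs \<nu>" by (auto simp: shape_ge_def)
    have "bs \<nu> i = 0" for i
    proof (rule ccontr)
      assume "bs \<nu> i \<noteq> 0"
      then have "unit_shape i \<le> bs \<nu>" by (auto simp: unit_shape_def le_fun_def)
      then show False using \<nu> by blast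
    qed
    then have "bs \<nu> = 0" by (simp add: fun_eq_iff)
    then show "\<nu> \<in> {None}" using bs_zero \<nu> by blast
  next
    fix \<nu> :: "'a option" assume "\<nu> \<in> {None}"
    then show "\<nu> \<in> L - (\<Union>i\<in>UNIV. shape_ge (unit_shape i))"
      by (auto simp: bar_None shape_ge_def bs_simps unit_shape_def le_fun_def)
  qed
  then show ?thesis
    using ind_Diff[OF one_in_A ind_UN[OF finite, of UNIV "\<lambda>i. shape_ge (unit_shape i)"]] ind_ge by simp
qed

lemma Omega_iff: "x \<in> X \<Longrightarrow> x = Omega G \<longleftrightarrow> In x {None}"
  using In_singleton[OF _ ind_Omega] In_point[OF ind_Omega] by (auto simp: emb_eq)

lemma L_src_at: "L = (\<Union>v\<in>objs G. src_at v)"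
proof -
  \<comment> \<open>An object must exist for \<Omega> to be covered by the union.\<close>
  have "{a \<in> mor G. shape G a = 0} \<noteq> {}" using cond_F unfolding cond_F_def by blast
  then have "objs G \<noteq> {}" by (auto simp: objs_def)
  then show ?thesis by (auto simp: src_at_def bar_Some bar_None intro: src_obj)
      (metis bar_Some not_None_eq option.inject src_obj ex_in_conv)
qed

text \<open>The finitely many sets \<open>src_at v\<close> cover \<Lambda>-bar and meet pairwise in
  \<Omega> alone, so an ultrafilter other than \<Omega> contains exactly one of them.\<close>

lemma ex1_src:
  assumes "x \<in> X" "x \<noteq> Omega G"
  shows "\<exists>!v. v \<in> objs G \<and> In x (src_at v)"
proof -
  have "In x (\<Union>v\<in>objs G. src_at v)" using In_UNIV[OF assms(1)] L_src_at by simp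
  then obtain v where v: "v \<in> objs G" "In x (src_at v)"
    using In_UN[OF assms(1) finite_objs ind_src_at] by auto
  show ?thesis
  proof (rule ex1I[of _ v])
    fix w assume w: "w \<in> objs G \<and> In x (src_at w)"
    show "w = v"
    proof (rule ccontr)
      assume "w \<noteq> v"
      then have "src_at w \<inter> src_at v = {None}" by (auto simp: src_at_def bar_None)
      then have "In x {None}" using In_Int[OF assms(1) ind_src_at ind_src_at, of w v] v w by simp
      then show False using Omega_iff[OF assms(1)] assms(2) by simp
    qed
  qed (use v in simp)
qed

text \<open>The candidate for the extended source selects the object of \<open>ex1_src\<close>. It
  is continuous since each \<open>src_at v\<close> defines an open set, and it is correct on
  morphisms, so it is the extension.\<close>

lemma X_src_props:
  assumes "x \<in> X" "x \<noteq> Omega G"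
  shows "X_src G x \<in> objs G" "In x (src_at (X_src G x))"
proof -
  let ?S = "X - {Omega G}"
  define g where "g = restrict (\<lambda>x. THE v. v \<in> objs G \<and> In x (src_at v)) ?S"
  have g: "g x \<in> objs G \<and> In x (src_at (g x))" if "x \<in> X" "x \<noteq> Omega G" for x
    using theI'[OF ex1_src[OF that]] that by (simp add: g_def)
  have open_S: "openin XT ?S"
  proof -
    have "?S = {x \<in> X. In x (L - {None})}"
      using Omega_iff In_Diff[OF _ one_in_A ind_Omega] In_UNIV by auto
    then show ?thesis using openin_In[OF ind_Diff[OF one_in_A ind_Omega]] by simp
  qed
  have top: "topspace (subtopology XT ?S) = ?S" by (auto simp: topspace_XT)
  have cont: "continuous_map (subtopology XT ?S) (discrete_topology (objs G)) g"
  proof -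
    have "openin (subtopology XT ?S) {x \<in> ?S. g x \<in> W}" if W: "W \<subseteq> objs G" for W
    proof -
      have "{x \<in> ?S. g x \<in> W} = (\<Union>v\<in>W. {x \<in> X. In x (src_at v)}) \<inter> ?S"
        using g ex1_src W by blast
      moreover have "openin XT (\<Union>v\<in>W. {x \<in> X. In x (src_at v)})"
        using W by (auto intro!: openin_Union openin_In ind_src_at)
      ultimately show ?thesis by (auto simp: openin_subtopology)
    qed
    then show ?thesis using g by (auto simp: continuous_map_def topspace_XT)
  qed
  have g_point: "g (emb G (Some a)) = src G a" if a: "a \<in> mor G" "shape G a \<noteq> 0" for a
  proof -
    have l: "Some a \<in> L" using a by (simp add: bar_Some)
    have p: "point (Some a) \<in> X" using point_in_X[OF l] .
    moreover have ne: "point (Some a) \<noteq> Omega G"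
      using Omega_iff[OF p] In_point[OF ind_Omega] by simp
    moreover have "In (point (Some a)) (src_at (src G a))"
      using In_point[OF ind_src_at[OF src_obj[OF a(1)]]] l by (auto simp: src_at_def)
    ultimately show ?thesis using ex1_src[OF p ne] g[OF p ne] src_obj[OF a(1)] by (auto simp: emb_eq)
  qed
  have "X_src G = g"
    unfolding X_src_def X_space_eq unfolding X_topology_eq
  proof (rule cont_extension_eqI[OF open_S Hausdorff_space_discrete_topology _ cont])
    fix \<mu> assume m: "\<mu> \<in> L" "point \<mu> \<in> ?S"
    then obtain a where "\<mu> = Some a" by (cases \<mu>) (auto simp: emb_eq)
    then show "point \<mu> \<in> (\<lambda>a. emb G (Some a)) ` {a \<in> mor G. shape G a \<noteq> 0}" using m by (auto simp: emb_eq bar_Some)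
  qed (use g_point in \<open>auto simp: g_def\<close>)
  then show "X_src G x \<in> objs G" "In x (src_at (X_src G x))" using g[OF assms] by auto
qed

text \<open>Since \<Omega> lies in every \<open>src_at v\<close>, one Boolean condition expresses
  composability, the convention for \<Omega> included.\<close>

lemma In_src_at_iff:
  assumes "x \<in> X" "v \<in> objs G"
  shows "In x (src_at v) \<longleftrightarrow> x = Omega G \<or> X_src G x = v"
proof (cases "x = Omega G")
  case True
  then show ?thesis using Omega_iff[OF assms(1)] In_mono[OF assms(1) ind_Omega ind_src_at[OF assms(2)]]
    by (auto simp: src_at_def bar_None)
next
  case False
  then show ?thesis using X_src_props[OF assms(1) False] ex1_src[OF assms(1) False] assms(2) by blast
qed

section \<open>The extended shape\<close>

text \<open>Splits a lower bound on the shape into its coordinates, one at a time; membership of the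
  indicator in \<open>A\<close> is carried along because \<open>In_Int\<close> needs it.\<close>

lemma In_shape_ge_finite:
  assumes x: "x \<in> X" and "finite F"
  shows "indicator {\<nu> \<in> L. \<forall>i\<in>F. m i \<le> bs \<nu> i} \<in> A \<and>
    (In x {\<nu> \<in> L. \<forall>i\<in>F. m i \<le> bs \<nu> i} \<longleftrightarrow> (\<forall>i\<in>F. In x (shape_ge (\<lambda>j. if j = i then m i else 0))))"
  using assms(2)
proof (induction F rule: finite_induct)
  case empty
  then show ?case using In_UNIV[OF x] one_in_A by simp
next
  case (insert i F)
  have "{\<nu> \<in> L. \<forall>i\<in>insert i F. m i \<le> bs \<nu> i} =
      shape_ge (\<lambda>j. if j = i then m i else 0) \<inter> {\<nu> \<in> L. \<forall>i\<in>F. m i \<le> bs \<nu> i}"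
    by (auto simp: shape_ge_def le_fun_def)
  then show ?case using insert In_Int[OF x ind_ge] ind_Int[OF ind_ge] by simp
qed

lemma In_shape_ge:
  "x \<in> X \<Longrightarrow> In x (shape_ge m) \<longleftrightarrow> (\<forall>i. In x (shape_ge (\<lambda>j. if j = i then m i else 0)))"
  using In_shape_ge_finite[of x UNIV m] by (simp add: shape_ge_def le_fun_def)

text \<open>A downward closed set of naturals without n is bounded by n - 1; that it contains 0
  makes n positive.\<close>

lemma Sup_enat_ge:
  assumes "\<And>m n :: nat. P n \<Longrightarrow> m \<le> n \<Longrightarrow> P m" "P 0"
  shows "enat n \<le> Sup {enat k |k. P k} \<longleftrightarrow> P n"
proof
  assume le: "enat n \<le> Sup {enat k |k. P k}"
  show "P n"
  proof (rule ccontr)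
    assume not: "\<not> P n"
    then have "n > 0" using assms(2) by (cases n) auto
    have "k < n" if "P k" for k using that not assms(1) not_le by blast
    then have "Sup {enat k |k. P k} \<le> enat (n - 1)"
      by (intro Sup_least) fastforce
    also have "\<dots> < enat n" using \<open>n > 0\<close> by simp
    finally show False using le by simp
  qed
qed (auto intro: Sup_upper)

text \<open>The candidate for the extended shape takes in coordinate i the largest n for which x
  belongs to the elements of shape at least n there, possibly infinity. It is continuous and right
  on \<Lambda>-bar, so it is the extension.\<close>

lemma X_shape_ge:
  assumes "x \<in> X"
  shows "(\<forall>i. enat (m i) \<le> X_shape G x i) \<longleftrightarrow> In x (shape_ge m)"
proof -
  let ?u = "\<lambda>i n. shape_ge (\<lambda>j. if j = i then n else 0)"
  define g where "g = restrict (\<lambda>x i. Sup {enat n |n. In x (?u i n)}) X"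
  have g: "enat n \<le> g x i \<longleftrightarrow> In x (?u i n)" if x: "x \<in> X" for x i n
  proof -
    have "In x (?u i m)" if "In x (?u i n)" "m \<le> n" for n m
      using that by (intro In_mono[OF x ind_ge ind_ge that(1)]) (auto simp: shape_ge_def le_fun_def)
    moreover have "?u i 0 = L" by (auto simp: shape_ge_def le_fun_def)
    ultimately show ?thesis
      using x In_UNIV[OF x] Sup_enat_ge[of "\<lambda>n. In x (?u i n)" n] by (simp add: g_def)
  qed
  have coord: "continuous_map XT euclidean (\<lambda>x. g x i)" for i
    unfolding continuous_map_def
  proof (intro conjI allI impI)
    fix W :: "enat set" assume "openin euclidean W"
    then have W: "open W" by (rule open_openin[THEN iffD2])
    show "openin XT {x \<in> topspace XT. g x i \<in> W}"
    proof (subst openin_subopen, intro ballI)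
      fix x assume x: "x \<in> {x \<in> topspace XT. g x i \<in> W}"
      then have xX: "x \<in> X" by (simp add: topspace_XT)
      show "\<exists>T. openin XT T \<and> x \<in> T \<and> T \<subseteq> {x \<in> topspace XT. g x i \<in> W}"
      proof (cases "g x i")
        case (enat n)
        \<comment> \<open>The value n means at least n but not at least n + 1, an open
          condition.\<close>
        let ?T = "{x \<in> X. In x (?u i n - ?u i (Suc n))}"
        have iff: "z \<in> ?T \<longleftrightarrow> z \<in> X \<and> g z i = enat n" for z
        proof -
          have "g z i = enat n \<longleftrightarrow> enat n \<le> g z i \<and> \<not> enat (Suc n) \<le> g z i"
            by (cases "g z i") auto
          then show ?thesis using In_Diff[OF _ ind_ge ind_ge] g by blast
        qed
        have "openin XT ?T" by (intro openin_In ind_Diff ind_ge)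
        then show ?thesis using iff x xX enat by (intro exI[of _ ?T]) (auto simp: topspace_XT)
      next
        case infinity
        \<comment> \<open>A neighbourhood of infinity contains all values above some n, and
          exceeding n means being at least n + 1.\<close>
        then obtain n where n: "{enat n <..} \<subseteq> W" using W x by (auto simp: open_enat_iff)
        let ?T = "{x \<in> X. In x (?u i (Suc n))}"
        have "z \<in> ?T \<longleftrightarrow> z \<in> X \<and> enat n < g z i" for z
          using g[of z "Suc n" i] by (auto simp: Suc_ile_eq)
        moreover have "openin XT ?T" by (intro openin_In ind_ge)
        ultimately show ?thesis using n xX infinity by (intro exI[of _ ?T]) (auto simp: topspace_XT)
      qed
    qed
  qed simp
  have cont: "continuous_map XT euclidean g"
    unfolding euclidean_product_topology[symmetric] continuous_map_componentwise_UNIV using coord by blast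
  have "Hausdorff_space (euclidean :: enat topology)"
    unfolding Hausdorff_space_def
  proof (intro allI impI)
    fix u v :: enat assume "u \<in> topspace euclidean \<and> v \<in> topspace euclidean \<and> u \<noteq> v"
    then obtain U V where "open U" "open V" "u \<in> U" "v \<in> V" "U \<inter> V = {}" using hausdorff[of u v] by blast
    then show "\<exists>U V. openin euclidean U \<and> openin euclidean V \<and> u \<in> U \<and> v \<in> V \<and> disjnt U V"
      by (intro exI[of _ U] exI[of _ V]) (simp add: disjnt_def)
  qed
  then have haus: "Hausdorff_space (euclidean :: ('r \<Rightarrow> enat) topology)"
    by (metis euclidean_product_topology Hausdorff_space_product_topology)
  have g_point: "g (emb G \<mu>) = (\<lambda>i. enat (bs \<mu> i))" if m: "\<mu> \<in> L" for \<mu>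
  proof
    fix i
    have "enat n \<le> g (emb G \<mu>) i \<longleftrightarrow> n \<le> bs \<mu> i" for n
      using g[OF point_in_X[OF m]] In_point[OF ind_ge] m by (auto simp: emb_eq shape_ge_def le_fun_def)
    then have "enat (bs \<mu> i) \<le> g (emb G \<mu>) i" "\<not> enat (Suc (bs \<mu> i)) \<le> g (emb G \<mu>) i" by auto
    then show "g (emb G \<mu>) i = enat (bs \<mu> i)" by (cases "g (emb G \<mu>) i") auto
  qed
  have open_X: "openin XT X" using openin_topspace[of XT] by (simp add: topspace_XT)
  have sub: "subtopology XT X = XT" by (metis topspace_XT subtopology_topspace)
  have "cont_extension (subtopology XT X) euclidean (emb G) L (\<lambda>\<mu> i. enat (bs \<mu> i)) = g"
  proof (rule cont_extension_eqI[OF open_X haus])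
    show "g \<in> extensional X" by (simp add: g_def)
    show "continuous_map (subtopology XT X) euclidean g" unfolding sub by (rule cont)
    show "g (emb G \<mu>) = (\<lambda>i. enat (bs \<mu> i))" if "\<mu> \<in> L" for \<mu> by (rule g_point[OF that])
    show "point \<mu> \<in> emb G ` L" if "\<mu> \<in> L" for \<mu> unfolding emb_eq by (rule imageI[OF that])
  qed
  then have "X_shape G = g" by (simp only: X_shape_def X_topology_eq sub)
  then show ?thesis unfolding In_shape_ge[OF assms, of m] by (simp only: g[OF assms])
qed

end

section \<open>Infinite paths and the dynamical system\<close>

lemma map_comp_assoc: "(f \<circ>\<^sub>m g) \<circ>\<^sub>m h = f \<circ>\<^sub>m (g \<circ>\<^sub>m h)"
  by (auto simp: map_comp_def fun_eq_iff split: option.splits)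

context rank_graph_F
begin

section \<open>Paths, their initial segments and concatenation\<close>

lemma grid_simps:
  "(n, n') \<in> mor grid \<longleftrightarrow> n \<le> n'" "src grid (n, n') = (n', n')" "tgt grid (n, n') = (n, n)"
  "comp grid (n, k) (k', p) = (n, p)" "shape grid (n, n') = n' - n"
  by (simp_all add: grid_def)

lemma path_props:
  assumes "y \<in> paths G" "n \<le> n'"
  shows "y (n, n') \<in> mor G" "src G (y (n, n')) = y (n', n')" "tgt G (y (n, n')) = y (n, n)"
    "shape G (y (n, n')) = n' - n"
proof -
  have m: "(n, n') \<in> mor grid" using assms(2) by (simp add: grid_simps)
  have y: "y \<in> mor grid \<rightarrow>\<^sub>E mor G" "\<forall>\<mu>\<in>mor grid. src G (y \<mu>) = y (src grid \<mu>) \<and> tgt G (y \<mu>) = y (tgt grid \<mu>) \<and>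
      shape G (y \<mu>) = shape grid \<mu>"
    using assms(1) unfolding paths_def graph_functors_def by blast+
  show "y (n, n') \<in> mor G" by (rule PiE_mem[OF y(1) m])
  show "src G (y (n, n')) = y (n', n')" "tgt G (y (n, n')) = y (n, n)" "shape G (y (n, n')) = n' - n"
    using bspec[OF y(2) m] unfolding grid_simps by blast+
qed

lemma path_comp:
  assumes "y \<in> paths G" "n \<le> k" "k \<le> p"
  shows "y (n, p) = comp G (y (n, k)) (y (k, p))"
proof -
  have "\<forall>\<mu>\<in>mor grid. \<forall>\<nu>\<in>mor grid. src grid \<mu> = tgt grid \<nu> \<longrightarrow> y (comp grid \<mu> \<nu>) = comp G (y \<mu>) (y \<nu>)"
    using assms(1) unfolding paths_def graph_functors_def by blast
  from bspec[OF bspec[OF this, of "(n, k)"], of "(k, p)"] show ?thesis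
    using assms(2,3) unfolding grid_simps by blast
qed

lemma path_undef: "y \<in> paths G \<Longrightarrow> \<not> n \<le> n' \<Longrightarrow> y (n, n') = undefined"
proof -
  assume y: "y \<in> paths G" and n: "\<not> n \<le> n'"
  have "y \<in> mor grid \<rightarrow>\<^sub>E mor G" using y unfolding paths_def graph_functors_def by blast
  then show "y (n, n') = undefined" by (rule PiE_arb) (simp add: grid_simps n)
qed

lemma pathsI:
  assumes undef: "\<And>n n'. \<not> n \<le> n' \<Longrightarrow> y (n, n') = undefined"
    and mor: "\<And>n n'. n \<le> n' \<Longrightarrow> y (n, n') \<in> mor G \<and> src G (y (n, n')) = y (n', n') \<and> tgt G (y (n, n')) = y (n, n) \<and>
      shape G (y (n, n')) = n' - n"
    and comp: "\<And>n k p. n \<le> k \<Longrightarrow> k \<le> p \<Longrightarrow> y (n, p) = comp G (y (n, k)) (y (k, p))"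
  shows "y \<in> paths G"
  unfolding paths_def graph_functors_def
proof (intro CollectI conjI ballI impI)
  show "y \<in> mor grid \<rightarrow>\<^sub>E mor G"
  proof (rule PiE_I)
    fix \<mu> :: "'r shp \<times> 'r shp"
    show "\<mu> \<in> mor grid \<Longrightarrow> y \<mu> \<in> mor G" using mor by (cases \<mu>) (simp add: grid_simps)
    show "\<mu> \<notin> mor grid \<Longrightarrow> y \<mu> = undefined" using undef by (cases \<mu>) (simp add: grid_simps)
  qed
  fix \<mu> :: "'r shp \<times> 'r shp" assume \<mu>: "\<mu> \<in> mor grid"
  then show "src G (y \<mu>) = y (src grid \<mu>)" "tgt G (y \<mu>) = y (tgt grid \<mu>)" "shape G (y \<mu>) = shape grid \<mu>"
    using mor by (cases \<mu>; simp add: grid_simps)+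
  fix \<nu> :: "'r shp \<times> 'r shp" assume \<nu>: "\<nu> \<in> mor grid" "src grid \<mu> = tgt grid \<nu>"
  obtain n k k' p where e: "\<mu> = (n, k)" "\<nu> = (k', p)" by (cases \<mu>; cases \<nu>)
  have "n \<le> k" "k \<le> p" "k' = k" using \<mu> \<nu> unfolding e grid_simps by simp_all
  then show "y (comp grid \<mu> \<nu>) = comp G (y \<mu>) (y \<nu>)"
    unfolding e grid_simps using comp[of n k p] by simp
qed

lemma shp_ge0: "(0 :: 'r shp) \<le> n"
  by (auto simp: le_fun_def)

lemma shp_le_add: "(n :: 'r shp) \<le> n + k" "(n :: 'r shp) \<le> k + n"
  by (auto simp: le_fun_def)

lemma path0:
  assumes "y \<in> paths G"
  shows "y (0, n) \<in> mor G" "src G (y (0, n)) = y (n, n)" "tgt G (y (0, n)) = y (0, 0)" "shape G (y (0, n)) = n"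
  using path_props[OF assms shp_ge0] by auto

lemma path_obj: "y \<in> paths G \<Longrightarrow> y (n, n) \<in> objs G"
  using path_props[of y n n] by (auto simp: objs_def)

lemma shift_eq: "n \<le> n' \<Longrightarrow> shift m y (n, n') = y (n + m, n' + m)"
  by (simp add: shift_def)

lemma shift_in: assumes "y \<in> paths G" shows "shift m y \<in> paths G"
proof (rule pathsI)
  fix n n' :: "'r shp" assume "\<not> n \<le> n'"
  then show "shift m y (n, n') = undefined" by (simp add: shift_def)
next
  fix n n' :: "'r shp" assume le: "n \<le> n'"
  then have "n + m \<le> n' + m" by (simp add: le_fun_def)
  moreover have "n' + m - (n + m) = n' - n" by (auto simp: fun_eq_iff)
  ultimately show "shift m y (n, n') \<in> mor G \<and> src G (shift m y (n, n')) = shift m y (n', n') \<and>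
      tgt G (shift m y (n, n')) = shift m y (n, n) \<and> shape G (shift m y (n, n')) = n' - n"
    using path_props[OF assms, of "n + m" "n' + m"] le by (simp add: shift_eq)
next
  fix n k p :: "'r shp" assume le: "n \<le> k" "k \<le> p"
  then have "n + m \<le> k + m" "k + m \<le> p + m" by (simp_all add: le_fun_def)
  then show "shift m y (n, p) = comp G (shift m y (n, k)) (shift m y (k, p))"
    using path_comp[OF assms] le by (simp add: shift_eq order_trans[OF le])
qed

lemma shift_shift: "shift m (shift n y) = shift (m + n) (y :: ('a, 'r) path)"
proof
  fix p :: "'r shp \<times> 'r shp"
  obtain i j where p: "p = (i, j)" by (cases p)
  have "i \<le> j \<Longrightarrow> i + m \<le> j + m" by (simp add: le_fun_def)
  then show "shift m (shift n y) p = shift (m + n) y p"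
    unfolding p by (auto simp: shift_def add.assoc)
qed

lemma shift_0: "y \<in> paths G \<Longrightarrow> shift 0 y = y"
  using path_undef[of y] by (auto simp: shift_def fun_eq_iff restrict_def)

lemma path_split:
  assumes "y \<in> paths G"
  shows "y (0, m + n) = comp G (y (0, m)) (shift m y (0, n))"
  using path_comp[OF assms shp_ge0 shp_le_add(1), of m n] shift_eq[OF shp_ge0, of m y n] by (simp add: add.commute)

lemma src_shift: "y \<in> paths G \<Longrightarrow> src G (y (0, m)) = shift m y (0, 0)"
  using path0(2)[of y m] shift_eq[of 0 0 m y] by simp

text \<open>The value at (n, n') is the factor that completes the segment to n to the segment to n',
  and factorization makes it unique.\<close>

lemma path_eqI:
  assumes "y \<in> paths G" "y' \<in> paths G" "\<And>n. y (0, n) = y' (0, n)"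
  shows "y = y'"
proof
  fix p :: "'r shp \<times> 'r shp"
  obtain n n' where p: "p = (n, n')" by (cases p)
  show "y p = y' p"
  proof (cases "n \<le> n'")
    case True
    have "comp G (y (0, n)) (y (n, n')) = comp G (y' (0, n)) (y' (n, n'))"
      using path_comp[OF assms(1) shp_ge0 True] path_comp[OF assms(2) shp_ge0 True] assms(3) by metis
    then show ?thesis
      using factor_unique[of "y (0, n)" "y (n, n')" "y' (0, n)" "y' (n, n')"] assms(3)[of n]
        path0[OF assms(1), of n] path0[OF assms(2), of n] path_props[OF assms(1) True] path_props[OF assms(2) True]
      unfolding p by simp
  qed (simp add: p path_undef assms)
qed

text \<open>The converse of \<open>path_eqI\<close>: the value at (n, n') is defined as the unique
  completion of \<open>w n\<close> to \<open>w n'\<close>, and functoriality follows from its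
  uniqueness.\<close>

lemma path_of_segments:
  assumes w: "\<And>n. w n \<in> mor G \<and> shape G (w n) = n"
    and ext: "\<And>n k. \<exists>b\<in>mor G. src G (w n) = tgt G b \<and> w (n + k) = comp G (w n) b"
  obtains y where "y \<in> paths G" "\<And>n. y (0, n) = w n"
proof -
  define P where "P n n' b \<longleftrightarrow> b \<in> mor G \<and> src G (w n) = tgt G b \<and> w n' = comp G (w n) b" for n n' b
  have ex: "\<exists>b. P n n' b" if "n \<le> n'" for n n'
    using that ext unfolding P_def shp_le by blast
  have un: "b = b'" if "P n n' b" "P n n' b'" for n n' b b'
    using that w factor_unique[of "w n" b "w n" b'] unfolding P_def by metis
  define y where "y = restrict (\<lambda>(n, n'). THE b. P n n' b) {(n, n'). n \<le> n'}"
  have y: "P n n' (y (n, n'))" if "n \<le> n'" for n n'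
    using theI[of "P n n'"] ex[OF that] un that by (auto simp: y_def) 
  have yI: "y (n, n') = b" if "n \<le> n'" "P n n' b" for n n' b
    using un[OF y[OF that(1)] that(2)] .
  have diag: "y (n, n) = src G (w n)" for n
    using w src_tgt by (intro yI) (auto simp: P_def)
  have "y \<in> paths G"
  proof (rule pathsI)
    fix n n' :: "'r shp" assume le: "n \<le> n'"
    have b: "y (n, n') \<in> mor G" "src G (w n) = tgt G (y (n, n'))" "w n' = comp G (w n) (y (n, n'))"
      using y[OF le] by (auto simp: P_def)
    have "n' = n + shape G (y (n, n'))"
      using comp_props(4)[OF _ b(1,2)] b(3) w by metis
    then have "shape G (y (n, n')) = n' - n" by (metis add_diff_cancel_left')
    moreover have "src G (y (n, n')) = src G (w n')" using comp_props(2)[OF _ b(1,2)] b(3) w by metis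
    ultimately show "y (n, n') \<in> mor G \<and> src G (y (n, n')) = y (n', n') \<and> tgt G (y (n, n')) = y (n, n) \<and>
      shape G (y (n, n')) = n' - n"
      using b diag by simp
  next
    fix n k p :: "'r shp" assume le: "n \<le> k" "k \<le> p"
    have b: "P n k (y (n, k))" "P k p (y (k, p))" using y le by auto
    then have "src G (y (n, k)) = tgt G (y (k, p))"
      using w comp_props(2)[of "w n" "y (n, k)"] by (simp add: P_def)
    then have "P n p (comp G (y (n, k)) (y (k, p)))"
      using b w comp_props[of "y (n, k)" "y (k, p)"] comp_assoc[of "w n" "y (n, k)" "y (k, p)"] by (simp add: P_def)
    then show "y (n, p) = comp G (y (n, k)) (y (k, p))" using le by (intro yI) auto
  qed (simp add: y_def)
  moreover have "y (0, n) = w n" for n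
    using y[OF shp_ge0, of n] comp_zero(1)[of "w 0" "y (0, n)"] w by (simp add: P_def)
  ultimately show ?thesis using that by blast
qed

text \<open>The concatenation is built from its initial segments. The one of shape n is the leading
  factor of shape n in \<open>a\<close> followed by \<open>y (0, n)\<close>, whose shape is at least
  n even when the shape of \<open>a\<close> is not comparable with n.\<close>

lemma concat_exists:
  assumes a: "a \<in> mor G" and y: "y \<in> paths G" and s: "src G a = y (0, 0)"
  obtains y' where "y' \<in> paths G" "y' (0, shape G a) = a" "shift (shape G a) y' = y"
proof -
  let ?s = "shape G a"
  have ay: "comp G a (y (0, n)) \<in> mor G" "shape G (comp G a (y (0, n))) = n + ?s"
    "src G (comp G a (y (0, n))) = y (n, n)" for n
    using comp_props[OF a, of "y (0, n)"] path0[OF y, of n] s by (auto simp: add.commute)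
  have "\<exists>w c. w \<in> mor G \<and> c \<in> mor G \<and> src G w = tgt G c \<and> comp G a (y (0, n)) = comp G w c \<and>
      shape G w = n \<and> shape G c = ?s" for n
    using factor[OF ay(1,2), of n] by metis
  then obtain w c where w: "\<And>n. w n \<in> mor G" "\<And>n. c n \<in> mor G" "\<And>n. src G (w n) = tgt G (c n)"
    "\<And>n. comp G a (y (0, n)) = comp G (w n) (c n)" "\<And>n. shape G (w n) = n" "\<And>n. shape G (c n) = ?s"
    by metis
  have step: "comp G a (y (0, n + k)) = comp G (comp G a (y (0, n))) (y (n, n + k))" for n k
    using comp_assoc[OF a path0(1)[OF y, of n] path_props(1)[OF y shp_le_add(1), of n k]]
      path_comp[OF y shp_ge0 shp_le_add(1), of n k] path0[OF y, of n] path_props[OF y shp_le_add(1), of n k] s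
    by simp
  have ext: "\<exists>b\<in>mor G. src G (w n) = tgt G b \<and> w (n + k) = comp G (w n) b" for n k
  proof -
    let ?e = "y (n, n + k)"
    have e: "?e \<in> mor G" "tgt G ?e = y (n, n)" "shape G ?e = k"
      using path_props[OF y shp_le_add(1), of n k] by auto
    have ce: "src G (c n) = tgt G ?e"
      using comp_props(2)[OF w(1) w(2) w(3), of n] ay(3)[of n] w(4)[of n] e by simp
    have d: "comp G (c n) ?e \<in> mor G" "shape G (comp G (c n) ?e) = k + ?s" "tgt G (comp G (c n) ?e) = tgt G (c n)"
      using comp_props[OF w(2) e(1) ce] w(6) e by (auto simp: add.commute)
    obtain b d where bd: "b \<in> mor G" "d \<in> mor G" "src G b = tgt G d" "comp G (c n) ?e = comp G b d"
      "shape G b = k" "shape G d = ?s"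
      using factor[OF d(1,2)] by metis
    have wb: "src G (w n) = tgt G b" using d(3) bd comp_props(3)[OF bd(1-3)] w(3) by metis
    have "comp G (w (n + k)) (c (n + k)) = comp G (comp G (w n) (c n)) ?e"
      using step[of n k] w(4) by metis
    also have "\<dots> = comp G (comp G (w n) b) d"
      using comp_assoc[OF w(1) w(2) e(1) w(3) ce] comp_assoc[OF w(1) bd(1,2) wb bd(3)] bd(4) by simp
    finally have "comp G (w (n + k)) (c (n + k)) = comp G (comp G (w n) b) d" .
    then have "w (n + k) = comp G (w n) b"
      using factor_unique[OF w(1) w(2) w(3) comp_props(1)[OF w(1) bd(1) wb] bd(2), of "n + k"]
        comp_props(2)[OF w(1) bd(1) wb] bd w(6) by simp
    then show ?thesis using bd(1) wb by blast
  qed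
  obtain y' where y': "y' \<in> paths G" "\<And>n. y' (0, n) = w n"
    using path_of_segments[of w] w ext by metis
  \<comment> \<open>At index \<open>?s + n\<close> nothing has to be cut: \<open>a\<close> followed
    by \<open>y (0, n)\<close> has exactly that shape and is a leading factor of the longer
    product.\<close>
  have wa: "w (?s + n) = comp G a (y (0, n))" for n
  proof -
    have "comp G (w (?s + n)) (c (?s + n)) = comp G (comp G a (y (0, n))) (y (n, n + ?s))"
      using step[of n ?s] w(4) by (metis add.commute)
    then show ?thesis
      using factor_unique[OF w(1)[of "?s + n"] w(2)[of "?s + n"] w(3)[of "?s + n"] ay(1)[of n]
          path_props(1)[OF y shp_le_add(1), of n ?s]]
        ay[of n] w(5) path_props(3)[OF y shp_le_add(1), of n ?s] by (simp add: add.commute)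
  qed
  have y0: "y' (0, ?s) = a"
    using wa[of 0] y'(2) comp_zero(2)[OF a path0(1)[OF y]] path0[OF y, of 0] s by simp
  moreover have "shift ?s y' = y"
  proof (rule path_eqI[OF shift_in[OF y'(1)] y])
    fix n
    have "comp G a (shift ?s y' (0, n)) = comp G a (y (0, n))"
      using path_split[OF y'(1), of ?s n] y0 y'(2) wa by simp
    then show "shift ?s y' (0, n) = y (0, n)"
      using factor_unique[OF a path0(1)[OF shift_in[OF y'(1)]] _ a path0(1)[OF y]]
        src_shift[OF y'(1), of ?s] path0(3)[OF shift_in[OF y'(1)]] path0(3)[OF y] y0 s by metis
  qed
  ultimately show ?thesis using that y'(1) by blast
qed

lemma path_split_unique:
  assumes y: "y \<in> paths G" "y' \<in> paths G" and e: "y (0, m + n) = y' (0, m + n)"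
  shows "y (0, m) = y' (0, m)" "shift m y (0, n) = shift m y' (0, n)"
proof -
  note s = shift_in[OF y(1), of m] shift_in[OF y(2), of m]
  have "y (0, m) = y' (0, m) \<and> shift m y (0, n) = shift m y' (0, n)"
  proof (rule factor_unique[OF path0(1)[OF y(1)] path0(1)[OF s(1)] _ path0(1)[OF y(2)] path0(1)[OF s(2)]])
    show "src G (y (0, m)) = tgt G (shift m y (0, n))" "src G (y' (0, m)) = tgt G (shift m y' (0, n))"
      using src_shift y path0(3)[OF s(1)] path0(3)[OF s(2)] by metis+
    show "comp G (y (0, m)) (shift m y (0, n)) = comp G (y' (0, m)) (shift m y' (0, n))"
      using e path_split y by metis
    show "shape G (y (0, m)) = shape G (y' (0, m)) \<or> shape G (shift m y (0, n)) = shape G (shift m y' (0, n))"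
      using path0(4) y by metis
  qed
  then show "y (0, m) = y' (0, m)" "shift m y (0, n) = shift m y' (0, n)" by auto
qed

text \<open>Longer segments y(0, n + m) are products of the two given data, and they determine y(0,
  n).\<close>

lemma path_det:
  assumes y: "y \<in> paths G" "y' \<in> paths G" and e: "y (0, m) = y' (0, m)" "shift m y = shift m y'"
  shows "y = y'"
proof (rule path_eqI[OF y])
  fix n
  have "y (0, n + m) = y' (0, n + m)" using path_split y e by (metis add.commute)
  then show "y (0, n) = y' (0, n)" by (rule path_split_unique(1)[OF y])
qed

text \<open>Values in \<Lambda>-bar make the segment of shape 0 equal to \<Omega>, so that
  multiplying by it is the identity of X and m = 0 needs no separate formula.\<close>

definition seg :: "('a, 'r) path \<Rightarrow> 'r shp \<Rightarrow> 'a option" where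
  "seg y n = to_bar G (y (0, n))"

lemma seg_in: "y \<in> paths G \<Longrightarrow> seg y n \<in> L" and bs_seg: "y \<in> paths G \<Longrightarrow> bs (seg y n) = n"
  by (auto simp: seg_def to_bar_in bs_to_bar path0)

lemma seg_Some: "y \<in> paths G \<Longrightarrow> seg y m = Some a \<longleftrightarrow> m \<noteq> 0 \<and> y (0, m) = a"
  by (auto simp: seg_def to_bar_def path0)

lemma seg_0: "y \<in> paths G \<Longrightarrow> seg y 0 = None"
  by (auto simp: seg_def to_bar_def path0)

lemma seg_add:
  assumes "y \<in> paths G"
  shows "seg y (m + n) = bc (seg y m) (seg (shift m y) n)" "bco (seg y m) (seg (shift m y) n)"
  using to_bar_comp[OF path0(1)[OF assms] path0(1)[OF shift_in[OF assms]], of m m n] src_shift[OF assms, of m]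
    path0(3)[OF shift_in[OF assms], of m n] path_split[OF assms, of m n] by (simp_all add: seg_def)

lemma path_det_bar:
  assumes "y \<in> paths G" "y' \<in> paths G" "seg y m = seg y' m" "shift m y = shift m y'"
  shows "y = y'"
proof (cases "m = 0")
  case True
  then show ?thesis using assms shift_0 by metis
next
  case False
  then show ?thesis using path_det[OF assms(1,2) _ assms(4)] assms(3) seg_Some[OF assms(1), of m] seg_Some[OF assms(2), of m] by metis
qed

lemma concat_path_props:
  assumes "\<mu> \<in> L" "y \<in> paths G" "\<And>a. \<mu> = Some a \<Longrightarrow> src G a = y (0, 0)"
  shows "concat_path G \<mu> y \<in> paths G" "seg (concat_path G \<mu> y) (bs \<mu>) = \<mu>" "shift (bs \<mu>) (concat_path G \<mu> y) = y"
proof -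
  let ?y = "concat_path G \<mu> y"
  have "?y \<in> paths G \<and> seg ?y (bs \<mu>) = \<mu> \<and> shift (bs \<mu>) ?y = y"
  proof (cases \<mu>)
    case None
    then show ?thesis using assms by (simp add: concat_path_def bs_simps seg_0 shift_0)
  next
    case (Some a)
    then have a: "a \<in> mor G" "shape G a \<noteq> 0" using assms(1) by (auto simp: bar_Some)
    let ?P = "\<lambda>y'. y' \<in> paths G \<and> y' (0, shape G a) = a \<and> shift (shape G a) y' = y"
    obtain y' where "?P y'" using concat_exists[OF a(1) assms(2) assms(3)[OF Some]] by metis
    then have "?P (The ?P)" by (rule theI[of ?P]) (metis path_det \<open>?P y'\<close>)
    then show ?thesis using Some a by (simp add: concat_path_def bs_simps seg_Some)
  qed
  then show "?y \<in> paths G" "seg ?y (bs \<mu>) = \<mu>" "shift (bs \<mu>) ?y = y" by auto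
qed

lemma concat_path_eq:
  assumes "y' \<in> paths G"
  shows "concat_path G (seg y' m) (shift m y') = y'"
proof -
  let ?y = "concat_path G (seg y' m) (shift m y')"
  have "?y \<in> paths G" "seg ?y m = seg y' m" "shift m ?y = shift m y'"
    using concat_path_props[OF seg_in[OF assms, of m] shift_in[OF assms, of m]] bs_seg[OF assms, of m]
      src_shift[OF assms] seg_Some[OF assms] by auto
  then show ?thesis using path_det_bar[OF _ assms] by blast
qed

section \<open>The space Z and the graphs of T and V\<close>

lemma Z_iff: "(x, y) \<in> Z_set G \<longleftrightarrow> x \<in> X \<and> y \<in> paths G \<and> In x (src_at (y (0, 0)))"
  using In_src_at_iff path_obj by (auto simp: Z_set_def X_space_eq)

text \<open>Every product \<nu>a has source exactly that of a, and it is never \<Omega>. So the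
  preimage of \<open>src_at v\<close> under right multiplication is its whole domain or
  empty.\<close>

lemma rmult_Some:
  assumes "Some a \<in> L" "rmult G (Some a) x = Some z"
  shows "In x (src_at (tgt G a))" "v \<in> objs G \<Longrightarrow> In z (src_at v) \<longleftrightarrow> v = src G a"
proof -
  have a: "a \<in> mor G" using assms by (simp add: bar_Some)
  note p = pmap_mult(3)[OF assms(1)]
  have h: "hat (rpm (Some a)) x = Some z" using assms by (simp add: rmult_eq)
  note S = hat_SomeD[OF p h]
  show "In x (src_at (tgt G a))" using S(2) dom_rpm[OF assms(1)] by simp
  have v: "vim (rpm (Some a)) (src_at v) = (if v = src G a then dom (rpm (Some a)) else {})" for v
  proof -
    have "bc \<nu> (Some a) \<in> src_at v \<longleftrightarrow> v = src G a" if "\<nu> \<in> L" "bco \<nu> (Some a)" for \<nu>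
      using that assms(1) a bc_props(1)[OF that(1) assms(1) that(2)]
      by (cases \<nu>) (auto simp: src_at_def bar_Some comp_props)
    then show ?thesis by (auto simp: vim_def rpm_def split: if_splits)
  qed
  show "In z (src_at v) \<longleftrightarrow> v = src G a" if "v \<in> objs G"
    using S(5)[OF ind_src_at[OF that]] v[of v] S(1,2) In_empty by simp
qed

text \<open>The condition defining Z is precisely that x lies in the domain of right multiplication
  by an initial segment of y. This is why V is total.\<close>

lemma rmult_total:
  assumes "(x, y) \<in> Z_set G"
  obtains z where "rmult G (seg y m) x = Some z" "(z, shift m y) \<in> Z_set G"
proof (cases "m = 0")
  case True
  then show ?thesis using assms that[of x] by (auto simp: Z_iff seg_0 rmult_None shift_0)
next
  case False
  have y: "y \<in> paths G" and x: "x \<in> X" "In x (src_at (y (0, 0)))" using assms by (auto simp: Z_iff)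
  let ?a = "y (0, m)"
  have a: "seg y m = Some ?a" "Some ?a \<in> L" using False seg_in[OF y, of m] seg_Some[OF y, of m ?a] by auto
  have "x \<in> dom (rmult G (Some ?a))"
    using x path0(3)[OF y] by (simp add: rmult_eq[OF a(2)] dom_hat dom_rpm[OF a(2)])
  then obtain z where z: "rmult G (Some ?a) x = Some z" by blast
  have "In z (src_at (src G ?a))" using rmult_Some(2)[OF a(2) z] src_obj path0(1)[OF y] by blast
  then have "(z, shift m y) \<in> Z_set G"
    using mult_in_X(2)[OF a(2) z] shift_in[OF y] src_shift[OF y] by (simp add: Z_iff)
  then show ?thesis using that z a by simp
qed

text \<open>The opposite move: a right factor of x may be transferred to the front of y, since the
  source of x is that of its right factor.\<close>

lemma concat_in_Z:
  assumes \<mu>: "\<mu> \<in> L" "rmult G \<mu> x' = Some x" and xy: "(x, y) \<in> Z_set G"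
  shows "concat_path G \<mu> y \<in> paths G" "seg (concat_path G \<mu> y) (bs \<mu>) = \<mu>"
    "shift (bs \<mu>) (concat_path G \<mu> y) = y" "(x', concat_path G \<mu> y) \<in> Z_set G"
    "\<mu> = Some a \<Longrightarrow> y (0, 0) = src G a"
proof -
  let ?y = "concat_path G \<mu> y"
  have y: "y \<in> paths G" "In x (src_at (y (0, 0)))" using xy by (auto simp: Z_iff)
  have ok: "src G a = y (0, 0)" if "\<mu> = Some a" for a
    using rmult_Some(2)[of a x' x "y (0, 0)"] that \<mu> y path_obj[OF y(1)] by simp
  then show "\<mu> = Some a \<Longrightarrow> y (0, 0) = src G a" by simp
  show c: "?y \<in> paths G" "seg ?y (bs \<mu>) = \<mu>" "shift (bs \<mu>) ?y = y"
    using concat_path_props[OF \<mu>(1) y(1) ok] by auto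
  show "(x', ?y) \<in> Z_set G"
  proof (cases \<mu>)
    case None
    then show ?thesis using \<mu> xy by (auto simp: rmult_None concat_path_def restrict_map_def split: if_splits)
  next
    case (Some a)
    then have "?y (0, bs \<mu>) = a" using c seg_Some by blast
    then have "tgt G a = ?y (0, 0)" using path0(3)[OF c(1)] by blast
    then show ?thesis using rmult_Some(1)[of a x' x] \<mu> Some c mult_in_X by (auto simp: Z_iff)
  qed
qed

text \<open>Here T is described without concatenation: the removed factor is recovered as
  \<open>seg y' m\<close>, and y as the shift of y'. Uniqueness of right factorization resolves the
  description in \<open>T_map\<close>.\<close>

lemma T_iff:
  "T_map G m (x, y) = Some (x', y') \<longleftrightarrow>
     (x, y) \<in> Z_set G \<and> (x', y') \<in> Z_set G \<and> y = shift m y' \<and> rmult G (seg y' m) x' = Some x"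
proof -
  have un: "p = q" if "right_factorization G m x (fst p) (snd p)" "right_factorization G m x (fst q) (snd q)" for p q
    using that right_unique[of "snd p" "snd q" "fst p" x "fst q"] by (auto simp: right_factorization_def prod_eq_iff)
  have "T_map G m (x, y) = Some (x', y') \<longleftrightarrow>
      (x, y) \<in> Z_set G \<and> (\<exists>\<mu>. right_factorization G m x x' \<mu> \<and> y' = concat_path G \<mu> y)" (is "?l \<longleftrightarrow> ?r")
  proof (cases "(x, y) \<in> Z_set G \<and> (\<exists>x' x''. right_factorization G m x x' x'')")
    case True
    then obtain x1 \<mu> where r: "right_factorization G m x x1 \<mu>" by blast
    have the: "(THE p. right_factorization G m x (fst p) (snd p)) = (x1, \<mu>)"
      using r un by (intro the_equality) auto
    have "right_factorization G m x x' \<mu>' \<longleftrightarrow> x' = x1 \<and> \<mu>' = \<mu>" for \<mu>'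
      using r un[of "(x1, \<mu>)" "(x', \<mu>')"] by auto
    then show ?thesis using True the unfolding T_map_def by auto
  next
    case False
    then show ?thesis by (auto simp: T_map_def)
  qed
  also have "\<dots> \<longleftrightarrow> (x, y) \<in> Z_set G \<and> (x', y') \<in> Z_set G \<and> y = shift m y' \<and> rmult G (seg y' m) x' = Some x"
  proof
    assume "(x, y) \<in> Z_set G \<and> (\<exists>\<mu>. right_factorization G m x x' \<mu> \<and> y' = concat_path G \<mu> y)"
    then obtain \<mu> where xy: "(x, y) \<in> Z_set G" and \<mu>: "\<mu> \<in> L" "bs \<mu> = m" "rmult G \<mu> x' = Some x"
      and y': "y' = concat_path G \<mu> y"
      by (auto simp: right_factorization_def)
    show "(x, y) \<in> Z_set G \<and> (x', y') \<in> Z_set G \<and> y = shift m y' \<and> rmult G (seg y' m) x' = Some x"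
      using xy \<mu> concat_in_Z[OF \<mu>(1,3) xy] y' by simp
  next
    assume r: "(x, y) \<in> Z_set G \<and> (x', y') \<in> Z_set G \<and> y = shift m y' \<and> rmult G (seg y' m) x' = Some x"
    then have y': "y' \<in> paths G" by (simp add: Z_iff)
    then show "(x, y) \<in> Z_set G \<and> (\<exists>\<mu>. right_factorization G m x x' \<mu> \<and> y' = concat_path G \<mu> y)"
      using r concat_path_eq[OF y', of m] seg_in[OF y', of m] bs_seg[OF y', of m]
      by (auto simp: right_factorization_def)
  qed
  finally show ?thesis .
qed

lemma L_shift_eq:
  assumes "\<nu> \<in> L" "bs \<nu> = m" "lmult G \<nu> \<rho> = Some z"
  shows "L_shift G m z = \<rho>"
  unfolding L_shift_def left_factorization_def
  using assms left_unique by (intro the_equality) blast+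

text \<open>Provides the left factor \<nu> behind \<open>L_shift\<close> and shows that removing it
  keeps the pair in Z.\<close>

lemma V_eq:
  assumes "(x, y) \<in> Z_set G" "rmult G (seg y m) x = Some z"
  obtains \<nu> \<rho> where "\<nu> \<in> L" "bs \<nu> = m" "lmult G \<nu> \<rho> = Some z" "V_map G m (x, y) = Some (\<rho>, shift m y)"
    "(\<rho>, shift m y) \<in> Z_set G"
proof -
  have y: "y \<in> paths G" using assms by (simp add: Z_iff)
  \<comment> \<open>The right factor of shape m shows that the shape of z is at least m, and this
    gives a left factor of shape m.\<close>
  have z: "z \<in> X" and "In z (shape_ge m)"
    using mult_in_X(2)[OF seg_in[OF y] assms(2)] right_factor_iff seg_in[OF y] bs_seg[OF y] assms(2) by blast+
  then obtain \<nu> \<rho> where \<nu>: "\<nu> \<in> L" "bs \<nu> = m" "lmult G \<nu> \<rho> = Some z" using left_factor_iff by blast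
  have "V_map G m (x, y) = Some (\<rho>, shift m y)"
    using assms L_shift_eq[OF \<nu>] by (simp add: V_map_def seg_def)
  moreover have "(\<rho>, shift m y) \<in> Z_set G"
  proof -
    let ?v = "shift m y (0, 0)"
    have "In z (src_at ?v)" using rmult_total[OF assms(1), of m] assms(2) by (metis Z_iff option.inject)
    moreover have v: "?v \<in> objs G" using path_obj shift_in y by blast
    moreover have h: "hat (lpm \<nu>) \<rho> = Some z" using \<nu> by (simp add: lmult_eq)
    note S = hat_SomeD[OF pmap_mult(1)[OF \<nu>(1)] h]
    ultimately have "In \<rho> (vim (lpm \<nu>) (src_at ?v))" using S(5)[OF ind_src_at[OF v]] by simp
    \<comment> \<open>\<nu>\<kappa> has the source of \<kappa> unless \<kappa> is \<Omega>, which
      lies in every \<open>src_at\<close>.\<close>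
    moreover have "vim (lpm \<nu>) (src_at ?v) \<subseteq> src_at ?v"
    proof
      fix \<kappa> assume "\<kappa> \<in> vim (lpm \<nu>) (src_at ?v)"
      then have k: "\<kappa> \<in> L" "bco \<nu> \<kappa>" "bc \<nu> \<kappa> \<in> src_at ?v" by (auto simp: vim_def lpm_def split: if_splits)
      then show "\<kappa> \<in> src_at ?v" using \<nu>(1) by (cases \<nu>; cases \<kappa>) (auto simp: src_at_def bar_Some comp_props)
    qed
    ultimately have "In \<rho> (src_at ?v)"
      using In_mono[OF S(1) ind_vim[OF pmap_mult(1)[OF \<nu>(1)] ind_src_at[OF v]] ind_src_at[OF v]] by blast
    then show ?thesis using S(1) shift_in[OF y] by (simp add: Z_iff)
  qed
  ultimately show ?thesis using \<nu> that by blast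
qed

lemma V_iff:
  "V_map G m (x, y) = Some (\<rho>, y') \<longleftrightarrow> (x, y) \<in> Z_set G \<and> y' = shift m y \<and>
     (\<exists>\<nu> z. \<nu> \<in> L \<and> bs \<nu> = m \<and> rmult G (seg y m) x = Some z \<and> lmult G \<nu> \<rho> = Some z)"
proof (cases "(x, y) \<in> Z_set G")
  case True
  obtain z where z: "rmult G (seg y m) x = Some z" using rmult_total[OF True] by metis
  obtain \<nu> \<rho>' where \<nu>: "\<nu> \<in> L" "bs \<nu> = m" "lmult G \<nu> \<rho>' = Some z" "V_map G m (x, y) = Some (\<rho>', shift m y)"
    using V_eq[OF True z] by metis
  show ?thesis
  proof
    assume "V_map G m (x, y) = Some (\<rho>, y')"
    then have "\<rho> = \<rho>'" "y' = shift m y" using \<nu>(4) by simp_all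
    then show "(x, y) \<in> Z_set G \<and> y' = shift m y \<and>
        (\<exists>\<nu> z. \<nu> \<in> L \<and> bs \<nu> = m \<and> rmult G (seg y m) x = Some z \<and> lmult G \<nu> \<rho> = Some z)"
      using True z \<nu>(1-3) by blast
  next
    assume "(x, y) \<in> Z_set G \<and> y' = shift m y \<and>
        (\<exists>\<nu> z. \<nu> \<in> L \<and> bs \<nu> = m \<and> rmult G (seg y m) x = Some z \<and> lmult G \<nu> \<rho> = Some z)"
    then obtain \<nu>' z' where \<nu>': "y' = shift m y" "\<nu>' \<in> L" "bs \<nu>' = m" "rmult G (seg y m) x = Some z'" "lmult G \<nu>' \<rho> = Some z'"
      by blast
    then have "\<rho> = \<rho>'" using left_unique[OF \<nu>'(2) \<nu>(1) _ \<nu>'(5), of \<rho>'] \<nu>(2,3) z by simp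
    then show "V_map G m (x, y) = Some (\<rho>, y')" using \<nu>(4) \<nu>'(1) by simp
  qed
next
  case False
  then show ?thesis by (simp add: V_map_def)
qed

lemma V_dom: "dom (V_map G m) = Z_set G" and V_ran: "ran (V_map G m) \<subseteq> Z_set G"
proof -
  have *: "\<exists>q\<in>Z_set G. V_map G m p = Some q" if "p \<in> Z_set G" for p
    using that rmult_total V_eq by (cases p) metis
  moreover have **: "p \<in> Z_set G" if "V_map G m p = Some q" for p q
    using that by (cases p; cases q) (auto simp: V_iff)
  ultimately show "dom (V_map G m) = Z_set G" by blast
  show "ran (V_map G m) \<subseteq> Z_set G" using * ** by (force simp: ran_def)
qed

lemma T_ran: "ran (T_map G m) \<subseteq> Z_set G"
  by (force simp: T_iff ran_def)

section \<open>Semigroup laws for T and for V\<close>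

lemma map_eqI: "(\<And>p q. f p = Some q \<longleftrightarrow> g p = Some q) \<Longrightarrow> f = g"
  by (metis ext not_Some_eq)

lemma map_comp_Some: "(f \<circ>\<^sub>m g) p = Some q \<longleftrightarrow> (\<exists>r. g p = Some r \<and> f r = Some q)"
  by (auto simp: map_comp_def split: option.splits)

lemma rmult_bc:
  assumes "\<alpha> \<in> L" "\<beta> \<in> L"
  shows "rmult G \<alpha> x = Some x' \<Longrightarrow> rmult G \<beta> x' = Some z \<Longrightarrow> bco \<alpha> \<beta> \<and> rmult G (bc \<alpha> \<beta>) x = Some z"
    and "bco \<alpha> \<beta> \<Longrightarrow> rmult G (bc \<alpha> \<beta>) x = Some z \<Longrightarrow> \<exists>x'. rmult G \<alpha> x = Some x' \<and> rmult G \<beta> x' = Some z"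
  using fun_cong[OF rmult_rmult[OF assms], of x] by (auto simp: map_comp_def split: if_splits option.splits)

lemma lmult_bc:
  assumes "\<alpha> \<in> L" "\<beta> \<in> L"
  shows "lmult G \<beta> x = Some x' \<Longrightarrow> lmult G \<alpha> x' = Some z \<Longrightarrow> bco \<alpha> \<beta> \<and> lmult G (bc \<alpha> \<beta>) x = Some z"
  using fun_cong[OF lmult_lmult[OF assms], of x] by (auto simp: map_comp_def split: if_splits option.splits)

lemma lr_commute:
  assumes "\<nu> \<in> L" "\<mu> \<in> L"
  shows "lmult G \<nu> x = Some x' \<Longrightarrow> rmult G \<mu> x' = Some z \<Longrightarrow> \<exists>x''. rmult G \<mu> x = Some x'' \<and> lmult G \<nu> x'' = Some z"
  using fun_cong[OF lmult_rmult[OF assms], of x] by (auto simp: map_comp_def split: option.splits)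

text \<open>The inner map strips the last factor, the outer one the factor before it. In terms of
  the final path y2 they are y2(n, n + m) and y2(0, n), which together make up y2(0, n + m).\<close>

lemma T_add: "T_map G n \<circ>\<^sub>m T_map G m = T_map G (m + n)"
proof (rule map_eqI)
  fix p q :: "'a xpoint \<times> ('a, 'r) path"
  obtain x y x2 y2 where p: "p = (x, y)" and q: "q = (x2, y2)" by (cases p; cases q)
  show "(T_map G n \<circ>\<^sub>m T_map G m) p = Some q \<longleftrightarrow> T_map G (m + n) p = Some q"
  proof
    assume "(T_map G n \<circ>\<^sub>m T_map G m) p = Some q"
    then obtain x1 y1 where 1: "T_map G m (x, y) = Some (x1, y1)" "T_map G n (x1, y1) = Some (x2, y2)"
      unfolding map_comp_Some p q by (metis surj_pair)
    have y2: "y2 \<in> paths G" "y1 = shift n y2" using 1 by (auto simp: T_iff Z_iff)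
    then have "rmult G (seg y2 (n + m)) x2 = Some x"
      using 1 rmult_bc(1)[OF seg_in[OF y2(1)] seg_in[OF shift_in[OF y2(1)]], of n x2 x1 n m x] seg_add(1)[OF y2(1), of n m]
      by (auto simp: T_iff)
    then show "T_map G (m + n) p = Some q"
      using 1 unfolding p q by (auto simp: T_iff shift_shift add.commute)
  next
    assume "T_map G (m + n) p = Some q"
    then have xy: "(x, y) \<in> Z_set G" "(x2, y2) \<in> Z_set G" "y = shift (m + n) y2" "rmult G (seg y2 (n + m)) x2 = Some x"
      unfolding p q by (auto simp: T_iff add.commute)
    have y2: "y2 \<in> paths G" using xy by (simp add: Z_iff)
    obtain x1 where x1: "rmult G (seg y2 n) x2 = Some x1" "rmult G (seg (shift n y2) m) x1 = Some x"
      using rmult_bc(2)[OF seg_in[OF y2] seg_in[OF shift_in[OF y2]] seg_add(2)[OF y2, of n m]] xy(4) seg_add(1)[OF y2, of n m]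
      by metis
    have "(x1, shift n y2) \<in> Z_set G" using rmult_total[OF xy(2), of n] x1 by (metis option.inject)
    then have "T_map G m (x, y) = Some (x1, shift n y2)" "T_map G n (x1, shift n y2) = Some (x2, y2)"
      using xy x1 by (auto simp: T_iff shift_shift)
    then show "(T_map G n \<circ>\<^sub>m T_map G m) p = Some q" unfolding map_comp_Some p q by blast
  qed
qed

lemma T_0: "T_map G 0 = Some |` Z_set G"
proof (rule map_eqI)
  fix p q :: "'a xpoint \<times> ('a, 'r) path"
  obtain x y x2 y2 where p: "p = (x, y)" and q: "q = (x2, y2)" by (cases p; cases q)
  show "T_map G 0 p = Some q \<longleftrightarrow> (Some |` Z_set G) p = Some q"
    unfolding p q T_iff by (auto simp: restrict_map_def Z_iff seg_0 shift_0 rmult_None split: if_splits)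
qed

lemma V_0: "V_map G 0 = Some |` Z_set G"
proof (rule map_eqI)
  fix p q :: "'a xpoint \<times> ('a, 'r) path"
  obtain x y x2 y2 where p: "p = (x, y)" and q: "q = (x2, y2)" by (cases p; cases q)
  show "V_map G 0 p = Some q \<longleftrightarrow> (Some |` Z_set G) p = Some q"
  proof (cases "(x, y) \<in> Z_set G")
    case True
    have "V_map G 0 (x, y) = Some (x, y)"
      unfolding V_iff using True
      by (auto simp: Z_iff seg_0 shift_0 rmult_None lmult_None bar_None bs_simps intro!: exI[of _ None] exI[of _ x])
    then show ?thesis using True by (auto simp: p q)
  next
    case False
    then show ?thesis unfolding p q V_iff by simp
  qed
qed

text \<open>Write x y(0, n) = \<nu>\<rho> and \<rho> y(n, n + m) = \<nu>'\<rho>'. Since left and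
  right multiplication commute, x y(0, n + m) = \<nu>\<nu>'\<rho>', and uniqueness of the left
  factor of shape n + m gives the claim.\<close>

lemma V_add: "V_map G m \<circ>\<^sub>m V_map G n = V_map G (n + m)"
proof
  fix p :: "'a xpoint \<times> ('a, 'r) path"
  obtain x y where p: "p = (x, y)" by (cases p)
  show "(V_map G m \<circ>\<^sub>m V_map G n) p = V_map G (n + m) p"
  proof (cases "(x, y) \<in> Z_set G")
    case False
    then show ?thesis by (simp add: p V_map_def)
  next
    case True
    have y: "y \<in> paths G" using True by (simp add: Z_iff)
    let ?y = "shift n y"
    obtain z where z: "rmult G (seg y n) x = Some z" "(z, ?y) \<in> Z_set G" using rmult_total[OF True] by metis
    obtain \<nu> \<rho> where \<nu>: "\<nu> \<in> L" "bs \<nu> = n" "lmult G \<nu> \<rho> = Some z" "V_map G n (x, y) = Some (\<rho>, ?y)" "(\<rho>, ?y) \<in> Z_set G"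
      using V_eq[OF True z(1)] by metis
    obtain z' where z': "rmult G (seg ?y m) \<rho> = Some z'" using rmult_total[OF \<nu>(5)] by metis
    obtain \<nu>' \<rho>' where \<nu>': "\<nu>' \<in> L" "bs \<nu>' = m" "lmult G \<nu>' \<rho>' = Some z'" "V_map G m (\<rho>, ?y) = Some (\<rho>', shift m ?y)"
      using V_eq[OF \<nu>(5) z'] by metis
    obtain w where w: "rmult G (seg ?y m) z = Some w" using rmult_total[OF z(2)] by metis
    have "lmult G \<nu> z' = Some w"
      using lr_commute[OF \<nu>(1) seg_in[OF shift_in[OF y]] \<nu>(3) w] z' by auto
    then have l: "bco \<nu> \<nu>'" "lmult G (bc \<nu> \<nu>') \<rho>' = Some w"
      using lmult_bc[OF \<nu>(1) \<nu>'(1) \<nu>'(3)] by auto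
    have r: "rmult G (seg y (n + m)) x = Some w"
      using rmult_bc(1)[OF seg_in[OF y] seg_in[OF shift_in[OF y]] z(1) w] seg_add(1)[OF y] by simp
    have "bc \<nu> \<nu>' \<in> L" "bs (bc \<nu> \<nu>') = n + m" using bc_props[OF \<nu>(1) \<nu>'(1) l(1)] \<nu>(2) \<nu>'(2) by auto
    then have "V_map G (n + m) (x, y) = Some (\<rho>', shift (n + m) y)"
      using True l r by (auto simp: V_iff)
    then show ?thesis using \<nu>(4) \<nu>'(4) by (simp add: p shift_shift add.commute)
  qed
qed

section \<open>Domains of the composites and commutation of T with V\<close>

lemma T_dom: "dom (T_map G m) = {(x, y) \<in> Z_set G. In x (shape_ge m)}"
proof -
  have "(x, y) \<in> dom (T_map G m) \<longleftrightarrow> (x, y) \<in> Z_set G \<and> (\<exists>x' \<mu>. right_factorization G m x x' \<mu>)" for x y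
    by (cases "(x, y) \<in> Z_set G \<and> (\<exists>x' \<mu>. right_factorization G m x x' \<mu>)")
      (auto simp: T_map_def domIff split: prod.splits)
  then have "(x, y) \<in> dom (T_map G m) \<longleftrightarrow> (x, y) \<in> Z_set G \<and> In x (shape_ge m)" for x y
    using right_factor_iff[of x m for x] unfolding right_factorization_def Z_iff by blast
  then show ?thesis by auto
qed

text \<open>Additivity of the shape on X, in Boolean form.\<close>

lemma shape_ge_rmult:
  assumes "\<alpha> \<in> L" "rmult G \<alpha> x = Some z"
  shows "In z (shape_ge (bs \<alpha> + m)) \<longleftrightarrow> In x (shape_ge m)"
proof -
  have h: "hat (rpm \<alpha>) x = Some z" using assms by (simp add: rmult_eq)
  note S = hat_SomeD[OF pmap_mult(3)[OF assms(1)] h]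
  have "vim (rpm \<alpha>) (shape_ge (bs \<alpha> + m)) = dom (rpm \<alpha>) \<inter> shape_ge m"
    using assms(1) by (auto simp: vim_def rpm_def shape_ge_def bc_props add.commute[of "bs \<alpha>"] le_fun_def split: if_splits)
  then show ?thesis
    using S(2,5) In_Int[OF S(1) ind_dom[OF pmap_mult(3)[OF assms(1)]] ind_ge] ind_ge by simp
qed

lemma shape_ge_lmult:
  assumes "\<alpha> \<in> L" "lmult G \<alpha> x = Some z"
  shows "In z (shape_ge (bs \<alpha> + m)) \<longleftrightarrow> In x (shape_ge m)"
proof -
  have h: "hat (lpm \<alpha>) x = Some z" using assms by (simp add: lmult_eq)
  note S = hat_SomeD[OF pmap_mult(1)[OF assms(1)] h]
  have "vim (lpm \<alpha>) (shape_ge (bs \<alpha> + m)) = dom (lpm \<alpha>) \<inter> shape_ge m"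
    using assms(1) by (auto simp: vim_def lpm_def shape_ge_def bc_props le_fun_def split: if_splits)
  then show ?thesis
    using S(2,5) In_Int[OF S(1) ind_dom[OF pmap_mult(1)[OF assms(1)]] ind_ge] ind_ge by simp
qed

text \<open>V adds shape n on the right and removes shape n on the left, so it preserves the shape,
  and the domain of the composite is that of \<open>T_map G m\<close>.\<close>

lemma TV_dom: "dom (T_map G m \<circ>\<^sub>m V_map G n) = {(x, y) \<in> Z_set G. In x (shape_ge m)}"
proof -
  have "(x, y) \<in> dom (T_map G m \<circ>\<^sub>m V_map G n) \<longleftrightarrow> (x, y) \<in> Z_set G \<and> In x (shape_ge m)" for x y
  proof (cases "(x, y) \<in> Z_set G")
    case True
    then have y: "y \<in> paths G" by (simp add: Z_iff)
    obtain z where z: "rmult G (seg y n) x = Some z" using rmult_total[OF True] by metis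
    obtain \<nu> \<rho> where \<nu>: "\<nu> \<in> L" "bs \<nu> = n" "lmult G \<nu> \<rho> = Some z" "V_map G n (x, y) = Some (\<rho>, shift n y)"
      "(\<rho>, shift n y) \<in> Z_set G"
      using V_eq[OF True z] by metis
    have "In x (shape_ge m) \<longleftrightarrow> In \<rho> (shape_ge m)"
      using shape_ge_rmult[OF seg_in[OF y] z] shape_ge_lmult[OF \<nu>(1,3)] bs_seg[OF y] \<nu>(2) by metis
    moreover have "(x, y) \<in> dom (T_map G m \<circ>\<^sub>m V_map G n) \<longleftrightarrow> (\<rho>, shift n y) \<in> dom (T_map G m)"
      using \<nu>(4) by (simp add: dom_def)
    ultimately show ?thesis using True \<nu>(5) by (simp add: T_dom)
  next
    case False
    then show ?thesis by (simp add: V_map_def dom_def)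
  qed
  then show ?thesis by auto
qed

text \<open>Both sides are defined where \<open>\<sigma>(x) \<ge> m\<close>, so it suffices to compare them there.\<close>

lemma T_V_commute: "T_map G m \<circ>\<^sub>m V_map G n = V_map G n \<circ>\<^sub>m T_map G m"
proof -
  have sub: "(T_map G m \<circ>\<^sub>m V_map G n) p = Some q" if VT: "(V_map G n \<circ>\<^sub>m T_map G m) p = Some q" for p q
  proof -
    obtain x y w u where p: "p = (x, y)" and q: "q = (w, u)" by (cases p; cases q)
    obtain x' y' where 1: "T_map G m (x, y) = Some (x', y')" "V_map G n (x', y') = Some (w, u)"
      using VT unfolding map_comp_Some p q by (metis surj_pair)
    have xy: "(x, y) \<in> Z_set G" "(x', y') \<in> Z_set G" "y = shift m y'" "rmult G (seg y' m) x' = Some x"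
      using 1(1) by (auto simp: T_iff)
    have y': "y' \<in> paths G" using xy by (simp add: Z_iff)
    obtain \<nu> z where \<nu>: "u = shift n y'" "\<nu> \<in> L" "bs \<nu> = n" "rmult G (seg y' n) x' = Some z" "lmult G \<nu> w = Some z"
      using 1(2) by (auto simp: V_iff)
    have u: "u \<in> paths G" using \<nu> shift_in y' by simp
    have wu: "(w, u) \<in> Z_set G" using 1(2) V_ran by (force simp: ran_def)
    have zu: "(z, u) \<in> Z_set G" using rmult_total[OF xy(2), of n] \<nu> by (metis option.inject)
    obtain z2 where z2: "rmult G (seg u m) z = Some z2" using rmult_total[OF zu] by metis
    obtain w2 where w2: "rmult G (seg u m) w = Some w2" "(w2, shift m u) \<in> Z_set G" using rmult_total[OF wu] by metis
    have l: "lmult G \<nu> w2 = Some z2"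
      using lr_commute[OF \<nu>(2) seg_in[OF u] \<nu>(5) z2] w2 by auto
    have "rmult G (seg y' (n + m)) x' = Some z2"
      using rmult_bc(1)[OF seg_in[OF y'] seg_in[OF u] \<nu>(4) z2] seg_add(1)[OF y', of n m] \<nu>(1) by simp
    \<comment> \<open>The segment y'(0, n + m) is regrouped as y'(0, m) followed by y(0, n), so that
      x = x' y'(0, m) can be substituted.\<close>
    then have "rmult G (bc (seg y' m) (seg y n)) x' = Some z2"
      using seg_add(1)[OF y', of m n] xy(3) by (simp add: add.commute)
    then have "rmult G (seg y n) x = Some z2"
      using rmult_bc(2)[OF seg_in[OF y', of m] seg_in[OF shift_in[OF y', of m], of n], of x' z2] seg_add(2)[OF y', of m n] xy(3,4)
      by auto
    moreover have "shift m u = shift n y" using \<nu>(1) xy(3) by (simp add: shift_shift add.commute)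
    ultimately have "V_map G n (x, y) = Some (w2, shift m u)" using xy(1) \<nu>(2,3) l by (auto simp: V_iff)
    moreover have "T_map G m (w2, shift m u) = Some (w, u)" using w2 wu by (simp add: T_iff)
    ultimately show "(T_map G m \<circ>\<^sub>m V_map G n) p = Some q" unfolding map_comp_Some p q by blast
  qed
  \<comment> \<open>V is defined on all of Z, where T takes its values.\<close>
  have "dom (V_map G n \<circ>\<^sub>m T_map G m) = dom (T_map G m)"
    using V_dom[of n] T_ran[of m] by (force simp: dom_def map_comp_Some ran_def)
  then have "dom (V_map G n \<circ>\<^sub>m T_map G m) = dom (T_map G m \<circ>\<^sub>m V_map G n)"
    by (simp add: T_dom TV_dom)
  then have "\<exists>q. (V_map G n \<circ>\<^sub>m T_map G m) p = Some q" if "(T_map G m \<circ>\<^sub>m V_map G n) p = Some q'" for p q'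
    using that by blast
  then show ?thesis using sub by (intro map_eqI) fastforce
qed

section \<open>Topology of Z and local charts\<close>

abbreviation "PT \<equiv> path_topology G"
abbreviation "ZT \<equiv> Z_topology G"

lemma topspace_PT: "topspace PT = paths G"
proof -
  have "\<Union> {{y \<in> paths G. y (0, k) = \<mu>} |k \<mu>. \<mu> \<in> mor G} = paths G"
  proof (intro equalityI subsetI)
    fix y assume y: "y \<in> paths G"
    show "y \<in> \<Union> {{y \<in> paths G. y (0, k) = \<mu>} |k \<mu>. \<mu> \<in> mor G}"
      by (rule UnionI[of "{y' \<in> paths G. y' (0, 0) = y (0, 0)}"]) (use y path0(1)[OF y, of 0] in blast)+
  qed blast
  then show ?thesis by (simp add: path_topology_def)
qed

lemma topspace_ZT: "topspace ZT = Z_set G"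
  by (auto simp: Z_topology_def X_topology_eq topspace_XT topspace_PT Z_iff)

lemma openin_cyl: "a \<in> mor G \<Longrightarrow> openin PT {y \<in> paths G. y (0, k) = a}"
  unfolding path_topology_def by (rule topology_generated_by_Basis) auto

text \<open>If each initial segment of the image depends only on some initial segment of y, the
  preimage of a cylinder is a union of cylinders.\<close>

lemma continuous_path_map:
  assumes "\<And>y. y \<in> S \<Longrightarrow> y \<in> paths G \<Longrightarrow> H y \<in> paths G"
    and "\<And>k. \<exists>k'. \<forall>y\<in>S \<inter> paths G. \<forall>y'\<in>S \<inter> paths G. y (0, k') = y' (0, k') \<longrightarrow> H y (0, k) = H y' (0, k)"
  shows "continuous_map (subtopology PT S) PT H"
proof -
  have top: "topspace (subtopology PT S) = S \<inter> paths G" by (auto simp: topspace_PT)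
  have "continuous_map (subtopology PT S) (topology_generated_by {{y \<in> paths G. y (0, k) = \<mu>} |k \<mu>. \<mu> \<in> mor G}) H"
  proof (rule continuous_on_generated_topo)
    fix U assume "U \<in> {{y \<in> paths G. y (0, k) = \<mu>} |k \<mu>. \<mu> \<in> mor G}"
    then obtain k a where U: "U = {y \<in> paths G. y (0, k) = a}" by blast
    obtain k' where k': "\<forall>y\<in>S \<inter> paths G. \<forall>y'\<in>S \<inter> paths G. y (0, k') = y' (0, k') \<longrightarrow> H y (0, k) = H y' (0, k)"
      using assms(2) by blast
    show "openin (subtopology PT S) (H -` U \<inter> topspace (subtopology PT S))"
    proof (subst openin_subopen, intro ballI)
      fix y assume y: "y \<in> H -` U \<inter> topspace (subtopology PT S)"
      let ?C = "{y' \<in> paths G. y' (0, k') = y (0, k')}"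
      have "openin PT ?C" using y path0(1) unfolding top by (intro openin_cyl) auto
      then have "openin (subtopology PT S) (?C \<inter> S)" by (auto simp: openin_subtopology)
      moreover have "y \<in> ?C \<inter> S" using y unfolding top by blast
      moreover have "?C \<inter> S \<subseteq> H -` U \<inter> topspace (subtopology PT S)"
      proof
        fix y' assume y': "y' \<in> ?C \<inter> S"
        then have "H y' (0, k) = H y (0, k)" using k' y unfolding top by blast
        then show "y' \<in> H -` U \<inter> topspace (subtopology PT S)" using y y' assms(1) unfolding top U by simp
      qed
      ultimately show "\<exists>T. openin (subtopology PT S) T \<and> y \<in> T \<and> T \<subseteq> H -` U \<inter> topspace (subtopology PT S)"
        by blast
    qed
  next
    have "H ` (S \<inter> paths G) \<subseteq> paths G" using assms(1) by blast
    then show "H ` topspace (subtopology PT S) \<subseteq> \<Union> {{y \<in> paths G. y (0, k) = \<mu>} |k \<mu>. \<mu> \<in> mor G}"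
      using topspace_PT unfolding top path_topology_def topology_generated_by_topspace
      by (simp add: Int_commute)
  qed
  then show ?thesis by (simp add: path_topology_def)
qed

lemma continuous_shift: "continuous_map (subtopology PT S) PT (shift m)"
proof (rule continuous_path_map)
  fix k
  show "\<exists>k'. \<forall>y\<in>S \<inter> paths G. \<forall>y'\<in>S \<inter> paths G. y (0, k') = y' (0, k') \<longrightarrow> shift m y (0, k) = shift m y' (0, k)"
    using path_split_unique(2) by blast
qed (rule shift_in)

lemma continuous_concat:
  assumes a: "Some a \<in> L"
  shows "continuous_map (subtopology PT {y \<in> paths G. y (0, 0) = src G a}) PT (concat_path G (Some a))"
proof (rule continuous_path_map)
  fix y assume "y \<in> {y \<in> paths G. y (0, 0) = src G a}" "y \<in> paths G"
  then show "concat_path G (Some a) y \<in> paths G" using concat_path_props(1)[OF a] by auto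
next
  fix k
  have "concat_path G (Some a) y (0, k) = concat_path G (Some a) y' (0, k)"
    if y: "y \<in> paths G" "y (0, 0) = src G a" "y' \<in> paths G" "y' (0, 0) = src G a" "y (0, k) = y' (0, k)" for y y'
  proof -
    let ?s = "shape G a" and ?c = "concat_path G (Some a) y" and ?c' = "concat_path G (Some a) y'"
    have c: "?c \<in> paths G" "?c (0, ?s) = a" "shift ?s ?c = y"
      using concat_path_props[OF a y(1)] y(2) seg_Some[of ?c ?s a] by (auto simp: bs_simps)
    have c': "?c' \<in> paths G" "?c' (0, ?s) = a" "shift ?s ?c' = y'"
      using concat_path_props[OF a y(3)] y(4) seg_Some[of ?c' ?s a] by (auto simp: bs_simps)
    \<comment> \<open>The segment of y of shape k fixes the one of \<open>?c\<close> of shape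
      \<open>k + ?s\<close>, of which the one of shape k is a part.\<close>
    have "?c (0, k + ?s) = ?c' (0, k + ?s)"
      using path_split[OF c(1), of ?s k] path_split[OF c'(1), of ?s k] c c' y(5) by (simp add: add.commute)
    then show ?thesis by (rule path_split_unique(1)[OF c(1) c'(1)])
  qed
  then show "\<exists>k'. \<forall>y\<in>{y \<in> paths G. y (0, 0) = src G a} \<inter> paths G. \<forall>y'\<in>{y \<in> paths G. y (0, 0) = src G a} \<inter> paths G.
      y (0, k') = y' (0, k') \<longrightarrow> concat_path G (Some a) y (0, k) = concat_path G (Some a) y' (0, k)"
    by blast
qed

lemma continuous_Z_map:
  assumes "pmap \<phi>" and H: "continuous_map (subtopology PT S) PT H"
    and U: "U \<subseteq> Z_set G" "\<And>x y. (x, y) \<in> U \<Longrightarrow> y \<in> S \<and> x \<in> dom (hat \<phi>) \<and> (the (hat \<phi> x), H y) \<in> Z_set G"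
    and g: "\<And>x y. (x, y) \<in> U \<Longrightarrow> g (x, y) = (the (hat \<phi> x), H y)"
  shows "continuous_map (subtopology ZT U) ZT g"
proof -
  have ZU: "subtopology ZT U = subtopology (prod_topology XT PT) U"
    using U(1) by (simp add: Z_topology_def X_topology_eq subtopology_subtopology Int_absorb1)
  have top: "topspace (subtopology ZT U) = U" using U(1) topspace_ZT by auto
  have "continuous_map (subtopology ZT U) (subtopology XT (dom (hat \<phi>))) fst"
    unfolding ZU continuous_map_in_subtopology
    using U by (force intro: continuous_map_from_subtopology continuous_map_fst)
  from continuous_map_compose[OF this continuous_hat[OF assms(1)]]
  have 1: "continuous_map (subtopology ZT U) XT (fst \<circ> g)"
    by (rule continuous_map_eq) (use g top in auto)
  have "continuous_map (subtopology ZT U) (subtopology PT S) snd"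
    unfolding ZU continuous_map_in_subtopology
    using U by (force intro: continuous_map_from_subtopology continuous_map_snd)
  from continuous_map_compose[OF this H]
  have 2: "continuous_map (subtopology ZT U) PT (snd \<circ> g)"
    by (rule continuous_map_eq) (use g top in auto)
  have "g ` U \<subseteq> Z_set G" using g U(2) by force
  moreover have "continuous_map (subtopology ZT U) (prod_topology XT PT) g"
    unfolding continuous_map_pairwise using 1 2 by blast
  ultimately show ?thesis
    unfolding Z_topology_def[of G] X_topology_eq continuous_map_in_subtopology
    using top unfolding Z_topology_def[of G] X_topology_eq by (simp add: image_subset_iff_funcset)
qed

lemma openin_Z_rect:
  assumes "indicator C \<in> A" "openin PT P"
  shows "openin ZT {(x, y) \<in> Z_set G. In x C \<and> y \<in> P}"
proof -
  have "openin (prod_topology XT PT) ({x \<in> X. In x C} \<times> P)"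
    using assms by (simp add: openin_prod_Times_iff openin_In)
  then have "openin ZT (({x \<in> X. In x C} \<times> P) \<inter> Z_set G)"
    unfolding Z_topology_def X_topology_eq openin_subtopology by blast
  moreover have "({x \<in> X. In x C} \<times> P) \<inter> Z_set G = {(x, y) \<in> Z_set G. In x C \<and> y \<in> P}"
    by (auto simp: Z_iff)
  ultimately show ?thesis by simp
qed

definition rect :: "('a option \<rightharpoonup> 'a option) \<Rightarrow> ('a, 'r) path set \<Rightarrow> ('a xpoint \<times> ('a, 'r) path) set" where
  "rect \<phi> P = {(x, y) \<in> Z_set G. In x (dom \<phi>) \<and> y \<in> P}"

text \<open>On the open set \<open>rect \<phi> P\<close> the map f is the product of
  \<open>hat \<phi>\<close> and H, and the product of \<open>hat \<psi>\<close> and K inverts it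
  from the open set \<open>rect \<psi> Q\<close>. The backward clause makes the image all of
  \<open>rect \<psi> Q\<close>, hence open.\<close>

definition chart where
  "chart f \<phi> \<psi> P Q H K \<longleftrightarrow> pmap \<phi> \<and> pmap \<psi> \<and> openin PT P \<and> openin PT Q \<and>
     continuous_map (subtopology PT P) PT H \<and> continuous_map (subtopology PT Q) PT K \<and>
     (\<forall>x y. (x, y) \<in> rect \<phi> P \<longrightarrow> (\<exists>x'. hat \<phi> x = Some x' \<and> f (x, y) = Some (x', H y) \<and>
       (x', H y) \<in> rect \<psi> Q \<and> hat \<psi> x' = Some x \<and> K (H y) = y)) \<and>
     (\<forall>x y. (x, y) \<in> rect \<psi> Q \<longrightarrow> (\<exists>x'. hat \<psi> x = Some x' \<and> (x', K y) \<in> rect \<phi> P \<and> f (x', K y) = Some (x, y)))"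

lemma local_homeo_charts:
  assumes "\<And>p. p \<in> dom f \<Longrightarrow> \<exists>\<phi> \<psi> P Q H K. chart f \<phi> \<psi> P Q H K \<and> p \<in> rect \<phi> P"
  shows "local_homeo ZT f"
proof -
  have loc: "\<exists>U. p \<in> U \<and> U \<subseteq> dom f \<and> openin ZT U \<and> openin ZT ((the \<circ> f) ` U) \<and>
      homeomorphic_map (subtopology ZT U) (subtopology ZT ((the \<circ> f) ` U)) (the \<circ> f)" if pf: "p \<in> dom f" for p
  proof -
    obtain \<phi> \<psi> P Q H K where c: "chart f \<phi> \<psi> P Q H K" and p: "p \<in> rect \<phi> P"
      using assms[OF pf] by blast
    have pm: "pmap \<phi>" "pmap \<psi>" and PQ: "openin PT P" "openin PT Q"
      and HK: "continuous_map (subtopology PT P) PT H" "continuous_map (subtopology PT Q) PT K"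
      and fwd: "\<And>x y. (x, y) \<in> rect \<phi> P \<Longrightarrow> \<exists>x'. hat \<phi> x = Some x' \<and> f (x, y) = Some (x', H y) \<and>
          (x', H y) \<in> rect \<psi> Q \<and> hat \<psi> x' = Some x \<and> K (H y) = y"
      and bwd: "\<And>x y. (x, y) \<in> rect \<psi> Q \<Longrightarrow> \<exists>x'. hat \<psi> x = Some x' \<and> (x', K y) \<in> rect \<phi> P \<and> f (x', K y) = Some (x, y)"
      using c unfolding chart_def by blast+
    let ?U = "rect \<phi> P" and ?W = "rect \<psi> Q"
    define g where "g = (\<lambda>(x, y). (the (hat \<psi> x), K y))"
    have UW: "openin ZT ?U" "openin ZT ?W" unfolding rect_def by (intro openin_Z_rect ind_dom pm PQ)+
    have cf: "continuous_map (subtopology ZT ?U) ZT (the \<circ> f)"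
    proof (rule continuous_Z_map[OF pm(1) HK(1)])
      show "y \<in> P \<and> x \<in> dom (hat \<phi>) \<and> (the (hat \<phi> x), H y) \<in> Z_set G" if "(x, y) \<in> ?U" for x y
        using fwd[OF that] that by (auto simp: rect_def)
      show "(the \<circ> f) (x, y) = (the (hat \<phi> x), H y)" if "(x, y) \<in> ?U" for x y
        using fwd[OF that] by auto
    qed (auto simp: rect_def)
    have cg: "continuous_map (subtopology ZT ?W) ZT g"
    proof (rule continuous_Z_map[OF pm(2) HK(2)])
      show "y \<in> Q \<and> x \<in> dom (hat \<psi>) \<and> (the (hat \<psi> x), K y) \<in> Z_set G" if "(x, y) \<in> ?W" for x y
        using bwd[OF that] that by (auto simp: rect_def)
    qed (auto simp: rect_def g_def)
    have fu: "the (f u) \<in> ?W \<and> g (the (f u)) = u" if "u \<in> ?U" for u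
      using fwd[of "fst u" "snd u"] that by (auto simp: g_def)
    have gw: "g w \<in> ?U \<and> the (f (g w)) = w" if "w \<in> ?W" for w
      using bwd[of "fst w" "snd w"] that by (cases w) (auto simp: g_def)
    have top: "topspace (subtopology ZT ?U) = ?U" "topspace (subtopology ZT ?W) = ?W"
      using openin_subset[OF UW(1)] openin_subset[OF UW(2)] by auto
    have "homeomorphic_maps (subtopology ZT ?U) (subtopology ZT ?W) (the \<circ> f) g"
      unfolding homeomorphic_maps_def top continuous_map_in_subtopology using cf cg fu gw by auto
    then have "homeomorphic_map (subtopology ZT ?U) (subtopology ZT ?W) (the \<circ> f)"
      by (rule homeomorphic_maps_imp_map)
    moreover have "(the \<circ> f) ` ?U = ?W" using fu gw by force
    moreover have "?U \<subseteq> dom f" using fwd by fast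
    ultimately show ?thesis using p UW by metis
  qed
  have "openin ZT (dom f)" by (subst openin_subopen) (use loc in blast)
  moreover have "openin ZT (ran f)"
  proof (subst openin_subopen, intro ballI)
    fix q assume "q \<in> ran f"
    then obtain p where p: "f p = Some q" by (auto simp: ran_def)
    then obtain U where U: "p \<in> U" "U \<subseteq> dom f" "openin ZT ((the \<circ> f) ` U)" using loc[of p] by blast
    moreover have "(the \<circ> f) ` U \<subseteq> ran f" using U(2) by (force simp: ran_def)
    moreover have "q \<in> (the \<circ> f) ` U" using U(1) p by force
    ultimately show "\<exists>T. openin ZT T \<and> q \<in> T \<and> T \<subseteq> ran f" by blast
  qed
  ultimately show ?thesis using loc unfolding local_homeo_def by blast
qed

text \<open>Where x has the right factor a = y0'(0, m), T divides x by a and puts a in front of y;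
  the inverse multiplies x by a and shifts, on paths that begin with a. As m is nonzero, a is a
  proper morphism.\<close>

lemma T_local_homeo:
  assumes m: "m \<noteq> 0"
  shows "local_homeo ZT (T_map G m)"
proof (rule local_homeo_charts)
  fix p assume "p \<in> dom (T_map G m)"
  then obtain x0 y0 x0' y0' where p: "p = (x0, y0)" and T: "T_map G m (x0, y0) = Some (x0', y0')"
    by (metis domD surj_pair)
  have xy0: "(x0, y0) \<in> Z_set G" "(x0', y0') \<in> Z_set G" "y0 = shift m y0'" "rmult G (seg y0' m) x0' = Some x0"
    using T by (auto simp: T_iff)
  have y0: "y0 \<in> paths G" "y0' \<in> paths G" using xy0 by (auto simp: Z_iff)
  define a where "a = y0' (0, m)"
  have a: "seg y0' m = Some a" "Some a \<in> L" "shape G a = m" "a \<in> mor G"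
    using m y0 seg_Some[OF y0(2)] seg_in[OF y0(2), of m] path0[OF y0(2)] unfolding a_def by metis+
  let ?\<phi> = "minv (rpm (Some a))" and ?\<psi> = "rpm (Some a)"
  \<comment> \<open>Paths that can be prefixed by \<open>a\<close>: an open set, on which prefixing
    is continuous.\<close>
  let ?P = "{y \<in> paths G. y (0, 0) = src G a}" and ?Q = "{y \<in> paths G. y (0, m) = a}"
  have hat: "hat ?\<psi> x' = Some x \<longleftrightarrow> rmult G (Some a) x' = Some x"
    "hat ?\<phi> x = Some x' \<longleftrightarrow> rmult G (Some a) x' = Some x" for x x'
    using rdiv_iff[OF a(2)] by (simp_all add: rmult_eq[OF a(2)] rdiv_def)
  have In: "In x (dom ?\<psi>)" "In x' (dom ?\<phi>)" if "rmult G (Some a) x = Some x'" for x x'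
    using that hat dom_hat by blast+
  have r0: "rmult G (Some a) x0' = Some x0" using xy0(4) a(1) by simp
  have "\<exists>x'. hat ?\<phi> x = Some x' \<and> T_map G m (x, y) = Some (x', concat_path G (Some a) y) \<and>
      (x', concat_path G (Some a) y) \<in> Z_set G \<and> In x' (dom ?\<psi>) \<and> concat_path G (Some a) y \<in> ?Q \<and>
      hat ?\<psi> x' = Some x \<and> shift m (concat_path G (Some a) y) = y"
    if xy: "(x, y) \<in> Z_set G" "In x (dom ?\<phi>)" for x y
  proof -
    obtain x' where h: "hat ?\<phi> x = Some x'" using xy dom_hat by (auto simp: Z_iff)
    then have r: "rmult G (Some a) x' = Some x" using hat by blast
    let ?y = "concat_path G (Some a) y"
    have c: "?y \<in> paths G" "seg ?y m = Some a" "shift m ?y = y" and Z: "(x', ?y) \<in> Z_set G"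
      using concat_in_Z(1-4)[OF a(2) r xy(1)] a(3) by (auto simp: bs_simps)
    have "T_map G m (x, y) = Some (x', ?y)" using xy Z c r by (simp add: T_iff)
    then show ?thesis using h r hat Z c In(1)[OF r] seg_Some[OF c(1), of m a] by simp
  qed
  moreover have "\<exists>x'. hat ?\<psi> x = Some x' \<and> (x', shift m y) \<in> Z_set G \<and> In x' (dom ?\<phi>) \<and> shift m y \<in> ?P \<and>
      T_map G m (x', shift m y) = Some (x, y)"
    if xy: "(x, y) \<in> Z_set G" "y \<in> ?Q" for x y
  proof -
    have s: "seg y m = Some a" using xy seg_Some m by blast
    obtain z where z: "rmult G (Some a) x = Some z" "(z, shift m y) \<in> Z_set G"
      using rmult_total[OF xy(1), of m] s by metis
    have "T_map G m (z, shift m y) = Some (x, y)" using z xy s by (simp add: T_iff)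
    then show ?thesis using z hat In(2)[OF z(1)] xy(2) src_shift[of y m] shift_in by auto
  qed
  moreover have "y0 (0, 0) = src G a" using src_shift[OF y0(2), of m] xy0(3) by (simp add: a_def)
  ultimately have "chart (T_map G m) ?\<phi> ?\<psi> ?P ?Q (concat_path G (Some a)) (shift m) \<and> p \<in> rect ?\<phi> ?P"
    using xy0(1) p y0 In(2)[OF r0] a
    by (simp add: chart_def rect_def pmap_mult openin_cyl src_tgt continuous_concat continuous_shift)
  then show "\<exists>\<phi> \<psi> P Q H K. chart (T_map G m) \<phi> \<psi> P Q H K \<and> p \<in> rect \<phi> P" by blast
qed

text \<open>Two data are frozen at the base point: the segment a of the path and the left factor
  \<nu> of x0 a. The domain of \<open>?\<phi>\<close> consists of the elements whose product with a
  has left factor \<nu>, and there V is multiplication by a, division by \<nu> and a shift.\<close>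

lemma V_local_homeo:
  assumes m: "m \<noteq> 0"
  shows "local_homeo ZT (V_map G m)"
proof (rule local_homeo_charts)
  fix p assume "p \<in> dom (V_map G m)"
  then obtain x0 y0 \<rho>0 u0 where p: "p = (x0, y0)" and V: "V_map G m (x0, y0) = Some (\<rho>0, u0)"
    by (metis domD surj_pair)
  obtain \<nu> z0 where Z0: "(x0, y0) \<in> Z_set G" and \<nu>: "\<nu> \<in> L" "bs \<nu> = m"
    and z0: "rmult G (seg y0 m) x0 = Some z0" "lmult G \<nu> \<rho>0 = Some z0"
    using V by (auto simp: V_iff)
  have y0: "y0 \<in> paths G" using Z0 by (simp add: Z_iff)
  define a where "a = y0 (0, m)"
  have a: "seg y0 m = Some a" "Some a \<in> L" "shape G a = m" "a \<in> mor G"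
    using m y0 seg_Some[OF y0] seg_in[OF y0, of m] path0[OF y0] unfolding a_def by metis+
  let ?\<phi> = "minv (lpm \<nu>) \<circ>\<^sub>m rpm (Some a)" and ?\<psi> = "minv (rpm (Some a)) \<circ>\<^sub>m lpm \<nu>"
  let ?P = "{y \<in> paths G. y (0, m) = a}" and ?Q = "{y \<in> paths G. y (0, 0) = src G a}"
  have pm: "pmap ?\<phi>" "pmap ?\<psi>"
    using pmap_mult[OF a(2)] pmap_mult[OF \<nu>(1)] by (auto intro: pmap_comp)
  have hat: "hat ?\<phi> x = Some \<rho> \<longleftrightarrow> (\<exists>z. rmult G (Some a) x = Some z \<and> lmult G \<nu> \<rho> = Some z)"
    "hat ?\<psi> \<rho> = Some x \<longleftrightarrow> (\<exists>z. rmult G (Some a) x = Some z \<and> lmult G \<nu> \<rho> = Some z)" for x \<rho>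
    using pmap_mult[OF a(2)] pmap_mult[OF \<nu>(1)] ldiv_iff[OF \<nu>(1)] rdiv_iff[OF a(2)]
    by (auto simp: hat_comp map_comp_Some rmult_eq[OF a(2)] lmult_eq[OF \<nu>(1)] ldiv_def rdiv_def)
  have In: "In x (dom ?\<phi>)" "In \<rho> (dom ?\<psi>)" if "hat ?\<phi> x = Some \<rho>" for x \<rho>
    using that hat dom_hat by blast+
  have "\<exists>\<rho>. hat ?\<phi> x = Some \<rho> \<and> V_map G m (x, y) = Some (\<rho>, shift m y) \<and> (\<rho>, shift m y) \<in> Z_set G \<and>
      In \<rho> (dom ?\<psi>) \<and> shift m y \<in> ?Q \<and> hat ?\<psi> \<rho> = Some x \<and> concat_path G (Some a) (shift m y) = y"
    if xy: "(x, y) \<in> Z_set G" "In x (dom ?\<phi>)" "y \<in> ?P" for x y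
  proof -
    have s: "seg y m = Some a" using xy seg_Some m by blast
    obtain \<rho> where \<rho>: "hat ?\<phi> x = Some \<rho>" using xy(1,2) dom_hat by (fastforce simp: Z_iff)
    then have V: "V_map G m (x, y) = Some (\<rho>, shift m y)" using hat(1)[of x \<rho>] xy(1) s \<nu> by (auto simp: V_iff)
    then have "(\<rho>, shift m y) \<in> Z_set G" using V_ran by (force simp: ran_def)
    moreover have "hat ?\<psi> \<rho> = Some x" using \<rho> hat by blast
    ultimately show ?thesis
      using \<rho> V In(2)[OF \<rho>] xy(3) src_shift[of y m] shift_in concat_path_eq[of y m] s by auto
  qed
  moreover have "\<exists>x. hat ?\<psi> \<rho> = Some x \<and> (x, concat_path G (Some a) y) \<in> Z_set G \<and> In x (dom ?\<phi>) \<and>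
      concat_path G (Some a) y \<in> ?P \<and> V_map G m (x, concat_path G (Some a) y) = Some (\<rho>, y)"
    if \<rho>y: "(\<rho>, y) \<in> Z_set G" "In \<rho> (dom ?\<psi>)" "y \<in> ?Q" for \<rho> y
  proof -
    obtain x where x: "hat ?\<psi> \<rho> = Some x" using \<rho>y(1,2) dom_hat by (fastforce simp: Z_iff)
    then obtain z where z: "rmult G (Some a) x = Some z" "lmult G \<nu> \<rho> = Some z" using hat by blast
    let ?y = "concat_path G (Some a) y"
    have c: "?y \<in> paths G" "seg ?y m = Some a" "shift m ?y = y"
      using concat_path_props[OF a(2), of y] \<rho>y(3) a(3) by (auto simp: bs_simps)
    then have e: "?y (0, m) = a" using seg_Some by blast
    then have "tgt G a = ?y (0, 0)" using path0(3)[OF c(1)] by metis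
    then have Z: "(x, ?y) \<in> Z_set G"
      using rmult_Some(1)[OF a(2) z(1)] c mult_in_X(2)[OF a(2) z(1)] by (simp add: Z_iff)
    have h: "hat ?\<phi> x = Some \<rho>" using z hat by blast
    have "V_map G m (x, ?y) = Some (\<rho>, y)" using Z c z \<nu> by (auto simp: V_iff)
    then show ?thesis using x Z c e In(1)[OF h] by simp
  qed
  moreover have "hat ?\<phi> x0 = Some \<rho>0" using hat z0 a(1) by auto
  ultimately have "chart (V_map G m) ?\<phi> ?\<psi> ?P ?Q (shift m) (concat_path G (Some a)) \<and> p \<in> rect ?\<phi> ?P"
    using Z0 p y0 In(1)[of x0 \<rho>0] a pm
    by (simp add: chart_def rect_def openin_cyl src_tgt continuous_concat continuous_shift a_def[symmetric])
  then show "\<exists>\<phi> \<psi> P Q H K. chart (V_map G m) \<phi> \<psi> P Q H K \<and> p \<in> rect \<phi> P" by blast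
qed

section \<open>The action, condition (DC) and the exit time\<close>

lemma mg_system_TV: "mg_system ZT (TV_system G)"
proof -
  have "T_map G m \<circ>\<^sub>m T_map G n = T_map G n \<circ>\<^sub>m T_map G m" "V_map G m \<circ>\<^sub>m V_map G n = V_map G n \<circ>\<^sub>m V_map G m" for m n
    by (simp_all add: T_add V_add add.commute)
  then have "TV_system G i \<circ>\<^sub>m TV_system G j = TV_system G j \<circ>\<^sub>m TV_system G i" for i j
    by (cases i; cases j) (simp_all add: TV_system_def T_V_commute)
  moreover have "local_homeo ZT (TV_system G i)" for i
    by (cases i) (simp_all add: TV_system_def T_local_homeo V_local_homeo unit_shape_nz)
  ultimately show ?thesis unfolding mg_system_def by blast
qed

text \<open>Induction over the set of generators already folded in, with exponent 0 on the others,
  keeps the composite in the normal form of one T after one V. A new T is absorbed by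
  \<open>T_add\<close>; a new V is first moved past T.\<close>

lemma mg_power_TV: "mg_power ZT (TV_system G) k = T_map G (k \<circ> Inl) \<circ>\<^sub>m V_map G (k \<circ> Inr)"
proof -
  let ?S = "TV_system G"
  have "comp_fun_commute (\<lambda>i H. ?S i \<circ>\<^sub>m H)"
  proof
    fix i j
    have "?S i \<circ>\<^sub>m ?S j = ?S j \<circ>\<^sub>m ?S i" using mg_system_TV by (simp add: mg_system_def)
    then show "(\<lambda>H. ?S j \<circ>\<^sub>m H) \<circ> (\<lambda>H. ?S i \<circ>\<^sub>m H) = (\<lambda>H. ?S i \<circ>\<^sub>m H) \<circ> (\<lambda>H. ?S j \<circ>\<^sub>m H)"
      by (intro ext) (simp flip: map_comp_assoc)
  qed
  then interpret comp_fun_commute "\<lambda>i. (\<lambda>H. ?S i \<circ>\<^sub>m H) ^^ k i"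
    by (rule comp_fun_commute.comp_fun_commute_funpow)
  define single :: "'r \<Rightarrow> nat \<Rightarrow> 'r shp" where "single a c = (\<lambda>j. if j = a then c else 0)" for a c
  have single: "single a (Suc c) = single a c + unit_shape a" "single a 0 = 0" for a c
    by (auto simp: single_def unit_shape_def fun_eq_iff)
  have powT: "((\<lambda>H. ?S (Inl a) \<circ>\<^sub>m H) ^^ c) (T_map G m \<circ>\<^sub>m V_map G n) = T_map G (m + single a c) \<circ>\<^sub>m V_map G n" for a c m n
  proof (induction c)
    case (Suc c)
    have "T_map G (unit_shape a) \<circ>\<^sub>m (T_map G (m + single a c) \<circ>\<^sub>m V_map G n) =
        T_map G (m + single a (Suc c)) \<circ>\<^sub>m V_map G n"
      unfolding map_comp_assoc[symmetric] T_add single by (simp only: add.assoc)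
    then show ?case unfolding funpow.simps comp_apply Suc.IH by (simp only: TV_system_def sum.case)
  qed (simp add: single)
  have powV: "((\<lambda>H. ?S (Inr a) \<circ>\<^sub>m H) ^^ c) (T_map G m \<circ>\<^sub>m V_map G n) = T_map G m \<circ>\<^sub>m V_map G (n + single a c)" for a c m n
  proof (induction c)
    case (Suc c)
    have "V_map G (unit_shape a) \<circ>\<^sub>m (T_map G m \<circ>\<^sub>m V_map G (n + single a c)) =
        T_map G m \<circ>\<^sub>m V_map G (n + single a (Suc c))"
      unfolding map_comp_assoc[symmetric] T_V_commute[symmetric]
      unfolding map_comp_assoc V_add single by (simp only: add.assoc)
    then show ?case unfolding funpow.simps comp_apply Suc.IH by (simp only: TV_system_def sum.case)
  qed (simp add: single)
  have fold: "Finite_Set.fold (\<lambda>i. (\<lambda>H. ?S i \<circ>\<^sub>m H) ^^ k i) (Some |` Z_set G) F =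
      T_map G (\<lambda>i. if Inl i \<in> F then k (Inl i) else 0) \<circ>\<^sub>m V_map G (\<lambda>i. if Inr i \<in> F then k (Inr i) else 0)"
    if "finite F" for F
    using that
  proof (induction F rule: finite_induct)
    case empty
    have "(\<lambda>i. if Inl i \<in> ({} :: ('r + 'r) set) then k (Inl i) else 0) = (0 :: 'r shp)"
      "(\<lambda>i. if Inr i \<in> ({} :: ('r + 'r) set) then k (Inr i) else 0) = (0 :: 'r shp)"
      by (simp_all add: fun_eq_iff)
    moreover have "T_map G 0 \<circ>\<^sub>m V_map G 0 = Some |` Z_set G"
      unfolding V_0 T_0[symmetric] T_add by simp
    ultimately show ?case by (simp only: fold_empty)
  next
    case (insert x F)
    show ?case
    proof (cases x)
      case (Inl a)
      have "(\<lambda>i. if Inl i \<in> insert x F then k (Inl i) else 0) = (\<lambda>i. if Inl i \<in> F then k (Inl i) else 0) + single a (k x)"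
        "(\<lambda>i. if Inr i \<in> insert x F then k (Inr i) else 0) = (\<lambda>i. if Inr i \<in> F then k (Inr i) else 0)"
        using insert(2) Inl by (auto simp: single_def fun_eq_iff)
      then show ?thesis using insert fold_insert powT Inl by simp
    next
      case (Inr a)
      have "(\<lambda>i. if Inr i \<in> insert x F then k (Inr i) else 0) = (\<lambda>i. if Inr i \<in> F then k (Inr i) else 0) + single a (k x)"
        "(\<lambda>i. if Inl i \<in> insert x F then k (Inl i) else 0) = (\<lambda>i. if Inl i \<in> F then k (Inl i) else 0)"
        using insert(2) Inr by (auto simp: single_def fun_eq_iff)
      then show ?thesis using insert fold_insert powV Inr by simp
    qed
  qed
  then show ?thesis unfolding mg_power_def topspace_ZT by (simp add: o_def)
qed

text \<open>The domain of a power depends only on its T-exponents, and shape at least m and at least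
  n is shape at least their maximum.\<close>

lemma DC_TV: "DC ZT (TV_system G)"
proof -
  have "shape_ge m \<inter> shape_ge n = shape_ge (sup m n)" for m n by (auto simp: shape_ge_def)
  then have "In x (shape_ge m) \<Longrightarrow> In x (shape_ge n) \<Longrightarrow> In x (shape_ge (sup m n))" if "x \<in> X" for x m n
    using In_Int[OF that ind_ge ind_ge] by metis
  moreover have "sup m n \<circ> f = sup (m \<circ> f) (n \<circ> f)" for m n :: "'r + 'r \<Rightarrow> nat" and f :: "'r \<Rightarrow> 'r + 'r"
    by (simp add: fun_eq_iff)
  ultimately show ?thesis unfolding DC_def mg_power_TV TV_dom by (auto simp: Z_iff)
qed

text \<open>The point is in the domain of \<open>T_map G m\<close> exactly when m is at most its
  shape, so the shape is an upper bound. It is the least one because the supremum is coordinatewise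
  and each finite value below a coordinate of the shape is attained.\<close>

lemma exit_time:
  assumes "(x, y) \<in> Z_set G"
  shows "Sup {(\<lambda>i. enat (m i)) |m. (x, y) \<in> dom (T_map G m)} = X_shape G x"
proof (rule antisym)
  have x: "x \<in> X" using assms by (simp add: Z_iff)
  have iff: "(x, y) \<in> dom (T_map G m) \<longleftrightarrow> (\<lambda>i. enat (m i)) \<le> X_shape G x" for m
    using X_shape_ge[OF x, of m] assms by (simp add: T_dom le_fun_def)
  show "Sup {(\<lambda>i. enat (m i)) |m. (x, y) \<in> dom (T_map G m)} \<le> X_shape G x"
    using iff by (intro Sup_least) auto
  show "X_shape G x \<le> Sup {(\<lambda>i. enat (m i)) |m. (x, y) \<in> dom (T_map G m)}" (is "_ \<le> ?R")
  proof (rule le_funI)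
    fix i
    have *: "enat n \<le> ?R i" if "enat n \<le> X_shape G x i" for n
    proof -
      \<comment> \<open>Concentrated in coordinate i, so that nothing is required of the other
        coordinates.\<close>
      let ?m = "\<lambda>j. if j = i then n else 0"
      have "(\<lambda>j. enat (?m j)) \<le> X_shape G x" using that by (auto simp: le_fun_def zero_enat_def[symmetric])
      then have "(x, y) \<in> dom (T_map G ?m)" by (rule iff[THEN iffD2])
      then have "(\<lambda>j. enat (?m j)) \<le> ?R" by (intro Sup_upper CollectI exI[of _ ?m]) simp
      then show ?thesis by (auto simp: le_fun_def dest: spec[of _ i])
    qed
    show "X_shape G x i \<le> ?R i"
    proof (cases "X_shape G x i")
      case (enat n) then show ?thesis using * by simp
    next
      case infinity
      then have "enat n \<le> ?R i" for n using * by simp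
      then show ?thesis by (cases "?R i") (metis enat_ord_simps(1) Suc_n_not_le_n, simp)
    qed
  qed
qed

end

theorem proposition3p3:
  fixes G :: "('a, 'r::finite) kgraph"
  assumes "rank_graph G"
    and "cond_F G"
  shows
    "(\<forall>m. ran (T_map G m) \<subseteq> Z_set G) \<and>
     (\<forall>m. dom (V_map G m) = Z_set G \<and> ran (V_map G m) \<subseteq> Z_set G) \<and>
     mg_system (Z_topology G) (TV_system G) \<and>
     (\<forall>m n. mg_power (Z_topology G) (TV_system G) (case_sum m 0) = T_map G m \<and>
            mg_power (Z_topology G) (TV_system G) (case_sum 0 n) = V_map G n \<and>
            mg_power (Z_topology G) (TV_system G) (case_sum m n) = T_map G m \<circ>\<^sub>m V_map G n) \<and>
     DC (Z_topology G) (TV_system G) \<and>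
     (\<forall>x y. (x, y) \<in> Z_set G \<longrightarrow>
        Sup {(\<lambda>i. enat (m i)) |m. (x, y) \<in> dom (T_map G m)} = X_shape G x)"
proof -
  interpret rank_graph_F G using assms by unfold_locales
  have c: "case_sum m n \<circ> Inl = m" "case_sum m n \<circ> Inr = n" for m n :: "'r shp" by auto
  have "mg_power (Z_topology G) (TV_system G) (case_sum m n) = T_map G m \<circ>\<^sub>m V_map G n" for m n
    unfolding mg_power_TV c ..
  \<comment> \<open>\<open>T_map G 0\<close> and \<open>V_map G 0\<close> are both the identity of
    Z, so either can stand for the other.\<close>
  moreover have "T_map G m \<circ>\<^sub>m V_map G 0 = T_map G m" for m
    by (metis T_0 V_0 T_add add_0)
  moreover have "T_map G 0 \<circ>\<^sub>m V_map G n = V_map G n" for n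
    by (metis T_0 V_0 V_add add_0_right)
  ultimately show ?thesis
    using T_ran V_dom V_ran mg_system_TV DC_TV exit_time by auto
qed

end
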